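(* Let $(M,g)$ be a smooth compact connected Riemannian manifold with nonempty boundary $\Sigma$. Let $p\in\Sigma$ and let $\varepsilon>0$, and let $B(p,\varepsilon)\subset M$ be the open ball of center $p$ and radius $\varepsilon$ for the distance of $(M,g)$. Then any Riemannian metric $g'$ on $M$ which coincides with $g$ on $B(p,\varepsilon)$ satisfies, for every integer $k\ge 1$, $$\sigma_k(M,g')\leq \lambda_k^D(B(p,\varepsilon),g),$$ where $\lambda_k^D(B(p,\varepsilon),g)$ is the $k$-th eigenvalue of the mixed Steklov-Dirichlet problem on $B(p,\varepsilon)$.
   Context: Riemannian metrics are smooth. Steklov eigenvalues: for a smooth compact connected Riemannian manifold $(M,g)$ with nonempty boundary $\Sigma$, these are the real numbers $\sigma$ for which there is a non-zero function $f:M\to\mathbb{R}$, harmonic with respect to $g$, with $\partial_\nu f=\sigma f$ on $\Sigma$, where $\partial_\nu$ is the outward normal derivative. They form a discrete sequence, indexed from $1$ and repeated according to multiplicity, $0=\sigma_1<\sigma_2\le\sigma_3\le\cdots\nearrow\infty$, with $\sigma_k=\sigma_k(M,g)$. Equivalently, $$\sigma_k(M,g)=\min_{E}\max_{0\neq f\in E}\frac{\int_M|df|_g^2\,dv_g}{\int_\Sigma f^2\,dv_g},$$ where $E$ ranges over $k$-dimensional linear subspaces of $C^\infty(M)$, the integral over $\Sigma$ is with respect to the induced Riemannian measure, and the quotient is $+\infty$ if $f$ is nonzero and vanishes on $\Sigma$. Mixed Steklov-Dirichlet problem on a domain $\Omega\subset M$: $$\Delta f=0\text{ in }\Omega,\qquad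 f=0\text{ on }\partial\Omega\setminus\Sigma,\qquad \partial_\nu f=\lambda f\text{ on }\partial\Omega\cap\Sigma.$$ Its eigenvalues $\lambda_1^D\le\lambda_2^D\le\cdots\nearrow\infty$, repeated according to multiplicity, are given by $$\lambda_k^D(\Omega,g)=\inf_{E}\max_{0\neq f\in E}\frac{\int_{\Omega}|df|_g^2\,dv_g}{\int_{\partial\Omega\cap\Sigma}f^2\,dv_g},$$ where $E$ ranges over $k$-dimensional linear spaces of smooth functions on $\overline\Omega$ (restrictions to $\overline\Omega$ of functions in $C^\infty(M)$) vanishing on $\partial\Omega\setminus\Sigma$, with the quotient equal to $+\infty$ when its denominator vanishes and $f\ne 0$. *)

theory Defs
  imports "HOL-Analysis.Analysis" "HOL-Library.Function_Algebras"
begin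

section \<open>Smooth manifolds with boundary\<close>

text \<open>
  The manifold is the whole type \<open>'a\<close>. The model space is \<open>'h \<times> real\<close> with \<open>'h\<close> a Euclidean space
  of dimension \<open>n - 1 \<ge> 1\<close>; charts take values in the half-space of points whose last coordinate is
  nonnegative. The dimension \<open>n \<ge> 2\<close> is therefore arbitrary (in dimension 1 there are only two
  Steklov eigenvalues).
\<close>

definition half_space :: "('h::euclidean_space \<times> real) set" where
  "half_space = {y. 0 \<le> snd y}"

primrec Ck_on :: "nat \<Rightarrow> ('b::real_normed_vector \<Rightarrow> 'c::real_normed_vector) \<Rightarrow> 'b set \<Rightarrow> bool" where
  "Ck_on 0 f V \<longleftrightarrow> continuous_on V f"
| "Ck_on (Suc k) f V \<longleftrightarrow> (\<forall>x\<in>V. f differentiable (at x)) \<and>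
     (\<forall>v. Ck_on k (\<lambda>x. frechet_derivative f (at x) v) V)"

text \<open>Smoothness at a point of a set that need not be open (here: relatively open in the half-space)
  means that there is a local smooth extension to an open set of the ambient vector space.\<close>

definition smooth_within ::
  "'b::real_normed_vector set \<Rightarrow> ('b \<Rightarrow> 'c::real_normed_vector) \<Rightarrow> 'b \<Rightarrow> bool" where
  "smooth_within S f y \<longleftrightarrow>
     (\<exists>V F. open V \<and> y \<in> V \<and> (\<forall>k. Ck_on k F V) \<and> (\<forall>z\<in>V \<inter> S. F z = f z))"

type_synonym ('a, 'h) chart = "'a set \<times> ('a \<Rightarrow> 'h \<times> real)"

abbreviation dom_chart :: "('a, 'h) chart \<Rightarrow> 'a set" where
  "dom_chart c \<equiv> fst c"

abbreviation coords :: "('a, 'h) chart \<Rightarrow> 'a \<Rightarrow> 'h \<times> real" where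
  "coords c \<equiv> snd c"

abbreviation param :: "('a, 'h) chart \<Rightarrow> 'h \<times> real \<Rightarrow> 'a" where
  "param c \<equiv> inv_into (dom_chart c) (coords c)"

definition is_chart :: "('a::topological_space, 'h::euclidean_space) chart \<Rightarrow> bool" where
  "is_chart c \<longleftrightarrow> open (dom_chart c) \<and>
     openin (top_of_set half_space) (coords c ` dom_chart c) \<and>
     homeomorphism (dom_chart c) (coords c ` dom_chart c) (coords c) (param c)"

definition smooth_atlas :: "('a::topological_space, 'h::euclidean_space) chart set \<Rightarrow> bool" where
  "smooth_atlas A \<longleftrightarrow> (\<forall>c\<in>A. is_chart c) \<and> (\<Union>c\<in>A. dom_chart c) = UNIV \<and>
     (\<forall>c\<in>A. \<forall>d\<in>A. \<forall>x\<in>dom_chart c \<inter> dom_chart d.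
        smooth_within (coords c ` (dom_chart c \<inter> dom_chart d)) (coords d \<circ> param c) (coords c x))"

definition manifold_boundary :: "('a, 'h) chart set \<Rightarrow> 'a set" where
  "manifold_boundary A = {x. \<exists>c\<in>A. x \<in> dom_chart c \<and> snd (coords c x) = 0}"

definition smooth_at ::
  "('a, 'h::euclidean_space) chart set \<Rightarrow> ('a \<Rightarrow> real) \<Rightarrow> 'a \<Rightarrow> bool" where
  "smooth_at A f x \<longleftrightarrow>
     (\<forall>c\<in>A. x \<in> dom_chart c \<longrightarrow>
        smooth_within (coords c ` dom_chart c) (f \<circ> param c) (coords c x))"

definition smooth_functions ::
  "('a, 'h::euclidean_space) chart set \<Rightarrow> ('a \<Rightarrow> real) set" where
  "smooth_functions A = {f. \<forall>x. smooth_at A f x}"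


section \<open>Tangent vectors and Riemannian metrics\<close>

text \<open>
  Tangent vectors are directional derivatives acting on the functions that are smooth near the base
  point. Functions not smooth near the base point are sent to 0, so that a tangent vector at \<open>x\<close>, as
  a functional, does not depend on the chart in which it is written. Because the charts take values
  in the half-space, the tangent space at a boundary point is also the full \<open>n\<close>-dimensional space.
\<close>

type_synonym 'a tangent = "('a \<Rightarrow> real) \<Rightarrow> real"

definition coord_vector ::
  "('a, 'h::euclidean_space) chart set \<Rightarrow> ('a, 'h) chart \<Rightarrow> 'a \<Rightarrow> 'h \<times> real \<Rightarrow> 'a tangent" where
  "coord_vector A c x u f =
     (if smooth_at A f x
      then frechet_derivative (f \<circ> param c) (at (coords c x) within half_space) u else 0)"

definition tangent_space ::
  "('a, 'h::euclidean_space) chart set \<Rightarrow> 'a \<Rightarrow> 'a tangent set" where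
  "tangent_space A x = {coord_vector A c x u | c u. c \<in> A \<and> x \<in> dom_chart c}"

type_synonym 'a metric_field = "'a \<Rightarrow> 'a tangent \<Rightarrow> 'a tangent \<Rightarrow> real"

definition metric_coeff ::
  "('a, 'h::euclidean_space) chart set \<Rightarrow> 'a metric_field \<Rightarrow> ('a, 'h) chart \<Rightarrow>
     'h \<times> real \<Rightarrow> 'h \<times> real \<Rightarrow> 'h \<times> real \<Rightarrow> real" where
  "metric_coeff A g c y u v =
     g (param c y) (coord_vector A c (param c y) u) (coord_vector A c (param c y) v)"

text \<open>Only the values of \<open>g x\<close> on tangent vectors at \<open>x\<close> are meaningful.\<close>

definition riemannian_metric ::
  "('a, 'h::euclidean_space) chart set \<Rightarrow> 'a metric_field \<Rightarrow> bool" where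
  "riemannian_metric A g \<longleftrightarrow>
     (\<forall>x. \<forall>X\<in>tangent_space A x. \<forall>Y\<in>tangent_space A x. g x X Y = g x Y X) \<and>
     (\<forall>x. \<forall>X\<in>tangent_space A x. \<forall>Y\<in>tangent_space A x. \<forall>Z\<in>tangent_space A x. \<forall>a b.
        g x (\<lambda>f. a * X f + b * Y f) Z = a * g x X Z + b * g x Y Z) \<and>
     (\<forall>x. \<forall>X\<in>tangent_space A x. X \<noteq> (\<lambda>f. 0) \<longrightarrow> 0 < g x X X) \<and>
     (\<forall>c\<in>A. \<forall>u v. \<forall>y\<in>coords c ` dom_chart c.
        smooth_within (coords c ` dom_chart c) (\<lambda>z. metric_coeff A g c z u v) y)"

definition metrics_agree_on ::
  "('a, 'h::euclidean_space) chart set \<Rightarrow> 'a set \<Rightarrow> 'a metric_field \<Rightarrow> 'a metric_field \<Rightarrow> bool" where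
  "metrics_agree_on A U g g' \<longleftrightarrow>
     (\<forall>x\<in>U. \<forall>X\<in>tangent_space A x. \<forall>Y\<in>tangent_space A x. g' x X Y = g x X Y)"

definition compact_riemannian_manifold ::
  "('a::{t2_space, second_countable_topology}, 'h::euclidean_space) chart set \<Rightarrow>
     'a metric_field \<Rightarrow> bool" where
  "compact_riemannian_manifold A g \<longleftrightarrow>
     compact (UNIV :: 'a set) \<and> connected (UNIV :: 'a set) \<and> smooth_atlas A \<and> riemannian_metric A g"


section \<open>Riemannian distance\<close>

definition piecewise_C1_path ::
  "('a::topological_space, 'h::euclidean_space) chart set \<Rightarrow> (real \<Rightarrow> 'a) \<Rightarrow> bool" where
  "piecewise_C1_path A \<gamma> \<longleftrightarrow> path \<gamma> \<and>
     (\<exists>S. finite S \<and>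
        (\<forall>c\<in>A. (coords c \<circ> \<gamma>) C1_differentiable_on {t \<in> {0..1} - S. \<gamma> t \<in> dom_chart c}))"

definition velocity ::
  "('a, 'h::euclidean_space) chart set \<Rightarrow> (real \<Rightarrow> 'a) \<Rightarrow> real \<Rightarrow> 'a tangent" where
  "velocity A \<gamma> t f =
     (if smooth_at A f (\<gamma> t) then vector_derivative (f \<circ> \<gamma>) (at t) else 0)"

definition path_length ::
  "('a, 'h::euclidean_space) chart set \<Rightarrow> 'a metric_field \<Rightarrow> (real \<Rightarrow> 'a) \<Rightarrow> ennreal" where
  "path_length A g \<gamma> =
     (\<integral>\<^sup>+t\<in>{0..1}. ennreal (sqrt (g (\<gamma> t) (velocity A \<gamma> t) (velocity A \<gamma> t))) \<partial>lborel)"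

definition riemannian_dist ::
  "('a::topological_space, 'h::euclidean_space) chart set \<Rightarrow> 'a metric_field \<Rightarrow> 'a \<Rightarrow> 'a \<Rightarrow> ennreal"
  where
  "riemannian_dist A g x y =
     (INF \<gamma>\<in>{\<gamma>. piecewise_C1_path A \<gamma> \<and> pathstart \<gamma> = x \<and> pathfinish \<gamma> = y}. path_length A g \<gamma>)"

definition riemannian_ball ::
  "('a::topological_space, 'h::euclidean_space) chart set \<Rightarrow> 'a metric_field \<Rightarrow> 'a \<Rightarrow> real \<Rightarrow> 'a set"
  where
  "riemannian_ball A g p \<epsilon> = {x. riemannian_dist A g p x < ennreal \<epsilon>}"


section \<open>Riemannian measure and induced boundary measure\<close>

text \<open>Determinant, by the Leibniz formula, of a matrix whose rows and columns are indexed by \<open>B\<close>.\<close>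

definition gram_det :: "'b set \<Rightarrow> ('b \<Rightarrow> 'b \<Rightarrow> real) \<Rightarrow> real" where
  "gram_det B q = (\<Sum>p | p permutes B. of_int (sign p) * (\<Prod>b\<in>B. q b (p b)))"

definition volume_density ::
  "('a, 'h::euclidean_space) chart set \<Rightarrow> 'a metric_field \<Rightarrow> ('a, 'h) chart \<Rightarrow> 'h \<times> real \<Rightarrow> real" where
  "volume_density A g c y = sqrt (gram_det Basis (metric_coeff A g c y))"

definition boundary_density ::
  "('a, 'h::euclidean_space) chart set \<Rightarrow> 'a metric_field \<Rightarrow> ('a, 'h) chart \<Rightarrow> 'h \<Rightarrow> real" where
  "boundary_density A g c z =
     sqrt (gram_det Basis (\<lambda>u v. metric_coeff A g c (z, 0) (u, 0) (v, 0)))"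

text \<open>
  The measures are glued from their expressions in charts along a finite measurable partition of the
  manifold subordinate to the atlas (a finite cover by chart domains, made disjoint). By the change
  of variables formula they do not depend on this choice.
\<close>

definition chart_cover :: "('a, 'h) chart set \<Rightarrow> ('a, 'h) chart list" where
  "chart_cover A = (SOME cs. set cs \<subseteq> A \<and> (\<Union>c\<in>set cs. dom_chart c) = UNIV)"

definition cover_piece :: "('a, 'h) chart list \<Rightarrow> nat \<Rightarrow> 'a set" where
  "cover_piece cs i = dom_chart (cs ! i) - (\<Union>j<i. dom_chart (cs ! j))"

definition riemannian_measure ::
  "('a::topological_space, 'h::euclidean_space) chart set \<Rightarrow> 'a metric_field \<Rightarrow> 'a measure" where
  "riemannian_measure A g =
     measure_of UNIV (sets borel) (\<lambda>B.
       \<Sum>i<length (chart_cover A).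
         let c = chart_cover A ! i in
         (\<integral>\<^sup>+y\<in>coords c ` (B \<inter> cover_piece (chart_cover A) i).
            ennreal (volume_density A g c y) \<partial>lborel))"

definition boundary_measure ::
  "('a::topological_space, 'h::euclidean_space) chart set \<Rightarrow> 'a metric_field \<Rightarrow> 'a measure" where
  "boundary_measure A g =
     measure_of UNIV (sets borel) (\<lambda>B.
       \<Sum>i<length (chart_cover A).
         let c = chart_cover A ! i in
         (\<integral>\<^sup>+z\<in>{z. (z, 0) \<in> coords c ` (B \<inter> cover_piece (chart_cover A) i)}.
            ennreal (boundary_density A g c z) \<partial>lborel))"


section \<open>Dirichlet energy and variational eigenvalues\<close>

text \<open>Square of the norm of \<open>df\<close> at \<open>x\<close>, dual to the norm of \<open>g x\<close> on the tangent space.\<close>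

definition differential_norm2 ::
  "('a, 'h::euclidean_space) chart set \<Rightarrow> 'a metric_field \<Rightarrow> ('a \<Rightarrow> real) \<Rightarrow> 'a \<Rightarrow> ennreal" where
  "differential_norm2 A g f x = (SUP X\<in>{X \<in> tangent_space A x. g x X X \<le> 1}. ennreal ((X f)\<^sup>2))"

definition energy ::
  "('a::topological_space, 'h::euclidean_space) chart set \<Rightarrow> 'a metric_field \<Rightarrow> 'a set \<Rightarrow>
     ('a \<Rightarrow> real) \<Rightarrow> ennreal" where
  "energy A g U f = (\<integral>\<^sup>+x\<in>U. differential_norm2 A g f x \<partial>riemannian_measure A g)"

definition boundary_norm2 ::
  "('a::topological_space, 'h::euclidean_space) chart set \<Rightarrow> 'a metric_field \<Rightarrow> 'a set \<Rightarrow>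
     ('a \<Rightarrow> real) \<Rightarrow> ennreal" where
  "boundary_norm2 A g S f = (\<integral>\<^sup>+x\<in>S. ennreal ((f x)\<^sup>2) \<partial>boundary_measure A g)"

text \<open>The case distinction is needed: \<open>0 / 0 = 0\<close> in \<^typ>\<open>ennreal\<close>.\<close>

definition rayleigh :: "ennreal \<Rightarrow> ennreal \<Rightarrow> ennreal" where
  "rayleigh num den = (if den = 0 then \<infinity> else num / den)"

definition fun_scale :: "real \<Rightarrow> ('a \<Rightarrow> real) \<Rightarrow> 'a \<Rightarrow> real" where
  "fun_scale a f = (\<lambda>x. a * f x)"

interpretation fun_space: vector_space fun_scale
  by unfold_locales (auto simp: fun_scale_def fun_eq_iff algebra_simps)

text \<open>\<^const>\<open>fun_space.dim\<close> is 0 on infinite-dimensional spaces; the definitions below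
  are used for \<open>k \<ge> 1\<close>.\<close>

definition steklov_eigenvalue ::
  "('a::topological_space, 'h::euclidean_space) chart set \<Rightarrow> 'a metric_field \<Rightarrow> nat \<Rightarrow> ennreal" where
  "steklov_eigenvalue A g k =
     (INF E\<in>{E. fun_space.subspace E \<and> fun_space.dim E = k \<and> E \<subseteq> smooth_functions A}.
        SUP f\<in>E - {0}.
          rayleigh (energy A g UNIV f) (boundary_norm2 A g (manifold_boundary A) f))"

text \<open>
  The boundary of \<open>\<Omega>\<close> as a domain of a manifold with boundary: besides the topological frontier,
  it contains the points of \<open>\<Omega>\<close> lying on the boundary of the manifold.
\<close>

definition domain_boundary :: "('a::topological_space, 'h) chart set \<Rightarrow> 'a set \<Rightarrow> 'a set" where
  "domain_boundary A \<Omega> = closure \<Omega> - (\<Omega> - manifold_boundary A)"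

text \<open>Functions on \<open>closure \<Omega>\<close> are represented by their extension by 0.\<close>

definition dirichlet_functions ::
  "('a::topological_space, 'h::euclidean_space) chart set \<Rightarrow> 'a set \<Rightarrow> ('a \<Rightarrow> real) set" where
  "dirichlet_functions A \<Omega> =
     {\<lambda>x. if x \<in> closure \<Omega> then f x else 0 | f.
        f \<in> smooth_functions A \<and> (\<forall>x\<in>domain_boundary A \<Omega> - manifold_boundary A. f x = 0)}"

definition mixed_eigenvalue ::
  "('a::topological_space, 'h::euclidean_space) chart set \<Rightarrow> 'a metric_field \<Rightarrow> 'a set \<Rightarrow> nat \<Rightarrow>
     ennreal" where
  "mixed_eigenvalue A g \<Omega> k =
     (INF E\<in>{E. fun_space.subspace E \<and> fun_space.dim E = k \<and> E \<subseteq> dirichlet_functions A \<Omega>}.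
        SUP f\<in>E - {0}.
          rayleigh (energy A g \<Omega> f)
            (boundary_norm2 A g (domain_boundary A \<Omega> \<inter> manifold_boundary A) f))"

end

theory Submission
  imports Defs "HOL-Real_Asymp.Real_Asymp" "HOL-Computational_Algebra.Polynomial"
begin

text \<open>
  The ball \<open>U = B(p, \<epsilon>)\<close> is open and \<open>g' = g\<close> on its closure, so the inequality would be trivial if
  extension by zero mapped the Dirichlet functions of \<open>U\<close> into \<open>C\<^sup>\<infinity>(M)\<close>; it does not, but
  the extensions are continuous. Given a \<open>k\<close>-dimensional space \<open>E\<close> of them with basis \<open>B\<close>, let
  \<open>s = \<Sum>b\<^sup>2\<close> over \<open>b \<in> B\<close>, and multiply \<open>E\<close> by the single function \<open>\<psi>\<^sub>m(s)\<close>, where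
  \<open>\<psi>\<^sub>m(s) = exp(-1 / (m s - 1))\<close> for \<open>m s > 1\<close> and \<open>0\<close> otherwise. The products vanish near the zeros
  of \<open>s\<close>, hence are smooth on \<open>M\<close>, and they again form a linear space. Since
  \<open>s \<psi>\<^sub>m'(s)\<close> is bounded and tends to \<open>0\<close> pointwise, the error term
  \<open>f d(\<psi>\<^sub>m(s))\<close>, bounded by \<open>2 |a| s \<psi>\<^sub>m'(s) |dB|\<close> for \<open>f = \<Sum>a\<^sub>b b\<close>, tends to \<open>0\<close> in \<open>L\<^sup>2\<close>,
  while the boundary norms converge because the boundary has finite measure; both uniformly in
  \<open>|a| = 1\<close>. Thus the suprema of the Rayleigh quotients on the new spaces are eventually at most
  that on \<open>E\<close> plus any given positive number.
\<close>

section \<open>Smooth functions and a flat cutoff\<close>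

text \<open>Truncating each function of \<open>E\<close> by its own values would not be a linear
  operation, so the image of \<open>E\<close> would not be a competitor space. One common multiplier
  built from \<open>s\<close> is linear in \<open>f\<close>, and \<open>s\<close> serves every
  \<open>f\<close> at once: it vanishes exactly where all of \<open>E\<close> does, and
  \<open>f^2 \<le> |a|^2 s\<close>. The multipliers are rescalings of one flat function, so the
  bound on \<open>s \<psi>'(s)\<close> does not depend on \<open>m\<close>, and the products are
  smooth whatever the zero set of \<open>s\<close> looks like.

  The ball enters the estimates as an open set \<open>U\<close> whose frontier may be arbitrary: of
  positive measure, or meeting \<open>\<Sigma>\<close> in any way. Points of \<open>\<Sigma>\<close>
  may lie in the interior of \<open>closure U\<close> without lying in \<open>U\<close>, and there
  the functions need not vanish; at the other points of \<open>\<Sigma>\<close> on the frontier they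
  do, by connectedness.

  The errors are controlled in terms of \<open>|a|^2\<close>, but a Rayleigh quotient compares with
  the boundary norm of \<open>f\<close>. A finite supremum on \<open>E\<close> forces this norm to
  be positive definite on \<open>E\<close>, hence at least a positive multiple of
  \<open>|a|^2\<close>, and this allows one \<open>m\<close> for all of \<open>E\<close>.\<close>

lemma Ck_on_cong:
  assumes "open V" "\<And>x. x \<in> V \<Longrightarrow> f x = g x" "Ck_on k f V"
  shows "Ck_on k g V"
  using assms
proof (induction k arbitrary: f g)
  case 0
  then show ?case by (auto cong: continuous_on_cong)
next
  case (Suc k)
  have d: "g differentiable (at x)" if "x \<in> V" for x
    using Suc.prems that
    by (metis Ck_on.simps(2) differentiable_def has_derivative_transform_within_open)
  have fr: "frechet_derivative f (at x) = frechet_derivative g (at x)" if "x \<in> V" for x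
    using Suc.prems that by (metis Ck_on.simps(2) frechet_derivative_transform_within_open)
  show ?case
    using Suc.prems d fr Suc.IH[of "\<lambda>x. frechet_derivative f (at x) v" "\<lambda>x. frechet_derivative g (at x) v" for v]
    by auto
qed

lemma Ck_on_subset: "Ck_on k f V \<Longrightarrow> U \<subseteq> V \<Longrightarrow> Ck_on k f U"
  by (induction k arbitrary: f) (auto intro: continuous_on_subset)

lemma Ck_on_SucD: "Ck_on (Suc k) f V \<Longrightarrow> Ck_on k f V"
proof (induction k arbitrary: f)
  case 0
  then show ?case
    by (auto simp: continuous_at_imp_continuous_on differentiable_imp_continuous_within)
qed auto

lemma Ck_on_has_derivative:
  assumes "Ck_on (Suc k) f V" "x \<in> V"
  shows "(f has_derivative frechet_derivative f (at x)) (at x)"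
  using assms frechet_derivative_works by auto

text \<open>Lets closure proofs exhibit the derivative by a formula; on an open set it must agree
  with the chosen \<open>frechet_derivative\<close>.\<close>

lemma Ck_on_SucI:
  assumes "open V" "\<And>x. x \<in> V \<Longrightarrow> (f has_derivative f' x) (at x)" "\<And>v. Ck_on k (\<lambda>x. f' x v) V"
  shows "Ck_on (Suc k) f V"
proof -
  have *: "frechet_derivative f (at x) = f' x" if "x \<in> V" for x
    using assms(2)[OF that] frechet_derivative_at by metis
  have "Ck_on k (\<lambda>x. frechet_derivative f (at x) v) V" for v
    by (rule Ck_on_cong[OF assms(1) _ assms(3)[of v]]) (simp add: *)
  then show ?thesis using assms(2) by (auto simp: differentiable_def)
qed

lemma Ck_on_const: "open V \<Longrightarrow> Ck_on k (\<lambda>x. c) V"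
proof (induction k arbitrary: c)
  case (Suc k)
  show ?case
    by (rule Ck_on_SucI[where f'="\<lambda>x v. 0"]) (use Suc in auto)
qed auto

lemma Ck_on_add:
  assumes "open V" "Ck_on k f V" "Ck_on k g V"
  shows "Ck_on k (\<lambda>x. f x + g x) V"
  using assms(2,3)
proof (induction k arbitrary: f g)
  case 0
  then show ?case by (auto intro: continuous_on_add)
next
  case (Suc k)
  show ?case
  proof (rule Ck_on_SucI[OF assms(1)])
    show "((\<lambda>x. f x + g x) has_derivative
        (\<lambda>v. frechet_derivative f (at x) v + frechet_derivative g (at x) v)) (at x)" if "x \<in> V" for x
      by (intro has_derivative_add Ck_on_has_derivative[OF _ that]) (use Suc.prems in blast)+
    show "Ck_on k (\<lambda>x. frechet_derivative f (at x) v + frechet_derivative g (at x) v) V" for v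
      using Suc by auto
  qed
qed

lemma Ck_on_mult:
  fixes f g :: "'b::real_normed_vector \<Rightarrow> real"
  assumes "open V" "Ck_on k f V" "Ck_on k g V"
  shows "Ck_on k (\<lambda>x. f x * g x) V"
  using assms(2,3)
proof (induction k arbitrary: f g)
  case 0
  then show ?case by (auto intro: continuous_on_mult)
next
  case (Suc k)
  show ?case
  proof (rule Ck_on_SucI[OF assms(1)])
    show "((\<lambda>x. f x * g x) has_derivative
        (\<lambda>v. f x * frechet_derivative g (at x) v + frechet_derivative f (at x) v * g x)) (at x)"
      if "x \<in> V" for x
      by (intro has_derivative_mult Ck_on_has_derivative[OF _ that]) (use Suc.prems in blast)+
    show "Ck_on k (\<lambda>x. f x * frechet_derivative g (at x) v + frechet_derivative f (at x) v * g x) V" for v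
      using Suc.IH Suc.prems Ck_on_SucD[OF Suc.prems(1)] Ck_on_SucD[OF Suc.prems(2)]
      by (intro Ck_on_add[OF assms(1)]) auto
  qed
qed

text \<open>The family \<open>H\<close> of successive derivatives replaces a higher chain rule:
  differentiating \<open>H n\<close> after \<open>f\<close> produces \<open>H (Suc n)\<close> after
  \<open>f\<close> times a derivative of \<open>f\<close>, so the induction on \<open>k\<close>
  leaves \<open>n\<close> free.\<close>

lemma Ck_on_compose_real:
  fixes H :: "nat \<Rightarrow> real \<Rightarrow> real"
  assumes "open V" "Ck_on k f V" "\<And>n x. (H n has_real_derivative H (Suc n) x) (at x)"
  shows "Ck_on k (\<lambda>x. H n (f x)) V"
  using assms(2)
proof (induction k arbitrary: n)
  case 0
  have "continuous_on UNIV (H n)"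
    using assms(3) DERIV_isCont continuous_at_imp_continuous_on by blast
  then show ?case using 0 continuous_on_compose2 by fastforce
next
  case (Suc k)
  show ?case
  proof (rule Ck_on_SucI[OF assms(1)])
    show "((\<lambda>x. H n (f x)) has_derivative
        (\<lambda>v. H (Suc n) (f x) * frechet_derivative f (at x) v)) (at x)" if "x \<in> V" for x
      using has_derivative_compose[OF Ck_on_has_derivative[OF Suc.prems that]
          assms(3)[unfolded has_field_derivative_def], of n] .
    show "Ck_on k (\<lambda>x. H (Suc n) (f x) * frechet_derivative f (at x) v) V" for v
      by (rule Ck_on_mult[OF assms(1) Suc.IH[OF Ck_on_SucD[OF Suc.prems]]]) (use Suc.prems in auto)
  qed
qed

section \<open>The flat function exp(-1/x) and its rescalings\<close>

text \<open>With \<open>t = 1 / x\<close> one has \<open>d/dx = - t^2 d/dt\<close>, so the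
  derivative of \<open>exp (- t) p(t)\<close> in \<open>x\<close> is
  \<open>exp (- t) t^2 (p(t) - p'(t))\<close>. These are the polynomial factors of the derivatives
  of \<open>exp (- 1 / x)\<close>.\<close>

primrec flat_poly :: "nat \<Rightarrow> real poly" where
  "flat_poly 0 = 1"
| "flat_poly (Suc n) = [:0, 0, 1:] * (flat_poly n - pderiv (flat_poly n))"

definition flat :: "nat \<Rightarrow> real \<Rightarrow> real" where
  "flat n x = (if 0 < x then exp (- (1 / x)) * poly (flat_poly n) (1 / x) else 0)"

lemma exp_poly_tendsto_0: "((\<lambda>t::real. exp (- t) * poly q t) \<longlongrightarrow> 0) at_top"
proof -
  have "((\<lambda>t. \<Sum>i\<le>degree q. coeff q i * (t ^ i / exp t)) \<longlongrightarrow> (\<Sum>i\<le>degree q. coeff q i * 0)) at_top"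
    by (intro tendsto_sum tendsto_mult tendsto_const tendsto_power_div_exp_0)
  then show ?thesis
    by (simp add: poly_altdef sum_distrib_left exp_minus field_simps)
qed

lemma DERIV_flat: "(flat n has_real_derivative flat (Suc n) x) (at x)"
proof -
  consider "x > 0" | "x < 0" | "x = 0" by linarith
  then show ?thesis
  proof cases
    case 1
    have i: "((\<lambda>x. 1 / x) has_real_derivative - (1 / x\<^sup>2)) (at x)"
      using 1 by (auto intro!: derivative_eq_intros simp: power2_eq_square)
    have e: "((\<lambda>x. exp (- (1 / x))) has_real_derivative exp (- (1 / x)) * (1 / x\<^sup>2)) (at x)"
      using DERIV_chain2[OF DERIV_exp DERIV_minus[OF i]] by simp
    have q: "((\<lambda>x. poly (flat_poly n) (1 / x)) has_real_derivative
        poly (pderiv (flat_poly n)) (1 / x) * - (1 / x\<^sup>2)) (at x)"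
      by (rule DERIV_chain2[OF poly_DERIV i])
    have "((\<lambda>x. exp (- (1 / x)) * poly (flat_poly n) (1 / x)) has_real_derivative flat (Suc n) x) (at x)"
      using 1 by (intro DERIV_cong[OF DERIV_mult[OF e q]])
        (simp add: flat_def power2_eq_square algebra_simps)
    then show ?thesis
      by (rule has_field_derivative_transform_within_open[where S="{0<..}"]) (use 1 in \<open>auto simp: flat_def\<close>)
  next
    case 2
    have "((\<lambda>x. 0) has_real_derivative flat (Suc n) x) (at x)"
      using 2 by (auto simp: flat_def)
    then show ?thesis
      by (rule has_field_derivative_transform_within_open[where S="{..<0}"]) (use 2 in \<open>auto simp: flat_def\<close>)
  next
    case 3
    \<comment> \<open>In \<open>t = 1 / h\<close> the right difference quotient at 0 is
      \<open>exp (- t)\<close> times the polynomial \<open>t p(t)\<close>, so it decays as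
      \<open>t\<close> grows.\<close>
    have r: "((\<lambda>h. flat n h / h) \<longlongrightarrow> 0) (at_right 0)"
    proof -
      have "((\<lambda>t. exp (- t) * poly ([:0,1:] * flat_poly n) t) \<longlongrightarrow> 0) at_top"
        by (rule exp_poly_tendsto_0)
      then have "((\<lambda>h. exp (- inverse h) * poly ([:0,1:] * flat_poly n) (inverse h)) \<longlongrightarrow> 0) (at_right 0)"
        using filterlim_compose[OF _ filterlim_inverse_at_top_right] by blast
      then show ?thesis
        by (rule Lim_transform_eventually)
          (auto simp: eventually_at_filter flat_def field_simps)
    qed
    have l: "((\<lambda>h. flat n h / h) \<longlongrightarrow> 0) (at_left 0)"
      by (rule Lim_transform_eventually[OF tendsto_const]) (auto simp: eventually_at_filter flat_def)
    have "((\<lambda>h. flat n h / h) \<longlongrightarrow> 0) (at 0)"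
      using r l by (simp add: filterlim_split_at)
    then show ?thesis
      using 3 by (simp add: has_field_derivative_iff flat_def)
  qed
qed

definition cutoff :: "nat \<Rightarrow> real \<Rightarrow> real" where
  "cutoff m s = flat 0 (real m * s - 1)"

definition cutoff' :: "nat \<Rightarrow> real \<Rightarrow> real" where
  "cutoff' m s = real m * flat (Suc 0) (real m * s - 1)"

lemma flat_0: "flat 0 x = (if 0 < x then exp (- (1 / x)) else 0)"
  by (simp add: flat_def)

lemma flat_1: "flat (Suc 0) x = (if 0 < x then exp (- (1 / x)) / x\<^sup>2 else 0)"
  by (simp add: flat_def power2_eq_square)

lemma DERIV_cutoff: "(cutoff m has_real_derivative cutoff' m s) (at s)"
  unfolding cutoff_def[abs_def] cutoff'_def
  by (rule DERIV_chain2[OF DERIV_flat[of 0, simplified], THEN DERIV_cong])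
     (auto intro!: derivative_eq_intros)

lemma Ck_on_cutoff:
  assumes "open V" "Ck_on k f V"
  shows "Ck_on k (\<lambda>x. cutoff m (f x)) V"
proof -
  have "Ck_on k (\<lambda>x. real m * f x + (- 1)) V"
    by (intro Ck_on_add Ck_on_mult Ck_on_const assms)
  then have "Ck_on k (\<lambda>x. flat 0 (real m * f x + (- 1))) V"
    by (rule Ck_on_compose_real[where H=flat, OF assms(1) _ DERIV_flat])
  then show ?thesis by (simp add: cutoff_def)
qed

lemma cutoff_nonneg: "0 \<le> cutoff m s" and cutoff_le_1: "cutoff m s \<le> 1"
  by (auto simp: cutoff_def flat_0)

lemma cutoff_eq_0: "s * real m \<le> 1 \<Longrightarrow> cutoff m s = 0"
  by (auto simp: cutoff_def flat_0 algebra_simps)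

lemma cutoff_tendsto_1:
  assumes "0 < s" shows "(\<lambda>m. cutoff m s) \<longlonglongrightarrow> 1"
proof -
  have l: "filterlim (\<lambda>m. real m * s - 1) at_top sequentially"
    using assms by real_asymp
  have "((\<lambda>t::real. exp (- (1 / t))) \<longlongrightarrow> 1) at_top" by real_asymp
  then have "((\<lambda>t::real. flat 0 t) \<longlongrightarrow> 1) at_top"
    by (rule Lim_transform_eventually)
       (rule eventually_mono[OF eventually_gt_at_top[of 0]], simp add: flat_0)
  then show ?thesis
    unfolding cutoff_def by (rule filterlim_compose[OF _ l])
qed

definition cutoff_err :: "nat \<Rightarrow> real \<Rightarrow> real" where
  "cutoff_err m s = s * cutoff' m s"

text \<open>Scale invariance: the error depends on \<open>m\<close> and \<open>s\<close> only
  through \<open>t = m s - 1\<close>, so one bound in \<open>t\<close> serves all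
  \<open>m\<close>.\<close>

lemma cutoff_err_eq: "cutoff_err m s = (let t = real m * s - 1 in (t + 1) * flat (Suc 0) t)"
  by (simp add: cutoff_err_def cutoff'_def Let_def)

lemma cutoff_err_nonneg: "0 \<le> cutoff_err m s"
proof -
  have "0 \<le> (t + 1) * flat (Suc 0) t" for t :: real
    by (cases "t > 0") (simp_all add: flat_1)
  then show ?thesis by (simp only: cutoff_err_eq Let_def)
qed

text \<open>With \<open>r = 1 / t\<close> the error is \<open>(r + r^2) exp (- r)\<close>, and twice
  the quadratic Taylor polynomial of \<open>exp\<close> dominates \<open>r + r^2\<close>; hence the
  constant 2.\<close>

lemma cutoff_err_le: "cutoff_err m s \<le> 2"
proof -
  have "(t + 1) * (exp (- (1 / t)) / t\<^sup>2) \<le> 2" if "t > 0" for t :: real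
  proof -
    define r where "r = 1 / t"
    have r: "r > 0" "t = 1 / r" using that by (auto simp: r_def)
    have "(r + r\<^sup>2) \<le> 2 * (1 + r + r\<^sup>2 / 2)" using r by (simp add: field_simps)
    also have "\<dots> \<le> 2 * exp r" using exp_lower_Taylor_quadratic[of r] r by simp
    finally have "(r + r\<^sup>2) / exp r \<le> 2" by (simp add: divide_le_eq)
    moreover have "(t + 1) * (exp (- (1 / t)) / t\<^sup>2) = (r + r\<^sup>2) / exp r"
      using r(1) unfolding r(2) by (simp add: power2_eq_square exp_minus field_simps)
    ultimately show ?thesis by simp
  qed
  then have "(t + 1) * flat (Suc 0) t \<le> 2" for t :: real
    by (cases "t > 0") (simp_all add: flat_1)
  then show ?thesis by (simp only: cutoff_err_eq Let_def)
qed

lemma cutoff_err_0 [simp]: "cutoff_err m 0 = 0"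
  by (simp add: cutoff_err_def)

lemma cutoff_err_tendsto_0: 
  assumes "0 \<le> s" shows "(\<lambda>m. cutoff_err m s) \<longlonglongrightarrow> 0"
proof (cases "s = 0")
  case False
  then have s: "s > 0" using assms by simp
  have l: "filterlim (\<lambda>m. real m * s - 1) at_top sequentially"
    using s by real_asymp
  have "((\<lambda>t::real. (t + 1) * (exp (- (1 / t)) / t\<^sup>2)) \<longlongrightarrow> 0) at_top" by real_asymp
  then have "((\<lambda>t::real. (t + 1) * flat (Suc 0) t) \<longlongrightarrow> 0) at_top"
    by (rule Lim_transform_eventually)
       (rule eventually_mono[OF eventually_gt_at_top[of 0]], simp add: flat_1)
  then show ?thesis
    unfolding cutoff_err_eq Let_def by (rule filterlim_compose[OF _ l])
qed simp

lemma continuous_on_cutoff: "continuous_on S f \<Longrightarrow> continuous_on S (\<lambda>x. cutoff m (f x))"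
  and continuous_on_cutoff_err: "continuous_on S f \<Longrightarrow> continuous_on S (\<lambda>x. cutoff_err m (f x))"
proof -
  have "continuous_on UNIV (cutoff m)"
    by (intro continuous_at_imp_continuous_on ballI DERIV_isCont[OF DERIV_cutoff])
  then show "continuous_on S f \<Longrightarrow> continuous_on S (\<lambda>x. cutoff m (f x))"
    by (rule continuous_on_compose2) auto
  have "continuous_on UNIV (flat (Suc 0))"
    by (intro continuous_at_imp_continuous_on ballI DERIV_isCont[OF DERIV_flat])
  then have "continuous_on UNIV (\<lambda>s. flat (Suc 0) (real m * s - 1))"
    by (rule continuous_on_compose2[where f="\<lambda>s. real m * s - 1"])
       (simp_all add: continuous_on_diff continuous_on_mult_left)
  then have "continuous_on UNIV (cutoff_err m)"
    unfolding cutoff_err_def[abs_def] cutoff'_def by (intro continuous_on_mult continuous_on_const continuous_on_id)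
  then show "continuous_on S f \<Longrightarrow> continuous_on S (\<lambda>x. cutoff_err m (f x))"
    by (rule continuous_on_compose2) auto
qed

section \<open>Charts and tangent vectors\<close>

abbreviation image_chart :: "('a, 'h) chart \<Rightarrow> ('h \<times> real) set" where
  "image_chart c \<equiv> coords c ` dom_chart c"

text \<open>From any point of the half-space a short positive step along each basis vector stays
  inside, and these directions determine a linear map. So derivatives within the half-space are
  unique even at its boundary.\<close>

lemma half_space_derivative_unique:
  fixes f :: "'h::euclidean_space \<times> real \<Rightarrow> 'b::real_normed_vector"
  assumes "y \<in> half_space" "(f has_derivative D) (at y within half_space)"
    "(f has_derivative D') (at y within half_space)"
  shows "D = D'"
proof (rule frechet_derivative_unique_within[OF assms(2,3)])
  fix i :: "'h \<times> real" and e :: real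
  assume i: "i \<in> Basis" and e: "0 < e"
  have "0 \<le> snd i"
    using i by (auto simp: Basis_prod_def)
  then show "\<exists>d. 0 < \<bar>d\<bar> \<and> \<bar>d\<bar> < e \<and> y + d *\<^sub>R i \<in> half_space"
    using assms(1) e by (intro exI[of _ "e/2"]) (auto simp: half_space_def)
qed

lemma convex_half_space: "convex (half_space :: ('h::euclidean_space \<times> real) set)"
  by (auto simp: convex_def half_space_def)

lemma closed_half_space: "closed (half_space :: ('h::euclidean_space \<times> real) set)"
  unfolding half_space_def by (intro closed_Collect_le continuous_intros)

lemma at_within_half_space_open:
  assumes "open V" "y \<in> V"
  shows "at y within V \<inter> half_space = at y within half_space"
  using assms by (intro at_within_nhd[of y V]) auto

lemma has_derivative_half_space_cong:
  assumes "(f has_derivative D) (at y within half_space)" "open W" "y \<in> W" "y \<in> half_space"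
    and "\<And>z. z \<in> W \<Longrightarrow> z \<in> half_space \<Longrightarrow> f z = h z"
  shows "(h has_derivative D) (at y within half_space)"
proof -
  have "(f has_derivative D) (at y within W \<inter> half_space)"
    using assms(1) by (simp add: at_within_half_space_open[OF assms(2,3)])
  then have "(h has_derivative D) (at y within W \<inter> half_space)"
    by (rule has_derivative_transform[rotated 2]) (use assms in auto)
  then show ?thesis by (simp add: at_within_half_space_open[OF assms(2,3)])
qed

text \<open>Together with uniqueness of derivatives in the half-space, this makes the differential
  at a boundary point independent of the local extension.\<close>

lemma extension_has_derivative:
  assumes "open V" "y \<in> V" "\<And>k. Ck_on k F V" "y \<in> half_space"
    and "\<And>z. z \<in> V \<Longrightarrow> z \<in> half_space \<Longrightarrow> F z = h z"
  shows "(h has_derivative frechet_derivative F (at y)) (at y within half_space)"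
  using has_derivative_at_withinI[OF Ck_on_has_derivative[OF assms(3,2)]] assms
  by (intro has_derivative_half_space_cong[of F _ y V h]) auto

lemma smooth_withinI:
  assumes "open V" "y \<in> V" "\<And>k. Ck_on k F V" "\<And>z. z \<in> V \<Longrightarrow> z \<in> S \<Longrightarrow> F z = f z"
  shows "smooth_within S f y"
  using assms unfolding smooth_within_def by blast

lemma smooth_within_local:
  assumes "smooth_within S f y" "open W" "y \<in> W" "\<And>z. z \<in> W \<Longrightarrow> z \<in> S' \<Longrightarrow> z \<in> S \<and> f z = g z"
  shows "smooth_within S' g y"
proof -
  obtain V F where "open V" "y \<in> V" "\<And>k. Ck_on k F V" "\<forall>z\<in>V \<inter> S. F z = f z"
    using assms(1) unfolding smooth_within_def by blast
  then show ?thesis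
    using assms by (intro smooth_withinI[of "V \<inter> W" y F]) (auto intro: Ck_on_subset)
qed

lemma smooth_within_const: "smooth_within S (\<lambda>x. c) y"
  by (rule smooth_withinI[of UNIV y "\<lambda>x. c"]) (auto intro: Ck_on_const)

lemma smooth_within_add:
  assumes "smooth_within S f y" "smooth_within S g y"
  shows "smooth_within S (\<lambda>x. f x + g x) y"
proof -
  obtain V F W G where V: "open V" "y \<in> V" "\<And>k. Ck_on k F V" "\<forall>z\<in>V \<inter> S. F z = f z"
     and W: "open W" "y \<in> W" "\<And>k. Ck_on k G W" "\<forall>z\<in>W \<inter> S. G z = g z"
    using assms unfolding smooth_within_def by blast
  show ?thesis
  proof (rule smooth_withinI[of "V \<inter> W" y "\<lambda>x. F x + G x"])
    show "Ck_on k (\<lambda>x. F x + G x) (V \<inter> W)" for k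
      by (intro Ck_on_add) (use V W in \<open>auto intro: Ck_on_subset\<close>)
  qed (use V W in auto)
qed

lemma smooth_within_mult:
  fixes f g :: "'b::real_normed_vector \<Rightarrow> real"
  assumes "smooth_within S f y" "smooth_within S g y"
  shows "smooth_within S (\<lambda>x. f x * g x) y"
proof -
  obtain V F W G where V: "open V" "y \<in> V" "\<And>k. Ck_on k F V" "\<forall>z\<in>V \<inter> S. F z = f z"
     and W: "open W" "y \<in> W" "\<And>k. Ck_on k G W" "\<forall>z\<in>W \<inter> S. G z = g z"
    using assms unfolding smooth_within_def by blast
  show ?thesis
  proof (rule smooth_withinI[of "V \<inter> W" y "\<lambda>x. F x * G x"])
    show "Ck_on k (\<lambda>x. F x * G x) (V \<inter> W)" for k
      by (intro Ck_on_mult) (use V W in \<open>auto intro: Ck_on_subset\<close>)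
  qed (use V W in auto)
qed

lemma smooth_within_cutoff:
  assumes "smooth_within S f y"
  shows "smooth_within S (\<lambda>x. cutoff m (f x)) y"
proof -
  obtain V F where V: "open V" "y \<in> V" "\<And>k. Ck_on k F V" "\<forall>z\<in>V \<inter> S. F z = f z"
    using assms unfolding smooth_within_def by blast
  then show ?thesis
    by (intro smooth_withinI[of V y "\<lambda>x. cutoff m (F x)"]) (auto intro: Ck_on_cutoff)
qed

lemma smooth_within_continuous:
  assumes "smooth_within S f y" "y \<in> S"
  shows "continuous (at y within S) f"
proof -
  obtain V F where V: "open V" "y \<in> V" "\<And>k. Ck_on k F V" "\<forall>z\<in>V \<inter> S. F z = f z"
    using assms unfolding smooth_within_def by blast
  have "continuous (at y within S) F"
    using V(1,2) V(3)[of 0] by (auto simp: continuous_on_eq_continuous_at continuous_at_imp_continuous_within)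
  moreover have "\<forall>\<^sub>F z in at y within S. F z = f z"
    using V unfolding eventually_at_topological by auto
  ultimately show ?thesis
    using V assms(2) by (auto simp: continuous_within intro: Lim_transform_eventually)
qed


section \<open>Smoothness of functions at a point of the manifold\<close>

text \<open>The cut functions will be smooth for different reasons near different points, so
  smoothness has to depend on the germ only. The charts carry a neighbourhood of \<open>x\<close> to
  a relatively open set.\<close>

lemma smooth_at_cong:
  assumes "smooth_at A f x" "open U" "x \<in> U" "\<And>z. z \<in> U \<Longrightarrow> f z = g z" "\<And>c. c \<in> A \<Longrightarrow> is_chart c"
  shows "smooth_at A g x"
  unfolding smooth_at_def
proof (intro ballI impI)
  fix c assume c: "c \<in> A" "x \<in> dom_chart c"
  have ch: "is_chart c" using assms c by auto
  have hom: "homeomorphism (dom_chart c) (image_chart c) (coords c) (param c)"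
    using ch by (auto simp: is_chart_def)
  have "openin (top_of_set (image_chart c)) (image_chart c \<inter> param c -` U)"
    using continuous_on_open[THEN iffD1, of "image_chart c" "param c"] hom assms(2) ch
    by (meson continuous_openin_preimage_gen homeomorphism_cont2)
  then obtain W where W: "open W" "image_chart c \<inter> param c -` U = image_chart c \<inter> W"
    by (auto simp: openin_open)
  show "smooth_within (image_chart c) (g \<circ> param c) (coords c x)"
  proof (rule smooth_within_local[where W=W])
    show "smooth_within (image_chart c) (f \<circ> param c) (coords c x)"
      using assms(1) c by (auto simp: smooth_at_def)
    show "coords c x \<in> W"
      using W c assms(3) hom by (auto simp: homeomorphism_def)
    show "z \<in> image_chart c \<and> (f \<circ> param c) z = (g \<circ> param c) z" if "z \<in> W" "z \<in> image_chart c" for z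
      using W that assms(4) by auto
  qed (use W in auto)
qed

lemma smooth_at_const: "smooth_at A (\<lambda>x. c) x"
  unfolding smooth_at_def comp_def by (simp add: smooth_within_const)

lemma smooth_at_add: "smooth_at A f x \<Longrightarrow> smooth_at A g x \<Longrightarrow> smooth_at A (\<lambda>x. f x + g x) x"
  unfolding smooth_at_def comp_def by (simp add: smooth_within_add)

lemma smooth_at_mult: "smooth_at A f x \<Longrightarrow> smooth_at A g x \<Longrightarrow> smooth_at A (\<lambda>x. f x * g x) x"
  unfolding smooth_at_def comp_def by (simp add: smooth_within_mult)

lemma smooth_at_cutoff: "smooth_at A f x \<Longrightarrow> smooth_at A (\<lambda>x. cutoff m (f x)) x"
  unfolding smooth_at_def comp_def by (simp add: smooth_within_cutoff)

lemma smooth_at_sum: "(\<And>i. i \<in> I \<Longrightarrow> smooth_at A (f i) x) \<Longrightarrow> smooth_at A (\<lambda>x. \<Sum>i\<in>I. f i x) x"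
  by (induction I rule: infinite_finite_induct) (auto intro: smooth_at_add smooth_at_const)

section \<open>Differential calculus in the charts of a manifold with boundary\<close>

locale manifold =
  fixes A :: "('a::{t2_space, second_countable_topology}, 'h::euclidean_space) chart set"
  assumes atlas: "smooth_atlas A"
begin

lemma chart: "c \<in> A \<Longrightarrow> is_chart c"
  using atlas by (auto simp: smooth_atlas_def)

lemma chart_at: obtains c where "c \<in> A" "x \<in> dom_chart c"
  using atlas unfolding smooth_atlas_def by blast

lemma open_dom: "c \<in> A \<Longrightarrow> open (dom_chart c)"
  using chart by (auto simp: is_chart_def)

lemma homeo: "c \<in> A \<Longrightarrow> homeomorphism (dom_chart c) (image_chart c) (coords c) (param c)"
  using chart by (auto simp: is_chart_def)

lemma param_coords [simp]: "c \<in> A \<Longrightarrow> x \<in> dom_chart c \<Longrightarrow> param c (coords c x) = x"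
  using homeomorphism_apply1[OF homeo] homeomorphism_apply2[OF homeo] by simp

lemma coords_param [simp]: "c \<in> A \<Longrightarrow> y \<in> image_chart c \<Longrightarrow> coords c (param c y) = y"
  using homeomorphism_apply1[OF homeo] homeomorphism_apply2[OF homeo] by simp

lemma param_dom [simp]: "c \<in> A \<Longrightarrow> y \<in> image_chart c \<Longrightarrow> param c y \<in> dom_chart c"
  by (rule inv_into_into)

lemma continuous_coords: "c \<in> A \<Longrightarrow> continuous_on (dom_chart c) (coords c)"
  and continuous_param: "c \<in> A \<Longrightarrow> continuous_on (image_chart c) (param c)"
  by (auto intro: homeomorphism_cont1[OF homeo] homeomorphism_cont2[OF homeo])

lemma image_half_space: "c \<in> A \<Longrightarrow> image_chart c \<subseteq> half_space"
  using chart openin_imp_subset unfolding is_chart_def by blast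

lemma coords_half_space: "c \<in> A \<Longrightarrow> x \<in> dom_chart c \<Longrightarrow> coords c x \<in> half_space"
  using image_half_space by blast

lemma image_open:
  assumes "c \<in> A" "open U"
  obtains W where "open W" "coords c ` (dom_chart c \<inter> U) = half_space \<inter> W"
proof -
  have "openin (top_of_set (image_chart c)) (image_chart c \<inter> param c -` U)"
    using continuous_param[OF assms(1)] assms(2) continuous_openin_preimage_gen by blast
  moreover have "image_chart c \<inter> param c -` U = coords c ` (dom_chart c \<inter> U)"
    using assms(1) by auto
  ultimately have "openin (top_of_set half_space) (coords c ` (dom_chart c \<inter> U))"
    using chart[OF assms(1)] openin_trans by (auto simp: is_chart_def)
  then show ?thesis using that by (auto simp: openin_open)
qed

text \<open>Relatively open images are presented as traces on the half-space of an ambient open set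
  \<open>W\<close>, the form in which local derivative rules apply.\<close>

lemma coords_open_image:
  assumes "c \<in> A" "open U"
  obtains W where "open W" "\<And>z. z \<in> W \<Longrightarrow> z \<in> half_space \<Longrightarrow> z \<in> image_chart c \<and> param c z \<in> U"
    "\<And>x. x \<in> dom_chart c \<Longrightarrow> x \<in> U \<Longrightarrow> coords c x \<in> W"
proof -
  obtain W where W: "open W" "coords c ` (dom_chart c \<inter> U) = half_space \<inter> W"
    using image_open[OF assms] .
  show ?thesis
  proof (rule that[OF W(1)])
    fix z :: "'h \<times> real" assume "z \<in> W" "z \<in> half_space"
    then have "z \<in> coords c ` (dom_chart c \<inter> U)" using W by blast
    then show "z \<in> image_chart c \<and> param c z \<in> U" using assms(1) by auto
  next
    fix x assume "x \<in> dom_chart c" "x \<in> U"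
    then have "coords c x \<in> coords c ` (dom_chart c \<inter> U)" by blast
    then show "coords c x \<in> W" using W by blast
  qed
qed

lemma open_param_image:
  assumes "c \<in> A" "open W"
  shows "open (dom_chart c \<inter> coords c -` W)"
  using continuous_on_open_vimage[THEN iffD1, OF open_dom continuous_coords] assms
  by (simp add: Int_commute)

lemma smooth_at_cong_local:
  assumes "smooth_at A f x" "open U" "x \<in> U" "\<And>z. z \<in> U \<Longrightarrow> f z = g z"
  shows "smooth_at A g x"
  using smooth_at_cong[OF assms] chart by blast

lemma smooth_at_extension:
  assumes "c \<in> A" "x \<in> dom_chart c" "smooth_at A f x" "open U" "x \<in> U"
  obtains V F where "open V" "coords c x \<in> V" "\<And>k. Ck_on k F V"
    "\<And>z. z \<in> V \<Longrightarrow> z \<in> half_space \<Longrightarrow> z \<in> image_chart c \<and> param c z \<in> U \<and> F z = f (param c z)"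
proof -
  obtain W where W: "open W" "\<And>z. z \<in> W \<Longrightarrow> z \<in> half_space \<Longrightarrow> z \<in> image_chart c \<and> param c z \<in> U"
    "\<And>x. x \<in> dom_chart c \<Longrightarrow> x \<in> U \<Longrightarrow> coords c x \<in> W"
    using coords_open_image[OF assms(1,4)] by blast
  obtain V F where V: "open V" "coords c x \<in> V" "\<And>k. Ck_on k F V"
     "\<forall>z\<in>V \<inter> image_chart c. F z = (f \<circ> param c) z"
    using assms unfolding smooth_at_def smooth_within_def by blast
  show ?thesis
    by (rule that[of "V \<inter> W" F], goal_cases)
      (use W V assms in \<open>auto intro: Ck_on_subset[OF V(3)]\<close>)
qed

lemma transition_extension:
  assumes "c \<in> A" "d \<in> A" "x \<in> dom_chart c" "x \<in> dom_chart d"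
  obtains V F where "open V" "coords c x \<in> V" "\<And>k. Ck_on k F V"
    "\<And>z. z \<in> V \<Longrightarrow> z \<in> half_space \<Longrightarrow>
      z \<in> image_chart c \<and> param c z \<in> dom_chart d \<and> F z = coords d (param c z)"
proof -
  obtain W where W: "open W" "\<And>z. z \<in> W \<Longrightarrow> z \<in> half_space \<Longrightarrow> z \<in> image_chart c \<and> param c z \<in> dom_chart d"
    "\<And>x. x \<in> dom_chart c \<Longrightarrow> x \<in> dom_chart d \<Longrightarrow> coords c x \<in> W"
    using coords_open_image[OF assms(1) open_dom[OF assms(2)]] by blast
  have "smooth_within (coords c ` (dom_chart c \<inter> dom_chart d)) (coords d \<circ> param c) (coords c x)"
    using atlas assms by (auto simp: smooth_atlas_def)
  then obtain V F where V: "open V" "coords c x \<in> V" "\<And>k. Ck_on k F V"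
     "\<forall>z\<in>V \<inter> coords c ` (dom_chart c \<inter> dom_chart d). F z = (coords d \<circ> param c) z"
    unfolding smooth_within_def by blast
  have *: "F z = coords d (param c z)" if "z \<in> V" "z \<in> W" "z \<in> half_space" for z
  proof -
    have "z \<in> coords c ` (dom_chart c \<inter> dom_chart d)"
      using W(2)[OF that(2,3)] assms(1) by (auto intro!: image_eqI[of _ _ "param c z"])
    then show ?thesis using V(4) that by auto
  qed
  show ?thesis
    by (rule that[of "V \<inter> W" F], goal_cases)
      (use W V assms * in \<open>auto intro: Ck_on_subset[OF V(3)]\<close>)
qed

lemma transition_has_derivative:
  assumes "c \<in> A" "d \<in> A" "x \<in> dom_chart c" "x \<in> dom_chart d"
  obtains T where "(coords d \<circ> param c has_derivative T) (at (coords c x) within half_space)"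
proof -
  obtain V F where V: "open V" "coords c x \<in> V" "\<And>k. Ck_on k F V"
    "\<And>z. z \<in> V \<Longrightarrow> z \<in> half_space \<Longrightarrow>
      z \<in> image_chart c \<and> param c z \<in> dom_chart d \<and> F z = coords d (param c z)"
    using transition_extension[OF assms] by blast
  show ?thesis
    by (rule that, rule extension_has_derivative[OF V(1-3) coords_half_space[OF assms(1,3)]])
      (use V(4) in auto)
qed

text \<open>\<open>coord_vector\<close> is defined through the choice in
  \<open>frechet_derivative\<close>; uniqueness in the half-space identifies that choice with any
  derivative at hand.\<close>

lemma coord_vector_eq:
  assumes "c \<in> A" "x \<in> dom_chart c" "smooth_at A f x"
    "(f \<circ> param c has_derivative D) (at (coords c x) within half_space)"
  shows "coord_vector A c x u f = D u"
proof -
  have "(f \<circ> param c has_derivative frechet_derivative (f \<circ> param c) (at (coords c x) within half_space))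
      (at (coords c x) within half_space)"
    using assms(4) frechet_derivative_works differentiable_def by blast
  then have "frechet_derivative (f \<circ> param c) (at (coords c x) within half_space) = D"
    using half_space_derivative_unique coords_half_space[OF assms(1,2)] assms(4) by blast
  then show ?thesis using assms(3) by (simp add: coord_vector_def)
qed

lemma coord_vector_extension:
  assumes "c \<in> A" "x \<in> dom_chart c" "smooth_at A f x"
    and V: "open V" "coords c x \<in> V" "\<And>k. Ck_on k F V"
    and F: "\<And>z. z \<in> V \<Longrightarrow> z \<in> half_space \<Longrightarrow> F z = f (param c z)"
  shows "coord_vector A c x u f = frechet_derivative F (at (coords c x)) u"
  by (rule coord_vector_eq[OF assms(1-3)], rule extension_has_derivative[OF V coords_half_space[OF assms(1,2)]])
    (simp add: F)

lemma smooth_has_derivative: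
  assumes "c \<in> A" "x \<in> dom_chart c" "smooth_at A f x"
  obtains D where "(f \<circ> param c has_derivative D) (at (coords c x) within half_space)"
    "\<And>u. coord_vector A c x u f = D u"
proof -
  obtain V F where V: "open V" "coords c x \<in> V" "\<And>k. Ck_on k F V"
    "\<And>z. z \<in> V \<Longrightarrow> z \<in> half_space \<Longrightarrow> z \<in> image_chart c \<and> param c z \<in> UNIV \<and> F z = f (param c z)"
    using smooth_at_extension[OF assms open_UNIV] by blast
  have D: "(f \<circ> param c has_derivative frechet_derivative F (at (coords c x))) (at (coords c x) within half_space)"
    by (rule extension_has_derivative[OF V(1-3) coords_half_space[OF assms(1,2)]]) (simp add: V(4))
  show ?thesis by (rule that[OF D coord_vector_eq[OF assms D]])
qed

lemma coord_vector_not_smooth: "\<not> smooth_at A f x \<Longrightarrow> coord_vector A c x u f = 0"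
  by (simp add: coord_vector_def)

text \<open>An equality of functionals, as the linearity clause of \<open>riemannian_metric\<close>
  requires; on functions not smooth at \<open>x\<close> all terms are the default 0.\<close>

lemma coord_vector_lincomb:
  assumes "c \<in> A" "x \<in> dom_chart c"
  shows "coord_vector A c x (a *\<^sub>R u + b *\<^sub>R v) =
    (\<lambda>f. a * coord_vector A c x u f + b * coord_vector A c x v f)"
proof
  fix f
  show "coord_vector A c x (a *\<^sub>R u + b *\<^sub>R v) f = a * coord_vector A c x u f + b * coord_vector A c x v f"
  proof (cases "smooth_at A f x")
    case True
    from smooth_has_derivative[OF assms True] obtain D where
      D: "(f \<circ> param c has_derivative D) (at (coords c x) within half_space)"
      "\<And>u. coord_vector A c x u f = D u" by blast
    interpret bounded_linear D using D(1) by (rule has_derivative_bounded_linear)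
    show ?thesis by (simp add: D(2) add scaleR)
  qed (simp add: coord_vector_not_smooth)
qed

lemma coord_vector_add:
  assumes "c \<in> A" "x \<in> dom_chart c" "smooth_at A f x" "smooth_at A g x"
  shows "coord_vector A c x u (\<lambda>x. f x + g x) = coord_vector A c x u f + coord_vector A c x u g"
proof -
  obtain D where D: "(f \<circ> param c has_derivative D) (at (coords c x) within half_space)"
      "\<And>u. coord_vector A c x u f = D u" using smooth_has_derivative[OF assms(1-3)] by blast
  obtain E where E: "(g \<circ> param c has_derivative E) (at (coords c x) within half_space)"
      "\<And>u. coord_vector A c x u g = E u" using smooth_has_derivative[OF assms(1,2,4)] by blast
  have "((\<lambda>x. f x + g x) \<circ> param c has_derivative (\<lambda>u. D u + E u)) (at (coords c x) within half_space)"
    using has_derivative_add[OF D(1) E(1)] by (simp add: comp_def)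
  then show ?thesis
    using coord_vector_eq[OF assms(1,2) smooth_at_add[OF assms(3,4)]] D E by simp
qed

lemma coord_vector_mult:
  assumes "c \<in> A" "x \<in> dom_chart c" "smooth_at A f x" "smooth_at A g x"
  shows "coord_vector A c x u (\<lambda>x. f x * g x) = f x * coord_vector A c x u g + coord_vector A c x u f * g x"
proof -
  obtain D where D: "(f \<circ> param c has_derivative D) (at (coords c x) within half_space)"
      "\<And>u. coord_vector A c x u f = D u" using smooth_has_derivative[OF assms(1-3)] by blast
  obtain E where E: "(g \<circ> param c has_derivative E) (at (coords c x) within half_space)"
      "\<And>u. coord_vector A c x u g = E u" using smooth_has_derivative[OF assms(1,2,4)] by blast
  have "((\<lambda>x. f x * g x) \<circ> param c has_derivative (\<lambda>u. f x * E u + D u * g x)) (at (coords c x) within half_space)"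
    using has_derivative_mult[OF D(1) E(1)] assms(1,2) by (simp add: comp_def)
  then show ?thesis
    using coord_vector_eq[OF assms(1,2) smooth_at_mult[OF assms(3,4)]] D E by simp
qed

lemma coord_vector_const:
  assumes "c \<in> A" "x \<in> dom_chart c"
  shows "coord_vector A c x u (\<lambda>x. k) = 0"
  using coord_vector_eq[OF assms smooth_at_const, of k "\<lambda>u. 0"] by (simp add: comp_def)

lemma coord_vector_sum:
  assumes "c \<in> A" "x \<in> dom_chart c" "\<And>i. i \<in> I \<Longrightarrow> smooth_at A (f i) x"
  shows "coord_vector A c x u (\<lambda>x. \<Sum>i\<in>I. f i x) = (\<Sum>i\<in>I. coord_vector A c x u (f i))"
  using assms(3)
proof (induction I rule: infinite_finite_induct)
  case (insert i I)
  then have "smooth_at A (\<lambda>x. \<Sum>i\<in>I. f i x) x" by (intro smooth_at_sum) auto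
  then show ?case using insert by (simp add: coord_vector_add[OF assms(1,2)])
qed (simp_all add: coord_vector_const[OF assms(1,2)])

lemma coord_vector_cutoff:
  assumes "c \<in> A" "x \<in> dom_chart c" "smooth_at A f x"
  shows "coord_vector A c x u (\<lambda>x. cutoff m (f x)) = cutoff' m (f x) * coord_vector A c x u f"
proof -
  obtain D where D: "(f \<circ> param c has_derivative D) (at (coords c x) within half_space)"
      "\<And>u. coord_vector A c x u f = D u" using smooth_has_derivative[OF assms(1-3)] by blast
  have "(cutoff m has_derivative (*) (cutoff' m (f x))) (at ((f \<circ> param c) (coords c x)))"
    using DERIV_cutoff[of m "f x"] assms(1,2) by (simp add: has_field_derivative_def)
  then have "((\<lambda>x. cutoff m (f x)) \<circ> param c has_derivative (\<lambda>u. cutoff' m (f x) * D u)) (at (coords c x) within half_space)"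
    using has_derivative_compose[OF D(1)] by (simp add: comp_def)
  then show ?thesis
    using coord_vector_eq[OF assms(1,2) smooth_at_cutoff[OF assms(3)]] D by simp
qed

text \<open>Smoothness is local too: if one function fails to be smooth at \<open>x\<close>, so does
  the other, and both values are the default 0.\<close>

lemma coord_vector_cong:
  assumes "c \<in> A" "x \<in> dom_chart c" "open U" "x \<in> U" "\<And>z. z \<in> U \<Longrightarrow> f z = g z"
  shows "coord_vector A c x u f = coord_vector A c x u g"
proof (cases "smooth_at A f x")
  case True
  have sg: "smooth_at A g x" using smooth_at_cong_local[OF True] assms by blast
  obtain D where D: "(f \<circ> param c has_derivative D) (at (coords c x) within half_space)"
      "\<And>u. coord_vector A c x u f = D u" using smooth_has_derivative[OF assms(1,2) True] by blast
  obtain W where W: "open W" "\<And>z. z \<in> W \<Longrightarrow> z \<in> half_space \<Longrightarrow> z \<in> image_chart c \<and> param c z \<in> U"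
    "\<And>x. x \<in> dom_chart c \<Longrightarrow> x \<in> U \<Longrightarrow> coords c x \<in> W"
    using coords_open_image[OF assms(1,3)] by blast
  have "(g \<circ> param c has_derivative D) (at (coords c x) within half_space)"
    by (rule has_derivative_half_space_cong[OF D(1) W(1)]) (use W assms coords_half_space in auto)
  then show ?thesis using coord_vector_eq[OF assms(1,2) sg] D(2) by simp
next
  case False
  moreover have "\<not> smooth_at A g x"
    using smooth_at_cong_local[of g x U f] False assms by auto
  ultimately show ?thesis by (simp add: coord_vector_not_smooth)
qed

text \<open>Stated for any \<open>h\<close> that corresponds to \<open>f\<close> on the overlap:
  with \<open>h\<close> a function read in the chart \<open>c\<close> it gives the change of tangent
  vectors, with \<open>h\<close> the identity the invertibility of the differential of a transition
  map.\<close>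

lemma transition_chain:
  assumes "c \<in> A" "d \<in> A" "x \<in> dom_chart c" "x \<in> dom_chart d"
    and T: "(coords d \<circ> param c has_derivative T) (at (coords c x) within half_space)"
    and D: "(f has_derivative D) (at (coords d x) within half_space)"
    and h: "\<And>y. y \<in> dom_chart c \<Longrightarrow> y \<in> dom_chart d \<Longrightarrow> f (coords d y) = h (coords c y)"
  shows "(h has_derivative (\<lambda>u. D (T u))) (at (coords c x) within half_space)"
proof -
  obtain W where W: "open W" "\<And>z. z \<in> W \<Longrightarrow> z \<in> half_space \<Longrightarrow> z \<in> image_chart c \<and> param c z \<in> dom_chart d"
    "\<And>x. x \<in> dom_chart c \<Longrightarrow> x \<in> dom_chart d \<Longrightarrow> coords c x \<in> W"
    using coords_open_image[OF assms(1) open_dom[OF assms(2)]] by blast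
  have xW: "coords c x \<in> W" using W assms by blast
  have T': "(coords d \<circ> param c has_derivative T) (at (coords c x) within W \<inter> half_space)"
    using T by (simp add: at_within_half_space_open[OF W(1) xW])
  have img: "(coords d \<circ> param c) ` (W \<inter> half_space) \<subseteq> half_space"
    using W(2) coords_half_space[OF assms(2)] by auto
  have D': "(f has_derivative D) (at ((coords d \<circ> param c) (coords c x)) within (coords d \<circ> param c) ` (W \<inter> half_space))"
    using D has_derivative_subset[OF _ img] assms by simp
  have "((\<lambda>y. f ((coords d \<circ> param c) y)) has_derivative (\<lambda>u. D (T u))) (at (coords c x) within half_space)"
    using has_derivative_in_compose[OF T' D'] by (simp add: at_within_half_space_open[OF W(1) xW])
  then show ?thesis
  proof (rule has_derivative_half_space_cong[OF _ W(1) xW coords_half_space[OF assms(1,3)]])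
    fix z assume "z \<in> W" "z \<in> half_space"
    then have z: "z \<in> image_chart c" "param c z \<in> dom_chart d" using W(2) by blast+
    show "f ((coords d \<circ> param c) z) = h z"
      using h[OF param_dom[OF assms(1) z(1)] z(2)] by (simp add: assms(1) z)
  qed
qed

lemma coord_vector_change:
  assumes "c \<in> A" "d \<in> A" "x \<in> dom_chart c" "x \<in> dom_chart d"
    "(coords d \<circ> param c has_derivative T) (at (coords c x) within half_space)"
  shows "coord_vector A c x u = coord_vector A d x (T u)"
proof
  fix f
  show "coord_vector A c x u f = coord_vector A d x (T u) f"
  proof (cases "smooth_at A f x")
    case True
    obtain D where D: "(f \<circ> param d has_derivative D) (at (coords d x) within half_space)"
      "\<And>u. coord_vector A d x u f = D u" using smooth_has_derivative[OF assms(2,4) True] by blast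
    have "(f \<circ> param c has_derivative (\<lambda>u. D (T u))) (at (coords c x) within half_space)"
      by (rule transition_chain[OF assms D(1)]) (simp add: assms(1,2))
    then show ?thesis using coord_vector_eq[OF assms(1,3) True] D(2) by simp
  qed (simp add: coord_vector_not_smooth)
qed

lemma transition_inverse_derivative:
  assumes "c \<in> A" "d \<in> A" "x \<in> dom_chart c" "x \<in> dom_chart d"
    "(coords d \<circ> param c has_derivative T) (at (coords c x) within half_space)"
    "(coords c \<circ> param d has_derivative S) (at (coords d x) within half_space)"
  shows "S (T u) = u"
proof -
  have "((\<lambda>y. y) has_derivative (\<lambda>u. S (T u))) (at (coords c x) within half_space)"
    by (rule transition_chain[OF assms]) (simp add: assms(2))
  then have "(\<lambda>u. S (T u)) = (\<lambda>u. u)"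
    using half_space_derivative_unique coords_half_space[OF assms(1,3)] has_derivative_ident by blast
  then show ?thesis by metis
qed

text \<open>At an interior point of one chart mapped to the boundary by another, the last coordinate of
  the transition map would have a minimum, so its differential could not be onto.\<close>

lemma boundary_invariance:
  assumes "c \<in> A" "d \<in> A" "x \<in> dom_chart c" "x \<in> dom_chart d" "snd (coords c x) = 0"
  shows "snd (coords d x) = 0"
proof (rule ccontr)
  assume n: "snd (coords d x) \<noteq> 0"
  have hs: "coords d x \<in> half_space" using coords_half_space assms by auto
  then have pos: "snd (coords d x) > 0" using n by (auto simp: half_space_def)
  obtain T where T: "(coords d \<circ> param c has_derivative T) (at (coords c x) within half_space)"
    using transition_has_derivative[OF assms(1-4)] .
  obtain S where S: "(coords c \<circ> param d has_derivative S) (at (coords d x) within half_space)"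
    using transition_has_derivative[OF assms(2,1,4,3)] .
  have inv: "S (T u) = u" for u
    using transition_inverse_derivative[OF assms(1-4) T S] .
  obtain W where W: "open W" "\<And>z. z \<in> W \<Longrightarrow> z \<in> half_space \<Longrightarrow> z \<in> image_chart d \<and> param d z \<in> dom_chart c"
      "\<And>x. x \<in> dom_chart d \<Longrightarrow> x \<in> dom_chart c \<Longrightarrow> coords d x \<in> W"
    using coords_open_image[OF assms(2) open_dom[OF assms(1)]] by blast
  \<comment> \<open>This set is open in the ambient space, so there the derivative within the
    half-space becomes a full derivative and the first-order condition at a minimum applies.\<close>
  let ?V = "W \<inter> {z. snd z > 0}"
  have oV: "open ?V" by (intro open_Int W open_Collect_less continuous_intros)
  have xV: "coords d x \<in> ?V" using W assms pos by auto
  have sub: "?V \<subseteq> half_space" by (auto simp: half_space_def)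
  have "(coords c \<circ> param d has_derivative S) (at (coords d x) within ?V)"
    using S sub has_derivative_subset by blast
  then have "(coords c \<circ> param d has_derivative S) (at (coords d x))"
    using at_within_open[OF xV oV] by simp
  then have s: "((\<lambda>y. snd ((coords c \<circ> param d) y)) has_derivative (\<lambda>u. snd (S u))) (at (coords d x))"
    by (rule has_derivative_snd)
  have "(\<lambda>u. snd (S u)) = (\<lambda>u. 0)"
  proof (rule differential_zero_maxmin[OF xV oV s])
    show "(\<forall>y\<in>?V. snd ((coords c \<circ> param d) y) \<le> snd ((coords c \<circ> param d) (coords d x))) \<or>
       (\<forall>y\<in>?V. snd ((coords c \<circ> param d) (coords d x)) \<le> snd ((coords c \<circ> param d) y))"
      using W(2) sub coords_half_space[OF assms(1)] assms by (auto simp: half_space_def)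
  qed
  then have "snd (S (T (0, 1))) = 0" by metis
  then show False by (simp add: inv)
qed

text \<open>The definition asks for some chart; by boundary invariance every chart containing the
  point decides.\<close>

lemma manifold_boundary_iff:
  assumes "c \<in> A" "x \<in> dom_chart c"
  shows "x \<in> manifold_boundary A \<longleftrightarrow> snd (coords c x) = 0"
  using assms boundary_invariance[OF _ assms(1) _ assms(2)] unfolding manifold_boundary_def by blast

lemma closed_manifold_boundary: "closed (manifold_boundary A)"
  unfolding closed_def
proof (subst open_subopen, intro ballI)
  fix x assume x: "x \<in> - manifold_boundary A"
  obtain c where c: "c \<in> A" "x \<in> dom_chart c" by (rule chart_at)
  have "open (dom_chart c \<inter> coords c -` {z. snd z \<noteq> 0})"
    by (intro open_param_image c open_Collect_neq continuous_intros)
  then show "\<exists>T. open T \<and> x \<in> T \<and> T \<subseteq> - manifold_boundary A"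
    using x c manifold_boundary_iff[OF c(1)]
    by (intro exI[of _ "dom_chart c \<inter> coords c -` {z. snd z \<noteq> 0}"]) auto
qed

text \<open>The union over charts in the definition collapses, because the differential of the
  transition map rewrites a vector of any other chart in \<open>c\<close>.\<close>

lemma tangent_space_eq:
  assumes "c \<in> A" "x \<in> dom_chart c"
  shows "tangent_space A x = range (coord_vector A c x)"
proof
  show "range (coord_vector A c x) \<subseteq> tangent_space A x"
    using assms unfolding tangent_space_def by blast
  show "tangent_space A x \<subseteq> range (coord_vector A c x)"
  proof
    fix X assume "X \<in> tangent_space A x"
    then obtain d u where d: "d \<in> A" "x \<in> dom_chart d" "X = coord_vector A d x u"
      unfolding tangent_space_def by blast
    obtain T where T: "(coords c \<circ> param d has_derivative T) (at (coords d x) within half_space)"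
      using transition_has_derivative[OF d(1) assms(1) d(2) assms(2)] .
    show "X \<in> range (coord_vector A c x)"
      using coord_vector_change[OF d(1) assms(1) d(2) assms(2) T] d by auto
  qed
qed

lemma coord_vector_tangent: "c \<in> A \<Longrightarrow> x \<in> dom_chart c \<Longrightarrow> coord_vector A c x u \<in> tangent_space A x"
  by (simp add: tangent_space_eq)

lemma smooth_at_continuous:
  assumes "smooth_at A f x"
  shows "isCont f x"
proof -
  obtain c where c: "c \<in> A" "x \<in> dom_chart c" by (rule chart_at)
  have "continuous (at (coords c x) within image_chart c) (f \<circ> param c)"
    using assms c by (intro smooth_within_continuous) (auto simp: smooth_at_def)
  moreover have "continuous (at x within dom_chart c) (coords c)"
    using continuous_coords[OF c(1)] c(2) by (auto simp: continuous_on_eq_continuous_within)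
  ultimately have "continuous (at x within dom_chart c) ((f \<circ> param c) \<circ> coords c)"
    using continuous_within_compose by blast
  moreover have "\<forall>\<^sub>F z in at x within dom_chart c. ((f \<circ> param c) \<circ> coords c) z = f z"
    using c unfolding eventually_at_topological by auto
  ultimately have "(f \<longlongrightarrow> ((f \<circ> param c) \<circ> coords c) x) (at x within dom_chart c)"
    unfolding continuous_within by (rule Lim_transform_eventually)
  then have "continuous (at x within dom_chart c) f"
    using c by (simp add: continuous_within)
  then show ?thesis by (simp add: at_within_open[OF c(2) open_dom[OF c(1)]])
qed

lemma smooth_functions_continuous: "f \<in> smooth_functions A \<Longrightarrow> continuous_on UNIV f"
  by (auto simp: smooth_functions_def intro!: continuous_at_imp_continuous_on smooth_at_continuous)

lemma tangentE:
  assumes "X \<in> tangent_space A x"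
  obtains c u where "c \<in> A" "x \<in> dom_chart c" "X = coord_vector A c x u"
  using assms unfolding tangent_space_def by blast

lemma tangent_mult:
  assumes "X \<in> tangent_space A x" "smooth_at A f x" "smooth_at A g x"
  shows "X (\<lambda>x. f x * g x) = f x * X g + X f * g x"
  using assms by (elim tangentE) (simp add: coord_vector_mult)

lemma tangent_const:
  assumes "X \<in> tangent_space A x"
  shows "X (\<lambda>x. k) = 0"
  using assms by (elim tangentE) (simp add: coord_vector_const)

lemma tangent_sum:
  assumes "X \<in> tangent_space A x" "\<And>i. i \<in> I \<Longrightarrow> smooth_at A (f i) x"
  shows "X (\<lambda>x. \<Sum>i\<in>I. f i x) = (\<Sum>i\<in>I. X (f i))"
  using assms by (elim tangentE) (simp add: coord_vector_sum)

lemma tangent_cutoff: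
  assumes "X \<in> tangent_space A x" "smooth_at A f x"
  shows "X (\<lambda>x. cutoff m (f x)) = cutoff' m (f x) * X f"
  using assms by (elim tangentE) (simp add: coord_vector_cutoff)

lemma tangent_cong:
  assumes "X \<in> tangent_space A x" "open U" "x \<in> U" "\<And>z. z \<in> U \<Longrightarrow> f z = g z"
  shows "X f = X g"
proof -
  obtain c u where "c \<in> A" "x \<in> dom_chart c" "X = coord_vector A c x u"
    using tangentE[OF assms(1)] .
  then show ?thesis using coord_vector_cong[of c x U f g u] assms by simp
qed

end

section \<open>Riemannian metrics, paths and balls\<close>

lemma linear_real_expand:
  fixes f :: "'v::euclidean_space \<Rightarrow> real"
  assumes "linear f"
  shows "f u = (\<Sum>i\<in>Basis. (u \<bullet> i) * f i)"
  using linear_sum[OF assms, of "\<lambda>i. (u \<bullet> i) *\<^sub>R i" Basis] linear_scale[OF assms]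
  by (simp add: euclidean_representation)

locale riemannian = manifold A for A :: "('a::{t2_space, second_countable_topology}, 'h::euclidean_space) chart set" +
  fixes g :: "'a metric_field"
  assumes metric: "riemannian_metric A g"
begin

lemmas metric_conjs = metric[unfolded riemannian_metric_def]

lemma metric_sym: "X \<in> tangent_space A x \<Longrightarrow> Y \<in> tangent_space A x \<Longrightarrow> g x X Y = g x Y X"
  by (rule metric_conjs[THEN conjunct1, rule_format])

lemma metric_lincomb: "X \<in> tangent_space A x \<Longrightarrow> Y \<in> tangent_space A x \<Longrightarrow> Z \<in> tangent_space A x \<Longrightarrow>
    g x (\<lambda>f. a * X f + b * Y f) Z = a * g x X Z + b * g x Y Z"
  by (rule metric_conjs[THEN conjunct2, THEN conjunct1, rule_format])

lemma metric_pos: "X \<in> tangent_space A x \<Longrightarrow> X \<noteq> (\<lambda>f. 0) \<Longrightarrow> 0 < g x X X"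
  by (rule metric_conjs[THEN conjunct2, THEN conjunct2, THEN conjunct1, rule_format])

lemma smooth_metric_coeff: "c \<in> A \<Longrightarrow> y \<in> image_chart c \<Longrightarrow>
    smooth_within (image_chart c) (\<lambda>z. metric_coeff A g c z u v) y"
  using metric_conjs[THEN conjunct2, THEN conjunct2, THEN conjunct2] by blast

lemma metric_zero:
  assumes "Z \<in> tangent_space A x" shows "g x (\<lambda>f. 0) Z = 0"
  using metric_lincomb[OF assms assms assms, of 0 0] by simp

lemma metric_nonneg: "X \<in> tangent_space A x \<Longrightarrow> 0 \<le> g x X X"
  using metric_pos metric_zero by (metis less_eq_real_def)

lemma metric_scale2:
  assumes "X \<in> tangent_space A x" "(\<lambda>f. a * X f) \<in> tangent_space A x"
  shows "g x (\<lambda>f. a * X f) (\<lambda>f. a * X f) = a\<^sup>2 * g x X X"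
proof -
  have 1: "g x (\<lambda>f. a * X f) Z = a * g x X Z" if "Z \<in> tangent_space A x" for Z
    using metric_lincomb[OF assms(1) assms(1) that, of a 0] by simp
  show ?thesis
    using 1[OF assms(2)] 1[OF assms(1)] metric_sym[OF assms] by (simp add: power2_eq_square)
qed

abbreviation q :: "('a, 'h) chart \<Rightarrow> 'h \<times> real \<Rightarrow> 'h \<times> real \<Rightarrow> 'h \<times> real \<Rightarrow> real" where
  "q \<equiv> metric_coeff A g"

lemma q_coords: "c \<in> A \<Longrightarrow> x \<in> dom_chart c \<Longrightarrow>
    q c (coords c x) u v = g x (coord_vector A c x u) (coord_vector A c x v)"
  by (simp add: metric_coeff_def)

lemma q_sym: "c \<in> A \<Longrightarrow> y \<in> image_chart c \<Longrightarrow> q c y u v = q c y v u"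
  unfolding metric_coeff_def by (intro metric_sym coord_vector_tangent param_dom)

lemma q_lincomb: "c \<in> A \<Longrightarrow> y \<in> image_chart c \<Longrightarrow>
    q c y (a *\<^sub>R u + b *\<^sub>R v) w = a * q c y u w + b * q c y v w"
  unfolding metric_coeff_def
  by (subst coord_vector_lincomb) (auto intro!: metric_lincomb coord_vector_tangent simp del: split_paired_All)

lemma linear_q_left: "c \<in> A \<Longrightarrow> y \<in> image_chart c \<Longrightarrow> linear (\<lambda>u. q c y u v)"
  using q_lincomb[of c y 1 _ 1 _ v] q_lincomb[of c y _ _ 0 0 v]
  by (intro linearI) simp_all

lemma linear_q_right: "c \<in> A \<Longrightarrow> y \<in> image_chart c \<Longrightarrow> linear (\<lambda>v. q c y u v)"
  using linear_q_left[of c y u] by (simp add: q_sym[of c y u])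

lemma q_expand:
  assumes "c \<in> A" "y \<in> image_chart c"
  shows "q c y u v = (\<Sum>i\<in>Basis. \<Sum>j\<in>Basis. (u \<bullet> i) * (v \<bullet> j) * q c y i j)"
proof -
  have "q c y u v = (\<Sum>i\<in>Basis. (u \<bullet> i) * q c y i v)"
    using linear_real_expand[OF linear_q_left[OF assms]] .
  also have "\<dots> = (\<Sum>i\<in>Basis. (u \<bullet> i) * (\<Sum>j\<in>Basis. (v \<bullet> j) * q c y i j))"
    using linear_real_expand[OF linear_q_right[OF assms], of _ v] by simp
  finally show ?thesis by (simp add: sum_distrib_left mult.assoc)
qed

lemma q_nonneg: "c \<in> A \<Longrightarrow> y \<in> image_chart c \<Longrightarrow> 0 \<le> q c y u u"
  unfolding metric_coeff_def by (intro metric_nonneg coord_vector_tangent param_dom)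

lemma continuous_q: "c \<in> A \<Longrightarrow> continuous_on (image_chart c) (\<lambda>y. q c y u v)"
  unfolding continuous_on_eq_continuous_within
  by (intro ballI smooth_within_continuous smooth_metric_coeff)

text \<open>Near \<open>coords c x\<close> each continuous coefficient exceeds its central value by
  less than 1 in modulus, and coordinates of \<open>u\<close> are at most \<open>norm u\<close>. The
  constant is written \<open>K\<^sup>2\<close> so that speeds are bounded by
  \<open>K\<close>.\<close>

lemma q_bound:
  assumes "c \<in> A" "x \<in> dom_chart c" "open U" "x \<in> U"
  obtains r K where "0 < r" "0 \<le> K"
    "\<And>y u. y \<in> ball (coords c x) r \<Longrightarrow> y \<in> half_space \<Longrightarrow>
      y \<in> image_chart c \<and> param c y \<in> U \<and> q c y u u \<le> K\<^sup>2 * (norm u)\<^sup>2"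
proof -
  obtain W where W: "open W" "\<And>z. z \<in> W \<Longrightarrow> z \<in> half_space \<Longrightarrow> z \<in> image_chart c \<and> param c z \<in> U"
    "\<And>x. x \<in> dom_chart c \<Longrightarrow> x \<in> U \<Longrightarrow> coords c x \<in> W"
    using coords_open_image[OF assms(1,3)] by blast
  let ?y = "coords c x"
  define C where "C = (\<Sum>i\<in>Basis. \<Sum>j\<in>Basis. \<bar>q c ?y i j\<bar> + 1)"
  have C: "0 \<le> C" unfolding C_def by (intro sum_nonneg) auto
  have ev: "\<forall>\<^sub>F y in at ?y within image_chart c. \<bar>q c y i j\<bar> < \<bar>q c ?y i j\<bar> + 1" for i j
  proof -
    have "((\<lambda>y. \<bar>q c y i j\<bar>) \<longlongrightarrow> \<bar>q c ?y i j\<bar>) (at ?y within image_chart c)"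
      using continuous_q[OF assms(1), of i j] assms(2)
      by (intro tendsto_rabs) (auto simp: continuous_on_def)
    then show ?thesis by (rule order_tendstoD) simp
  qed
  have "\<forall>\<^sub>F y in at ?y within image_chart c. \<forall>i\<in>Basis. \<forall>j\<in>Basis. \<bar>q c y i j\<bar> < \<bar>q c ?y i j\<bar> + 1"
    by (intro eventually_ball_finite ballI ev finite_Basis)
  then obtain e where e: "e > 0" "\<And>y. y \<in> image_chart c \<Longrightarrow> y \<noteq> ?y \<Longrightarrow> dist y ?y < e \<Longrightarrow>
      \<forall>i\<in>Basis. \<forall>j\<in>Basis. \<bar>q c y i j\<bar> < \<bar>q c ?y i j\<bar> + 1"
    unfolding eventually_at by blast
  have "?y \<in> W" using W assms by blast
  then obtain r where r: "r > 0" "ball ?y r \<subseteq> W" using W(1) open_contains_ball by blast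
  show ?thesis
  proof (rule that[of "min r e" "sqrt C"])
    fix y u :: "'h \<times> real"
    assume y: "y \<in> ball ?y (min r e)" "y \<in> half_space"
    then have yi: "y \<in> image_chart c \<and> param c y \<in> U" using W(2)[of y] r by auto
    have b: "\<bar>q c y i j\<bar> \<le> \<bar>q c ?y i j\<bar> + 1" if "i \<in> Basis" "j \<in> Basis" for i j
      using e(2)[of y] yi y that by (cases "y = ?y") (fastforce simp: dist_commute)+
    have "q c y u u = (\<Sum>i\<in>Basis. \<Sum>j\<in>Basis. (u \<bullet> i) * (u \<bullet> j) * q c y i j)"
      using q_expand[of c y u u] yi assms by blast
    also have "\<dots> \<le> (\<Sum>i\<in>Basis. \<Sum>j\<in>Basis. (norm u)\<^sup>2 * (\<bar>q c ?y i j\<bar> + 1))"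
    proof (intro sum_mono)
      fix i j :: "'h \<times> real" assume ij: "i \<in> Basis" "j \<in> Basis"
      have "(u \<bullet> i) * (u \<bullet> j) * q c y i j \<le> \<bar>u \<bullet> i\<bar> * \<bar>u \<bullet> j\<bar> * \<bar>q c y i j\<bar>"
        by (metis abs_mult abs_ge_self)
      also have "\<dots> \<le> norm u * norm u * (\<bar>q c ?y i j\<bar> + 1)"
        using ij b by (intro mult_mono Basis_le_norm) auto
      finally show "(u \<bullet> i) * (u \<bullet> j) * q c y i j \<le> (norm u)\<^sup>2 * (\<bar>q c ?y i j\<bar> + 1)"
        by (simp add: power2_eq_square)
    qed
    also have "\<dots> = (sqrt C)\<^sup>2 * (norm u)\<^sup>2"
      using C by (simp add: C_def sum_distrib_left mult.commute)
    finally show "y \<in> image_chart c \<and> param c y \<in> U \<and> q c y u u \<le> (sqrt C)\<^sup>2 * (norm u)\<^sup>2"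
      using yi by blast
  qed (use r e C in auto)
qed

end

section \<open>Lengths of paths and openness of balls\<close>

text \<open>Derivatives are two-sided at the points of \<open>S\<close> and their continuity is
  relative to \<open>S\<close>; both can be tested near each point, which is how the two halves of a
  joined path are treated.\<close>

lemma C1_differentiable_on_local:
  assumes "\<And>x. x \<in> S \<Longrightarrow> \<exists>U. open U \<and> x \<in> U \<and> f C1_differentiable_on (S \<inter> U)"
  shows "f C1_differentiable_on S"
  unfolding C1_differentiable_on_eq continuous_on_eq_continuous_within
proof (intro conjI ballI)
  fix x assume x: "x \<in> S"
  obtain U where U: "open U" "x \<in> U" "f C1_differentiable_on (S \<inter> U)"
    using assms[OF x] by blast
  show "f differentiable at x"
    using U x by (auto simp: C1_differentiable_on_eq)
  have "continuous (at x within S \<inter> U) (\<lambda>x. vector_derivative f (at x))"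
    using U x by (auto simp: C1_differentiable_on_eq continuous_on_eq_continuous_within)
  moreover have "at x within S \<inter> U = at x within S"
    using U by (intro at_within_nhd[of x U]) auto
  ultimately show "continuous (at x within S) (\<lambda>x. vector_derivative f (at x))" by simp
qed

lemma C1_differentiable_on_cong_open:
  assumes "f C1_differentiable_on S" "S \<subseteq> U" "open U" "\<And>x. x \<in> U \<Longrightarrow> f x = g x"
  shows "g C1_differentiable_on S"
  using assms unfolding C1_differentiable_on_def
  by (meson has_vector_derivative_transform_within_open subsetD)

text \<open>No measurability is assumed, so the estimates go through simple functions below the integrand.\<close>

lemma nn_integral_join_le:
  fixes F I1 I2 :: "real \<Rightarrow> ennreal"
  assumes "finite N"
    and F: "\<And>t. t \<notin> N \<Longrightarrow> F t \<le> (if t < 1/2 then 2 * I1 (2 * t) else 2 * I2 (2 * t - 1))"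
  shows "(\<integral>\<^sup>+t. F t \<partial>lborel) \<le> (\<integral>\<^sup>+t. I1 t \<partial>lborel) + (\<integral>\<^sup>+t. I2 t \<partial>lborel)"
  unfolding nn_integral_def[of lborel F]
proof (rule SUP_least)
  fix s assume s: "s \<in> {s. simple_function lborel s \<and> s \<le> F}"
  then have ms [measurable]: "s \<in> borel_measurable borel"
    using borel_measurable_simple_function[of lborel s] by simp
  have sF: "s t \<le> F t" for t using s by (auto simp: le_fun_def)
  \<comment> \<open>The affine substitution is applied to the measurable minorant \<open>h\<close>;
    the comparison with \<open>I\<close>, which may not be measurable, comes afterwards.\<close>
  have half: "(\<integral>\<^sup>+t. h t \<partial>lborel) \<le> (\<integral>\<^sup>+t. I t \<partial>lborel)"
    if [measurable]: "h \<in> borel_measurable borel" and h: "\<And>t. h t \<le> 2 * I (2 * t - b)"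
    for h I :: "real \<Rightarrow> ennreal" and b
  proof -
    have "(\<integral>\<^sup>+t. h t \<partial>lborel) = ennreal (1/2) * (\<integral>\<^sup>+t. h (b/2 + (1/2) * t) \<partial>lborel)"
      using nn_integral_real_affine[of h "1/2" "b/2"] by simp
    also have "\<dots> = (\<integral>\<^sup>+t. ennreal (1/2) * h (b/2 + (1/2) * t) \<partial>lborel)"
      by (rule nn_integral_cmult[symmetric]) simp
    also have "\<dots> \<le> (\<integral>\<^sup>+t. I t \<partial>lborel)"
    proof (rule nn_integral_mono)
      fix t :: real
      have two: "ennreal (1/2) * (2 * x) = x" for x
      proof -
        have "ennreal (1/2) * 2 = ennreal (1/2) * ennreal 2"
          by (simp only: ennreal_numeral)
        also have "\<dots> = 1" by (subst ennreal_mult[symmetric]) auto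
        finally show ?thesis by (simp flip: mult.assoc)
      qed
      have "ennreal (1/2) * h (b/2 + (1/2) * t) \<le> ennreal (1/2) * (2 * I (2 * (b/2 + (1/2) * t) - b))"
        by (rule mult_left_mono[OF h]) simp
      also have "\<dots> = I t" by (simp only: two) (simp add: field_simps)
      finally show "ennreal (1/2) * h (b/2 + (1/2) * t) \<le> I t" .
    qed
    finally show ?thesis .
  qed
  \<comment> \<open>The finite set \<open>N\<close>, where the bound on \<open>F\<close> is not
    assumed, is dropped from both halves; being null, it does not affect the integral.\<close>
  define h1 where "h1 = (\<lambda>t. s t * indicator ({..<1/2} - N) t)"
  define h2 where "h2 = (\<lambda>t. s t * indicator ({1/2..} - N) t)"
  have N: "N \<in> sets borel" using assms(1) by (simp add: finite_imp_closed)
  have [measurable]: "h1 \<in> borel_measurable borel" "h2 \<in> borel_measurable borel"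
    using N unfolding h1_def h2_def by (auto intro!: borel_measurable_times borel_measurable_indicator)
  have "integral\<^sup>S lborel s = (\<integral>\<^sup>+t. s t \<partial>lborel)"
    using s by (auto simp: nn_integral_eq_simple_integral)
  also have "\<dots> \<le> (\<integral>\<^sup>+t. h1 t + h2 t \<partial>lborel)"
  proof (rule nn_integral_mono_AE)
    have "AE t in lborel. t \<notin> N"
      using finite_imp_null_set_lborel[OF assms(1)] by (rule AE_not_in)
    then show "AE t in lborel. s t \<le> h1 t + h2 t"
      by eventually_elim (auto simp: h1_def h2_def indicator_def)
  qed
  also have "\<dots> = (\<integral>\<^sup>+t. h1 t \<partial>lborel) + (\<integral>\<^sup>+t. h2 t \<partial>lborel)"
    by (rule nn_integral_add) simp_all
  also have "\<dots> \<le> (\<integral>\<^sup>+t. I1 t \<partial>lborel) + (\<integral>\<^sup>+t. I2 t \<partial>lborel)"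
  proof (rule add_mono)
    show "(\<integral>\<^sup>+t. h1 t \<partial>lborel) \<le> (\<integral>\<^sup>+t. I1 t \<partial>lborel)"
    proof (rule half[where b=0])
      show "h1 t \<le> 2 * I1 (2 * t - 0)" for t
        using order_trans[OF sF F, of t] by (auto simp: h1_def indicator_def split: if_splits)
    qed simp
    show "(\<integral>\<^sup>+t. h2 t \<partial>lborel) \<le> (\<integral>\<^sup>+t. I2 t \<partial>lborel)"
    proof (rule half[where b=1])
      show "h2 t \<le> 2 * I2 (2 * t - 1)" for t
        using order_trans[OF sF F, of t] by (auto simp: h2_def indicator_def split: if_splits)
    qed simp
  qed
  finally show "integral\<^sup>S lborel s \<le> (\<integral>\<^sup>+t. I1 t \<partial>lborel) + (\<integral>\<^sup>+t. I2 t \<partial>lborel)" .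
qed

context manifold
begin

lemma velocity_chart:
  assumes c: "c \<in> A" and t: "\<gamma> t \<in> dom_chart c" and cont: "isCont \<gamma> t"
    and D: "(coords c \<circ> \<gamma> has_vector_derivative D) (at t)"
  shows "velocity A \<gamma> t = coord_vector A c (\<gamma> t) D"
proof
  fix f
  show "velocity A \<gamma> t f = coord_vector A c (\<gamma> t) D f"
  proof (cases "smooth_at A f (\<gamma> t)")
    case True
    obtain E where E: "(f \<circ> param c has_derivative E) (at (coords c (\<gamma> t)) within half_space)"
      "\<And>u. coord_vector A c (\<gamma> t) u f = E u" using smooth_has_derivative[OF c t True] by blast
    \<comment> \<open>Continuity of \<open>\<gamma>\<close> keeps it in the chart near
      \<open>t\<close>. Differentiability of \<open>coords c \<circ> \<gamma>\<close> would not,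
      since \<open>coords c\<close> is arbitrary outside its domain.\<close>
    obtain N where N: "open N" "t \<in> N" "\<And>s. s \<in> N \<Longrightarrow> \<gamma> s \<in> dom_chart c"
      using cont t open_dom[OF c] unfolding continuous_at_open by metis
    have d: "(coords c \<circ> \<gamma> has_derivative (\<lambda>x. x *\<^sub>R D)) (at t within N)"
      using D unfolding has_vector_derivative_def by (rule has_derivative_at_withinI)
    have "(coords c \<circ> \<gamma>) ` N \<subseteq> half_space"
      using N coords_half_space[OF c] by auto
    then have "(f \<circ> param c has_derivative E) (at ((coords c \<circ> \<gamma>) t) within (coords c \<circ> \<gamma>) ` N)"
      using E(1) has_derivative_subset by fastforce
    from has_derivative_in_compose[OF d this]
    have "((\<lambda>x. (f \<circ> param c) ((coords c \<circ> \<gamma>) x)) has_derivative (\<lambda>x. E (x *\<^sub>R D))) (at t)"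
      by (simp add: at_within_open[OF N(2,1)])
    then have "(f \<circ> \<gamma> has_derivative (\<lambda>x. E (x *\<^sub>R D))) (at t)"
      by (rule has_derivative_transform_within_open[OF _ N(1,2)]) (use N c in auto)
    moreover have "E (x *\<^sub>R D) = x *\<^sub>R E D" for x
      using has_derivative_bounded_linear[OF E(1)] by (simp add: bounded_linear.linear linear_scale)
    ultimately have "(f \<circ> \<gamma> has_vector_derivative E D) (at t)"
      by (simp add: has_vector_derivative_def)
    then show ?thesis
      using True E(2) by (simp add: velocity_def vector_derivative_at)
  qed (simp add: velocity_def coord_vector_not_smooth)
qed

lemma path_isCont: "path \<gamma> \<Longrightarrow> 0 < t \<Longrightarrow> t < 1 \<Longrightarrow> isCont \<gamma> t"
  unfolding path_def using continuous_on_interior[of "{0..1}" \<gamma> t] by simp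

text \<open>The endpoints are left out because \<open>path\<close> gives continuity relative to
  \<open>{0..1}\<close>, whereas \<open>velocity\<close> is a two-sided derivative.\<close>

lemma piecewise_C1_velocity:
  assumes "path \<gamma>" "\<And>c. c \<in> A \<Longrightarrow> (coords c \<circ> \<gamma>) C1_differentiable_on {t \<in> {0..1} - S. \<gamma> t \<in> dom_chart c}"
    "t \<notin> S" "0 < t" "t < 1"
  obtains c D where "c \<in> A" "\<gamma> t \<in> dom_chart c" "(coords c \<circ> \<gamma> has_vector_derivative D) (at t)"
    "velocity A \<gamma> t = coord_vector A c (\<gamma> t) D"
proof -
  obtain c where c: "c \<in> A" "\<gamma> t \<in> dom_chart c" by (rule chart_at)
  obtain D' where "\<forall>s\<in>{s \<in> {0..1} - S. \<gamma> s \<in> dom_chart c}. (coords c \<circ> \<gamma> has_vector_derivative D' s) (at s)"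
    using assms(2)[OF c(1)] unfolding C1_differentiable_on_def by blast
  then obtain D where D: "(coords c \<circ> \<gamma> has_vector_derivative D) (at t)"
    using c(2) assms(3-5) by (metis (no_types, lifting) DiffI atLeastAtMost_iff less_imp_le mem_Collect_eq)
  show ?thesis
    using that[OF c D velocity_chart[OF c path_isCont D]] assms by blast
qed

lemma piecewise_C1_join:
  assumes "piecewise_C1_path A \<gamma>1" "piecewise_C1_path A \<gamma>2" "pathfinish \<gamma>1 = pathstart \<gamma>2"
  shows "piecewise_C1_path A (\<gamma>1 +++ \<gamma>2)"
proof -
  obtain S1 where S1: "path \<gamma>1" "finite S1"
    "\<And>c. c \<in> A \<Longrightarrow> (coords c \<circ> \<gamma>1) C1_differentiable_on {t \<in> {0..1} - S1. \<gamma>1 t \<in> dom_chart c}"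
    using assms(1) unfolding piecewise_C1_path_def by blast
  obtain S2 where S2: "path \<gamma>2" "finite S2"
    "\<And>c. c \<in> A \<Longrightarrow> (coords c \<circ> \<gamma>2) C1_differentiable_on {t \<in> {0..1} - S2. \<gamma>2 t \<in> dom_chart c}"
    using assms(2) unfolding piecewise_C1_path_def by blast
  \<comment> \<open>The exceptional times of the joined path: the junction and the rescaled
    exceptional times of the two pieces.\<close>
  define S where "S = insert (1/2) ((\<lambda>s. s / 2) ` S1 \<union> (\<lambda>s. (s + 1) / 2) ` S2)"
  have fin1: "finite (T \<inter> (\<lambda>t. 2 * t) -` {x})" for T and x :: real
    by (rule finite_subset[of _ "{x / 2}"]) auto
  have fin2: "finite (T \<inter> (\<lambda>t. 2 * t - 1) -` {x})" for T and x :: real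
    by (rule finite_subset[of _ "{(x + 1) / 2}"]) auto
  have n1: "t \<in> S" if "2 * t \<in> S1" for t
    unfolding S_def using that by (intro insertI2 UnI1 image_eqI[of _ _ "2 * t"]) auto
  have n2: "t \<in> S" if "2 * t - 1 \<in> S2" for t
    unfolding S_def using that by (intro insertI2 UnI2 image_eqI[of _ _ "2 * t - 1"]) auto
  have "(coords c \<circ> (\<gamma>1 +++ \<gamma>2)) C1_differentiable_on {t \<in> {0..1} - S. (\<gamma>1 +++ \<gamma>2) t \<in> dom_chart c}"
    (is "?f C1_differentiable_on ?T") if c: "c \<in> A" for c
  proof (rule C1_differentiable_on_local)
    fix t assume t: "t \<in> ?T"
    then consider "t < 1/2" | "1/2 < t" by (fastforce simp: S_def)
    then show "\<exists>U. open U \<and> t \<in> U \<and> ?f C1_differentiable_on (?T \<inter> U)"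
    proof cases
      case 1
      have "(coords c \<circ> \<gamma>1) C1_differentiable_on ((\<lambda>t. 2 * t) ` (?T \<inter> {..<1/2}))"
        by (rule C1_differentiable_on_subset[OF S1(3)[OF c]]) (auto simp: joinpaths_def dest: n1)
      then have "((coords c \<circ> \<gamma>1) \<circ> (\<lambda>t. 2 * t)) C1_differentiable_on (?T \<inter> {..<1/2})"
        by (rule C1_differentiable_compose[OF _ _ fin1, rotated]) simp
      then have "?f C1_differentiable_on (?T \<inter> {..<1/2})"
        by (rule C1_differentiable_on_cong_open[of _ _ "{..<1/2}"]) (auto simp: joinpaths_def)
      then show ?thesis using 1 by (intro exI[of _ "{..<1/2}"]) auto
    next
      case 2
      have "(coords c \<circ> \<gamma>2) C1_differentiable_on ((\<lambda>t. 2 * t - 1) ` (?T \<inter> {1/2<..}))"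
        by (rule C1_differentiable_on_subset[OF S2(3)[OF c]]) (auto simp: joinpaths_def dest: n2)
      then have "((coords c \<circ> \<gamma>2) \<circ> (\<lambda>t. 2 * t - 1)) C1_differentiable_on (?T \<inter> {1/2<..})"
        by (rule C1_differentiable_compose[OF _ _ fin2, rotated]) simp
      then have "?f C1_differentiable_on (?T \<inter> {1/2<..})"
        by (rule C1_differentiable_on_cong_open[of _ _ "{1/2<..}"]) (auto simp: joinpaths_def)
      then show ?thesis using 2 by (intro exI[of _ "{1/2<..}"]) auto
    qed
  qed
  moreover have "finite S" using S1 S2 by (simp add: S_def)
  moreover have "path (\<gamma>1 +++ \<gamma>2)" using S1 S2 assms by simp
  ultimately show ?thesis unfolding piecewise_C1_path_def by blast
qed

end

context riemannian
begin

text \<open>Both halves of a joined path are of this form, with \<open>b = 0\<close> and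
  \<open>b = 1\<close>. The doubled parameter speed doubles the velocity, hence the norm, outside
  the times coming from the exceptional set of \<open>\<gamma>\<close>.\<close>

lemma speed_affine:
  assumes \<gamma>: "piecewise_C1_path A \<gamma>"
    and \<delta>: "\<And>t. t \<in> N \<Longrightarrow> \<delta> t = \<gamma> (2 * t - b)" "open N" "\<And>t. t \<in> N \<Longrightarrow> 0 < 2 * t - b \<and> 2 * t - b < 1"
  obtains S where "finite S" "\<And>t. t \<in> N \<Longrightarrow> t \<notin> S \<Longrightarrow>
     sqrt (g (\<delta> t) (velocity A \<delta> t) (velocity A \<delta> t)) =
     2 * sqrt (g (\<gamma> (2 * t - b)) (velocity A \<gamma> (2 * t - b)) (velocity A \<gamma> (2 * t - b)))"
proof -
  obtain S where S: "path \<gamma>" "finite S"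
    "\<And>c. c \<in> A \<Longrightarrow> (coords c \<circ> \<gamma>) C1_differentiable_on {t \<in> {0..1} - S. \<gamma> t \<in> dom_chart c}"
    using \<gamma> unfolding piecewise_C1_path_def by blast
  show ?thesis
  proof (rule that[of "(\<lambda>s. (s + b) / 2) ` S"])
    fix t assume t: "t \<in> N" "t \<notin> (\<lambda>s. (s + b) / 2) ` S"
    have tS: "2 * t - b \<notin> S" using t(2) by (auto simp: image_iff)
    obtain c D where c: "c \<in> A" "\<gamma> (2 * t - b) \<in> dom_chart c"
      "(coords c \<circ> \<gamma> has_vector_derivative D) (at (2 * t - b))"
      "velocity A \<gamma> (2 * t - b) = coord_vector A c (\<gamma> (2 * t - b)) D"
      using piecewise_C1_velocity[OF S(1,3) tS] \<delta>(3)[OF t(1)] by blast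
    have "((coords c \<circ> \<gamma>) \<circ> (\<lambda>t. 2 * t - b) has_vector_derivative 2 *\<^sub>R D) (at t)"
      by (rule vector_diff_chain_at) (use c in \<open>auto intro!: derivative_eq_intros\<close>)
    then have d: "(coords c \<circ> \<delta> has_vector_derivative 2 *\<^sub>R D) (at t)"
      by (rule has_vector_derivative_transform_within_open[OF _ \<delta>(2) t(1)]) (simp add: \<delta>)
    have "isCont \<gamma> (2 * t - b)" using path_isCont[OF S(1)] \<delta>(3)[OF t(1)] by blast
    then have "isCont (\<lambda>t. \<gamma> (2 * t - b)) t"
      by (intro isCont_o2[of t "\<lambda>t. 2 * t - b" \<gamma>] continuous_intros)
    moreover have "\<forall>\<^sub>F s in nhds t. \<delta> s = \<gamma> (2 * s - b)"
      by (rule eventually_mono[OF eventually_nhds_in_open[OF \<delta>(2) t(1)]]) (rule \<delta>(1))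
    ultimately have "isCont \<delta> t" by (simp add: isCont_cong)
    then have "velocity A \<delta> t = coord_vector A c (\<delta> t) (2 *\<^sub>R D)"
      using velocity_chart[OF c(1) _ _ d] c(2) \<delta>(1)[OF t(1)] by simp
    also have "\<dots> = (\<lambda>f. 2 * velocity A \<gamma> (2 * t - b) f)"
      using coord_vector_lincomb[OF c(1,2), of 2 D 0 0] c(4) \<delta>(1)[OF t(1)] by simp
    finally have v: "velocity A \<delta> t = (\<lambda>f. 2 * velocity A \<gamma> (2 * t - b) f)" .
    have "velocity A \<delta> t \<in> tangent_space A (\<gamma> (2 * t - b))"
      using coord_vector_tangent[OF c(1,2)] \<open>velocity A \<delta> t = coord_vector A c (\<delta> t) (2 *\<^sub>R D)\<close> \<delta>(1)[OF t(1)]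
      by simp
    then have "g (\<delta> t) (velocity A \<delta> t) (velocity A \<delta> t) =
      2\<^sup>2 * g (\<gamma> (2 * t - b)) (velocity A \<gamma> (2 * t - b)) (velocity A \<gamma> (2 * t - b))"
      using metric_scale2[of "velocity A \<gamma> (2 * t - b)" "\<gamma> (2 * t - b)" 2] coord_vector_tangent[OF c(1,2)] c(4) v \<delta>(1)[OF t(1)]
      by simp
    then show "sqrt (g (\<delta> t) (velocity A \<delta> t) (velocity A \<delta> t)) =
     2 * sqrt (g (\<gamma> (2 * t - b)) (velocity A \<gamma> (2 * t - b)) (velocity A \<gamma> (2 * t - b)))"
      by (simp add: real_sqrt_mult)
  qed (use S in auto)
qed

lemma path_length_join:
  assumes "piecewise_C1_path A \<gamma>1" "piecewise_C1_path A \<gamma>2" "pathfinish \<gamma>1 = pathstart \<gamma>2"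
  shows "path_length A g (\<gamma>1 +++ \<gamma>2) \<le> path_length A g \<gamma>1 + path_length A g \<gamma>2"
proof -
  let ?s = "\<lambda>\<gamma> t. sqrt (g (\<gamma> t) (velocity A \<gamma> t) (velocity A \<gamma> t))"
  obtain S1 where S1: "finite S1" "\<And>t. t \<in> {0<..<1/2} \<Longrightarrow> t \<notin> S1 \<Longrightarrow>
     ?s (\<gamma>1 +++ \<gamma>2) t = 2 * ?s \<gamma>1 (2 * t - 0)"
    by (rule speed_affine[OF assms(1), of "{0<..<1/2}" "\<gamma>1 +++ \<gamma>2" 0]) (auto simp: joinpaths_def)
  obtain S2 where S2: "finite S2" "\<And>t. t \<in> {1/2<..<1} \<Longrightarrow> t \<notin> S2 \<Longrightarrow>
     ?s (\<gamma>1 +++ \<gamma>2) t = 2 * ?s \<gamma>2 (2 * t - 1)"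
    by (rule speed_affine[OF assms(2), of "{1/2<..<1}" "\<gamma>1 +++ \<gamma>2" 1]) (auto simp: joinpaths_def)
  show ?thesis
    unfolding path_length_def
  proof (rule nn_integral_join_le[of "{0, 1/2, 1} \<union> S1 \<union> S2"])
    fix t assume t: "t \<notin> {0, 1/2, 1} \<union> S1 \<union> S2"
    consider "t < 0 \<or> 1 < t" | "t \<in> {0<..<1/2}" | "t \<in> {1/2<..<1}" using t by fastforce
    then show "ennreal (?s (\<gamma>1 +++ \<gamma>2) t) * indicator {0..1} t
      \<le> (if t < 1/2 then 2 * (ennreal (?s \<gamma>1 (2 * t)) * indicator {0..1} (2 * t))
         else 2 * (ennreal (?s \<gamma>2 (2 * t - 1)) * indicator {0..1} (2 * t - 1)))"
    proof cases
      case 2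
      then show ?thesis using S1(2)[of t] t by (simp add: ennreal_mult')
    next
      case 3
      then show ?thesis using S2(2)[of t] t by (simp add: ennreal_mult')
    qed auto
  qed (use S1 S2 in auto)
qed

text \<open>The intersection of a ball with the half-space is convex, so a coordinate segment stays
  in the chart; its velocity is the constant coordinate vector \<open>b - a\<close>, which the
  hypothesis on \<open>q\<close> bounds.\<close>

lemma segment_path:
  assumes c: "c \<in> A" and r: "\<And>y u. y \<in> ball w r \<Longrightarrow> y \<in> half_space \<Longrightarrow>
      y \<in> image_chart c \<and> q c y u u \<le> K\<^sup>2 * (norm u)\<^sup>2" and K: "0 \<le> K"
    and ab: "a \<in> ball w r" "a \<in> half_space" "b \<in> ball w r" "b \<in> half_space"
  shows "piecewise_C1_path A (param c \<circ> linepath a b)"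
    and "path_length A g (param c \<circ> linepath a b) \<le> ennreal (K * norm (b - a))"
proof -
  let ?\<sigma> = "param c \<circ> linepath a b"
  have seg: "linepath a b t \<in> ball w r \<and> linepath a b t \<in> half_space" if "t \<in> {0..1}" for t
  proof -
    have "linepath a b t \<in> closed_segment a b" using that by (simp add: linepath_in_path)
    moreover have "closed_segment a b \<subseteq> ball w r \<inter> half_space"
      using ab by (intro closed_segment_subset convex_Int convex_ball convex_half_space) auto
    ultimately show ?thesis by blast
  qed
  have img: "linepath a b t \<in> image_chart c" if "t \<in> {0..1}" for t
    using seg[OF that] r by blast
  have path: "path ?\<sigma>"
    unfolding path_def
    by (rule continuous_on_compose[OF continuous_on_linepath])
       (rule continuous_on_subset[OF continuous_param[OF c]], use img in auto)
  have dl: "(linepath a b has_vector_derivative (b - a)) (at t)" for t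
    by (rule has_vector_derivative_linepath_within)
  \<comment> \<open>A piecewise C1 path has to be checked in every chart \<open>d\<close> it meets,
    not only in \<open>c\<close>. Near each time the path read in \<open>d\<close> is a smooth
    extension of the transition map along a straight line.\<close>
  have C1: "(coords d \<circ> ?\<sigma>) C1_differentiable_on {t \<in> {0..1} - {0,1}. ?\<sigma> t \<in> dom_chart d}"
    (is "?f C1_differentiable_on ?T") if d: "d \<in> A" for d
  proof (rule C1_differentiable_on_local)
    fix t assume t: "t \<in> ?T"
    then have ti: "linepath a b t \<in> image_chart c" using img by auto
    obtain V F where V: "open V" "coords c (?\<sigma> t) \<in> V" "\<And>k. Ck_on k F V"
      "\<And>z. z \<in> V \<Longrightarrow> z \<in> half_space \<Longrightarrow>
        z \<in> image_chart c \<and> param c z \<in> dom_chart d \<and> F z = coords d (param c z)"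
      using transition_extension[OF c d, of "?\<sigma> t"] t ti c by auto
    let ?U = "linepath a b -` V \<inter> {0<..<1}"
    have U: "open ?U"
      by (intro open_Int open_vimage V continuous_on_linepath) auto
    have tU: "t \<in> ?U" using V(2) t ti c by auto
    have "(F \<circ> linepath a b) C1_differentiable_on (?T \<inter> ?U)"
      unfolding C1_differentiable_on_def
    proof (intro exI conjI ballI)
      show "(F \<circ> linepath a b has_vector_derivative frechet_derivative F (at (linepath a b s)) (b - a)) (at s)"
        if "s \<in> ?T \<inter> ?U" for s
        using vector_derivative_diff_chain_within[of "linepath a b" "b - a" s UNIV F] dl
          has_derivative_at_withinI[OF Ck_on_has_derivative[OF V(3)]] that by auto
      have "continuous_on V (\<lambda>x. frechet_derivative F (at x) (b - a))"
        using V(3)[of "Suc 0"] unfolding Ck_on.simps by blast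
      then show "continuous_on (?T \<inter> ?U) (\<lambda>s. frechet_derivative F (at (linepath a b s)) (b - a))"
        by (rule continuous_on_compose2[OF _ continuous_on_linepath]) auto
    qed
    then have "?f C1_differentiable_on (?T \<inter> ?U)"
      by (rule C1_differentiable_on_cong_open[OF _ _ U]) (use V(4) seg in auto)
    then show "\<exists>U. open U \<and> t \<in> U \<and> ?f C1_differentiable_on (?T \<inter> U)"
      using U tU by blast
  qed
  show "piecewise_C1_path A ?\<sigma>"
    unfolding piecewise_C1_path_def using path C1 by (intro conjI exI[of _ "{0,1}"]) auto
  have sp: "sqrt (g (?\<sigma> t) (velocity A ?\<sigma> t) (velocity A ?\<sigma> t)) \<le> K * norm (b - a)" if t: "0 < t" "t < 1" for t
  proof -
    have ti: "linepath a b t \<in> image_chart c" using img t by auto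
    have "(coords c \<circ> ?\<sigma> has_vector_derivative (b - a)) (at t)"
      by (rule has_vector_derivative_transform_within_open[OF dl, of "{0<..<1}"])
        (use t c img in auto)
    then have "velocity A ?\<sigma> t = coord_vector A c (?\<sigma> t) (b - a)"
      using velocity_chart[OF c _ path_isCont[OF path t]] ti c by simp
    then have "g (?\<sigma> t) (velocity A ?\<sigma> t) (velocity A ?\<sigma> t) = q c (linepath a b t) (b - a) (b - a)"
      by (simp add: metric_coeff_def)
    also have "\<dots> \<le> K\<^sup>2 * (norm (b - a))\<^sup>2"
      using r seg[of t] t by auto
    finally have "sqrt (g (?\<sigma> t) (velocity A ?\<sigma> t) (velocity A ?\<sigma> t)) \<le> sqrt ((K * norm (b - a))\<^sup>2)"
      by (simp add: power_mult_distrib)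
    then show ?thesis using K by simp
  qed
  have "path_length A g ?\<sigma> \<le> (\<integral>\<^sup>+t. ennreal (K * norm (b - a)) * indicator {0..1::real} t \<partial>lborel)"
    unfolding path_length_def
  proof (rule nn_integral_mono_AE)
    have "AE t in lborel. t \<notin> {0, 1::real}"
      by (rule AE_not_in[OF finite_imp_null_set_lborel]) simp
    then show "AE t in lborel. ennreal (sqrt (g (?\<sigma> t) (velocity A ?\<sigma> t) (velocity A ?\<sigma> t))) * indicator {0..1} t
      \<le> ennreal (K * norm (b - a)) * indicator {0..1} t"
    proof eventually_elim
      case (elim t)
      show ?case
      proof (cases "0 < t \<and> t < 1")
        case True
        then show ?thesis using sp[of t] by (simp add: ennreal_leI)
      qed (use elim in \<open>auto simp: indicator_def\<close>)
    qed
  qed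
  also have "\<dots> = ennreal (K * norm (b - a))"
    by (simp add: nn_integral_cmult_indicator)
  finally show "path_length A g ?\<sigma> \<le> ennreal (K * norm (b - a))" .
qed

text \<open>A path to \<open>x\<close> of length \<open>l < \<epsilon>\<close> leaves room
  \<open>\<epsilon> - l\<close>; appending a short coordinate segment reaches every point near
  \<open>x\<close> without exhausting it.\<close>

lemma open_riemannian_ball: "open (riemannian_ball A g p \<epsilon>)"
proof (subst open_subopen, intro ballI)
  fix x assume "x \<in> riemannian_ball A g p \<epsilon>"
  then obtain \<gamma> where \<gamma>: "piecewise_C1_path A \<gamma>" "pathstart \<gamma> = p" "pathfinish \<gamma> = x"
      "path_length A g \<gamma> < ennreal \<epsilon>"
    unfolding riemannian_ball_def riemannian_dist_def by (auto simp: INF_less_iff)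
  obtain l where l: "path_length A g \<gamma> = ennreal l" "0 \<le> l" "l < \<epsilon>"
    using \<gamma>(4) by (cases "path_length A g \<gamma>") (auto simp: ennreal_less_iff)
  obtain c where c: "c \<in> A" "x \<in> dom_chart c" by (rule chart_at)
  obtain r K where r: "0 < r" "0 \<le> K"
    "\<And>y u. y \<in> ball (coords c x) r \<Longrightarrow> y \<in> half_space \<Longrightarrow>
      y \<in> image_chart c \<and> param c y \<in> UNIV \<and> q c y u u \<le> K\<^sup>2 * (norm u)\<^sup>2"
    by (rule q_bound[OF c open_UNIV UNIV_I]) (rule that)
  \<comment> \<open>Dividing by \<open>K + 1\<close> is legitimate for \<open>K = 0\<close> and
    makes \<open>K * \<delta>\<close> strictly smaller than the room left.\<close>
  define \<delta> where "\<delta> = min r ((\<epsilon> - l) / (K + 1))"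
  have \<delta>: "0 < \<delta>" "\<delta> \<le> r" "K * \<delta> < \<epsilon> - l"
  proof -
    show "0 < \<delta>" "\<delta> \<le> r" using r l by (auto simp: \<delta>_def)
    have "(K + 1) * \<delta> \<le> (K + 1) * ((\<epsilon> - l) / (K + 1))"
      unfolding \<delta>_def using r(2) by (intro mult_left_mono) auto
    also have "\<dots> = \<epsilon> - l" using r(2) by simp
    finally have "(K + 1) * \<delta> \<le> \<epsilon> - l" .
    then show "K * \<delta> < \<epsilon> - l" using \<open>0 < \<delta>\<close> by (simp add: algebra_simps)
  qed
  let ?T = "dom_chart c \<inter> coords c -` ball (coords c x) \<delta>"
  have "?T \<subseteq> riemannian_ball A g p \<epsilon>"
  proof
    fix y assume y: "y \<in> ?T"
    let ?\<sigma> = "param c \<circ> linepath (coords c x) (coords c y)"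
    have r': "z \<in> image_chart c \<and> q c z u u \<le> K\<^sup>2 * (norm u)\<^sup>2" if "z \<in> ball (coords c x) r" "z \<in> half_space" for z u
      using r(3)[OF that] by blast
    have hs: "coords c x \<in> half_space" "coords c y \<in> half_space"
      using y c coords_half_space[OF c(1)] by auto
    have mem: "coords c x \<in> ball (coords c x) r" "coords c y \<in> ball (coords c x) r"
      using r \<delta> y by auto
    have seg: "piecewise_C1_path A ?\<sigma>"
      "path_length A g ?\<sigma> \<le> ennreal (K * norm (coords c y - coords c x))"
      by (rule segment_path[OF c(1) _ r(2) mem(1) hs(1) mem(2) hs(2)], rule r', assumption+)+
    have ends: "pathstart ?\<sigma> = x" "pathfinish ?\<sigma> = y"
      using y c by (auto simp: pathstart_compose pathfinish_compose)
    have "path_length A g (\<gamma> +++ ?\<sigma>) \<le> path_length A g \<gamma> + path_length A g ?\<sigma>"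
      by (rule path_length_join[OF \<gamma>(1) seg(1)]) (rule trans[OF \<gamma>(3) ends(1)[symmetric]])
    also have "\<dots> \<le> ennreal l + ennreal (K * norm (coords c y - coords c x))"
      unfolding l(1) by (rule add_left_mono[OF seg(2)])
    also have "\<dots> = ennreal (l + K * norm (coords c y - coords c x))"
      using l r by (simp add: ennreal_plus)
    also have "\<dots> < ennreal \<epsilon>"
    proof -
      have "norm (coords c y - coords c x) \<le> \<delta>" using y by (simp add: dist_norm norm_minus_commute)
      then have "K * norm (coords c y - coords c x) \<le> K * \<delta>" using r by (intro mult_left_mono) auto
      then show ?thesis using \<delta> l by (intro ennreal_lessI) auto
    qed
    finally have "path_length A g (\<gamma> +++ ?\<sigma>) < ennreal \<epsilon>" .
    moreover have "piecewise_C1_path A (\<gamma> +++ ?\<sigma>)"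
      using piecewise_C1_join[OF \<gamma>(1) seg(1)] \<gamma>(3) ends by simp
    moreover have "pathstart (\<gamma> +++ ?\<sigma>) = p" "pathfinish (\<gamma> +++ ?\<sigma>) = y" using \<gamma> ends by simp_all
    ultimately show "y \<in> riemannian_ball A g p \<epsilon>"
      unfolding riemannian_ball_def riemannian_dist_def by (auto simp: INF_less_iff)
  qed
  moreover have "open ?T" by (rule open_param_image[OF c(1) open_ball])
  ultimately show "\<exists>T. open T \<and> x \<in> T \<and> T \<subseteq> riemannian_ball A g p \<epsilon>"
    using c \<delta>(1) by (intro exI[of _ ?T]) auto
qed

end

section \<open>Riemannian measure and boundary measure\<close>

text \<open>\<open>measure_of\<close> keeps the prescribed values only for a countably additive
  function. Here \<open>m\<close> is a finite sum of push-forwards of weighted Lebesgue measures,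
  hence a measure.\<close>

lemma emeasure_glued:
  fixes Z :: "nat \<Rightarrow> 'b::euclidean_space set" and P :: "nat \<Rightarrow> 'b \<Rightarrow> 'a::topological_space"
    and w :: "nat \<Rightarrow> 'b \<Rightarrow> ennreal"
  assumes Z: "\<And>i. i < n \<Longrightarrow> Z i \<in> sets borel"
    and P: "\<And>i. i < n \<Longrightarrow> P i \<in> measurable (restrict_space borel (Z i)) borel"
    and w: "\<And>i. i < n \<Longrightarrow> w i \<in> borel_measurable (restrict_space borel (Z i))"
    and m: "\<And>B. B \<in> sets borel \<Longrightarrow> m B = (\<Sum>i<n. \<integral>\<^sup>+z\<in>{z \<in> Z i. P i z \<in> B}. w i z \<partial>lborel)"
    and B: "B \<in> sets borel"
  shows "emeasure (measure_of UNIV (sets borel) m) B = m B"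
proof -
  define N where "N i = distr (density (restrict_space lborel (Z i)) (w i)) borel (P i)" for i
  have N: "emeasure (N i) B = (\<integral>\<^sup>+z\<in>{z \<in> Z i. P i z \<in> B}. w i z \<partial>lborel)"
    if i: "i < n" and B: "B \<in> sets borel" for i B
  proof -
    have sets: "sets (restrict_space lborel (Z i)) = sets (restrict_space borel (Z i))"
      by (simp add: sets_restrict_space)
    have [measurable]: "P i \<in> measurable (restrict_space lborel (Z i)) borel"
      "w i \<in> borel_measurable (restrict_space lborel (Z i))"
      using P[OF i] w[OF i] measurable_cong_sets[OF sets refl] by blast+
    have sp: "space (restrict_space lborel (Z i)) = Z i" by (simp add: space_restrict_space)
    have pre: "P i -` B \<inter> Z i \<in> sets (restrict_space lborel (Z i))"
      using measurable_sets[of "P i" "restrict_space lborel (Z i)" borel B] B sp by simp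
    have "emeasure (N i) B = emeasure (density (restrict_space lborel (Z i)) (w i)) (P i -` B \<inter> Z i)"
      unfolding N_def using B sp by (subst emeasure_distr) simp_all
    also have "\<dots> = (\<integral>\<^sup>+z. w i z * indicator (P i -` B \<inter> Z i) z \<partial>restrict_space lborel (Z i))"
      by (rule emeasure_density) (use pre in simp_all)
    also have "\<dots> = (\<integral>\<^sup>+z. w i z * indicator (P i -` B \<inter> Z i) z * indicator (Z i) z \<partial>lborel)"
      by (rule nn_integral_restrict_space) (simp add: Z[OF i])
    also have "\<dots> = (\<integral>\<^sup>+z\<in>{z \<in> Z i. P i z \<in> B}. w i z \<partial>lborel)"
      by (rule nn_integral_cong) (auto simp: indicator_def)
    finally show ?thesis .
  qed
  have mN: "m B = (\<Sum>i<n. emeasure (N i) B)" if "B \<in> sets borel" for B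
    using that by (simp add: m N)
  show ?thesis
  proof (rule emeasure_measure_of_sigma[OF _ _ _ B])
    show "sigma_algebra UNIV (sets borel :: 'a set set)"
      using sets.sigma_algebra_axioms[of borel] by simp
    show "positive (sets borel) m"
      using mN by (simp add: positive_def)
    show "countably_additive (sets borel) m"
    proof (rule countably_additiveI)
      fix F :: "nat \<Rightarrow> 'a set"
      assume F: "range F \<subseteq> sets borel" "disjoint_family F" "(\<Union>i. F i) \<in> sets borel"
      have "(\<Sum>j. m (F j)) = (\<Sum>j. \<Sum>i<n. emeasure (N i) (F j))"
        using F(1) by (intro suminf_cong mN) auto
      also have "\<dots> = (\<Sum>i<n. \<Sum>j. emeasure (N i) (F j))"
        by (rule suminf_sum) simp
      also have "\<dots> = (\<Sum>i<n. emeasure (N i) (\<Union>j. F j))"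
        using F by (intro sum.cong refl suminf_emeasure) (auto simp: N_def)
      also have "\<dots> = m (\<Union>j. F j)" by (simp add: mN F(3))
      finally show "(\<Sum>j. m (F j)) = m (\<Union>j. F j)" .
    qed
  qed
qed

text \<open>The restrictions to \<open>U\<close> are the same measure, so the integrals agree for
  every \<open>f\<close>, measurable or not.\<close>

lemma nn_integral_measures_agree:
  assumes "sets M = sets N" "U \<in> sets M"
    and "\<And>B. B \<in> sets M \<Longrightarrow> B \<subseteq> U \<Longrightarrow> emeasure M B = emeasure N B"
  shows "(\<integral>\<^sup>+x\<in>U. f x \<partial>M) = (\<integral>\<^sup>+x\<in>U. f x \<partial>N)"
proof -
  have sp: "space M = space N" using assms(1) by (rule sets_eq_imp_space_eq)
  have U: "U \<inter> space M \<in> sets M" "U \<inter> space N \<in> sets N" using assms(1,2) by auto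
  have "restrict_space M U = restrict_space N U"
  proof (rule measure_eqI)
    show "sets (restrict_space M U) = sets (restrict_space N U)"
      using assms(1) by (simp add: sets_restrict_space)
    fix B assume "B \<in> sets (restrict_space M U)"
    then have B: "B \<in> sets M" "B \<subseteq> U"
      using U(1) by (auto simp: sets_restrict_space_iff)
    then show "emeasure (restrict_space M U) B = emeasure (restrict_space N U) B"
      using U assms by (simp add: emeasure_restrict_space)
  qed
  then show ?thesis
    using nn_integral_restrict_space[OF U(1), of f] nn_integral_restrict_space[OF U(2), of f] by simp
qed

lemma continuous_on_gram_det:
  fixes f :: "'c::topological_space \<Rightarrow> 'b \<Rightarrow> 'b \<Rightarrow> real"
  assumes "\<And>u v. continuous_on S (\<lambda>y. f y u v)"
  shows "continuous_on S (\<lambda>y. gram_det B (f y))"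
  unfolding gram_det_def
  by (intro continuous_on_sum continuous_on_mult continuous_on_const continuous_on_prod assms)

context riemannian
begin

lemma continuous_volume_density: "c \<in> A \<Longrightarrow> continuous_on (image_chart c) (volume_density A g c)"
  unfolding volume_density_def
  by (intro continuous_on_real_sqrt continuous_on_gram_det continuous_q)

lemma continuous_boundary_density:
  "c \<in> A \<Longrightarrow> continuous_on {z. (z, 0) \<in> image_chart c} (boundary_density A g c)"
  unfolding boundary_density_def
  by (intro continuous_on_real_sqrt continuous_on_gram_det
        continuous_on_compose2[OF continuous_q]) (auto intro!: continuous_intros)

end

context manifold
begin

text \<open>Images under a chart are preimages under its continuous inverse, and preimages preserve
  Borel sets.\<close>

lemma borel_image_chart:
  assumes "c \<in> A" "B \<in> sets borel"
  shows "coords c ` (dom_chart c \<inter> B) \<in> sets borel"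
proof -
  obtain W where W: "open W" "coords c ` (dom_chart c \<inter> UNIV) = half_space \<inter> W"
    using image_open[OF assms(1) open_UNIV] .
  then have img: "image_chart c \<in> sets borel" by (simp add: closed_half_space)
  have "param c -` B \<inter> space (restrict_space borel (image_chart c)) \<in> sets (restrict_space borel (image_chart c))"
    by (rule measurable_sets[OF borel_measurable_continuous_on_restrict[OF continuous_param[OF assms(1)]] assms(2)])
  then have "param c -` B \<inter> image_chart c \<in> sets borel"
    using img by (simp add: sets_restrict_space_iff space_restrict_space)
  also have "param c -` B \<inter> image_chart c = coords c ` (dom_chart c \<inter> B)"
    using assms(1) by auto
  finally show ?thesis .
qed

end

locale compact_riemannian = riemannian A g
  for A :: "('a::{t2_space, second_countable_topology}, 'h::euclidean_space) chart set" and g +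
  assumes compact: "compact (UNIV :: 'a set)"
begin

abbreviation "cs \<equiv> chart_cover A"
abbreviation "piece \<equiv> cover_piece cs"

text \<open>Compactness yields a finite subcover by chart domains, so the choice in
  \<open>chart_cover\<close> has a witness.\<close>

lemma chart_cover_subset: "set cs \<subseteq> A"
  and chart_cover_UNIV: "(\<Union>c\<in>set cs. dom_chart c) = UNIV"
proof -
  have "\<exists>T\<subseteq>dom_chart ` A. finite T \<and> UNIV \<subseteq> \<Union>T"
  proof (rule compactE[OF compact])
    show "UNIV \<subseteq> \<Union>(dom_chart ` A)" using atlas by (simp add: smooth_atlas_def)
    show "open B" if "B \<in> dom_chart ` A" for B using that open_dom by blast
  qed blast
  then obtain T where T: "T \<subseteq> A" "finite T" "(\<Union>c\<in>T. dom_chart c) = UNIV"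
    by (metis finite_subset_image top.extremum_uniqueI)
  then obtain xs where "set xs = T" using finite_list by blast
  then have "\<exists>cs. set cs \<subseteq> A \<and> (\<Union>c\<in>set cs. dom_chart c) = UNIV" using T by blast
  then have "set cs \<subseteq> A \<and> (\<Union>c\<in>set cs. dom_chart c) = UNIV"
    unfolding chart_cover_def by (rule someI_ex)
  then show "set cs \<subseteq> A" "(\<Union>c\<in>set cs. dom_chart c) = UNIV" by blast+
qed

lemma cs_A: "i < length cs \<Longrightarrow> cs ! i \<in> A"
  using chart_cover_subset by (meson nth_mem subsetD)

lemma piece_subset: "piece i \<subseteq> dom_chart (cs ! i)"
  by (auto simp: cover_piece_def)

lemma borel_piece: "i < length cs \<Longrightarrow> piece i \<in> sets borel"
  unfolding cover_piece_def
  by (intro sets.Diff sets.finite_UN borel_open open_dom cs_A) auto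

lemma image_piece:
  assumes "i < length cs"
  shows "coords (cs ! i) ` (B \<inter> piece i) = {y \<in> coords (cs ! i) ` piece i. param (cs ! i) y \<in> B}"
  using cs_A[OF assms] piece_subset[of i] by auto

lemma borel_image_piece: "i < length cs \<Longrightarrow> coords (cs ! i) ` piece i \<in> sets borel"
  using borel_image_chart[OF cs_A borel_piece, of i i] piece_subset[of i] by (simp add: inf_absorb2)

lemma sets_riemannian_measure [simp, measurable_cong]: "sets (riemannian_measure A g) = sets borel"
  unfolding riemannian_measure_def by (simp add: sets.sets_measure_of_eq[of borel, simplified])

lemma sets_boundary_measure [simp, measurable_cong]: "sets (boundary_measure A g) = sets borel"
  unfolding boundary_measure_def by (simp add: sets.sets_measure_of_eq[of borel, simplified])

lemma space_boundary_measure [simp]: "space (boundary_measure A g) = UNIV"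
  unfolding boundary_measure_def by (simp add: space_measure_of_conv)

lemma emeasure_riemannian_measure:
  assumes "B \<in> sets borel"
  shows "emeasure (riemannian_measure A g) B =
    (\<Sum>i<length cs. \<integral>\<^sup>+y\<in>coords (cs ! i) ` (B \<inter> piece i). ennreal (volume_density A g (cs ! i) y) \<partial>lborel)"
  unfolding riemannian_measure_def Let_def
proof (rule emeasure_glued[where Z="\<lambda>i. coords (cs ! i) ` piece i" and P="\<lambda>i. param (cs ! i)"
      and w="\<lambda>i y. ennreal (volume_density A g (cs ! i) y)" and n="length cs"])
  fix i assume i: "i < length cs"
  have sub: "coords (cs ! i) ` piece i \<subseteq> image_chart (cs ! i)" using piece_subset by blast
  show "coords (cs ! i) ` piece i \<in> sets borel" by (rule borel_image_piece[OF i])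
  show "param (cs ! i) \<in> borel_measurable (restrict_space borel (coords (cs ! i) ` piece i))"
    by (intro borel_measurable_continuous_on_restrict continuous_on_subset[OF continuous_param sub] cs_A i)
  show "(\<lambda>y. ennreal (volume_density A g (cs ! i) y)) \<in> borel_measurable (restrict_space borel (coords (cs ! i) ` piece i))"
    by (intro measurable_compose[OF _ measurable_ennreal] borel_measurable_continuous_on_restrict
        continuous_on_subset[OF continuous_volume_density sub] cs_A i)
qed (simp_all add: image_piece assms)

lemma emeasure_boundary_measure:
  assumes "B \<in> sets borel"
  shows "emeasure (boundary_measure A g) B =
    (\<Sum>i<length cs. \<integral>\<^sup>+z\<in>{z. (z, 0) \<in> coords (cs ! i) ` (B \<inter> piece i)}. ennreal (boundary_density A g (cs ! i) z) \<partial>lborel)"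
  unfolding boundary_measure_def Let_def
proof (rule emeasure_glued[where Z="\<lambda>i. {z. (z, 0) \<in> coords (cs ! i) ` piece i}" and P="\<lambda>i z. param (cs ! i) (z, 0)"
      and w="\<lambda>i z. ennreal (boundary_density A g (cs ! i) z)" and n="length cs"])
  fix i assume i: "i < length cs"
  have sub: "{z. (z, 0) \<in> coords (cs ! i) ` piece i} \<subseteq> {z. (z, 0) \<in> image_chart (cs ! i)}"
    using piece_subset[of i] by blast
  have "(\<lambda>z. (z, 0)) -` (coords (cs ! i) ` piece i) \<inter> space borel \<in> sets borel"
    by (rule measurable_sets[OF _ borel_image_piece[OF i]])
       (intro borel_measurable_continuous_onI continuous_intros)
  then show "{z. (z, 0) \<in> coords (cs ! i) ` piece i} \<in> sets borel" by (simp add: vimage_def)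
  show "(\<lambda>z. param (cs ! i) (z, 0)) \<in> borel_measurable (restrict_space borel {z. (z, 0) \<in> coords (cs ! i) ` piece i})"
    by (intro borel_measurable_continuous_on_restrict continuous_on_compose2[OF continuous_param[OF cs_A[OF i]]])
       (use piece_subset[of i] in \<open>auto intro!: continuous_intros\<close>)
  show "(\<lambda>y. ennreal (boundary_density A g (cs ! i) y)) \<in> borel_measurable (restrict_space borel {z. (z, 0) \<in> coords (cs ! i) ` piece i})"
    by (intro measurable_compose[OF _ measurable_ennreal] borel_measurable_continuous_on_restrict
        continuous_on_subset[OF continuous_boundary_density sub] cs_A i)
qed (simp_all add: image_piece assms)

text \<open>In charts \<open>\<Sigma>\<close> lies in a hyperplane. This disposes of the points of
  \<open>\<Sigma>\<close> outside \<open>U\<close>, where a cut function need not have zero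
  differential.\<close>

lemma null_boundary: "manifold_boundary A \<in> null_sets (riemannian_measure A g)"
proof (rule null_setsI)
  have B: "manifold_boundary A \<in> sets borel" using closed_manifold_boundary by simp
  then show "manifold_boundary A \<in> sets (riemannian_measure A g)" by simp
  have "(\<integral>\<^sup>+y\<in>coords (cs ! i) ` (manifold_boundary A \<inter> piece i). ennreal (volume_density A g (cs ! i) y) \<partial>lborel) = 0"
    if i: "i < length cs" for i
  proof -
    have "coords (cs ! i) ` (manifold_boundary A \<inter> piece i) \<subseteq> {y. (0, 1) \<bullet> y = (0::real)}"
      using manifold_boundary_iff[OF cs_A[OF i]] piece_subset[of i] by (auto simp: inner_prod_def)
    moreover have "{y :: 'h \<times> real. (0, 1) \<bullet> y = 0} \<in> null_sets lborel"
      using negligible_hyperplane[of "(0, 1) :: 'h \<times> real" 0]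
      by (subst null_sets_completion_iff[symmetric])
         (auto simp: negligible_iff_null_sets[symmetric] zero_prod_def intro!: borel_closed closed_hyperplane)
    ultimately have "AE y in lborel. y \<notin> coords (cs ! i) ` (manifold_boundary A \<inter> piece i)"
      by (metis (no_types, lifting) AE_not_in AE_mp AE_I2 subsetD)
    then have "(\<integral>\<^sup>+y\<in>coords (cs ! i) ` (manifold_boundary A \<inter> piece i). ennreal (volume_density A g (cs ! i) y) \<partial>lborel) =
        integral\<^sup>N lborel (\<lambda>y::'h \<times> real. 0)"
      by (intro nn_integral_cong_AE) (auto elim!: eventually_mono)
    then show ?thesis by simp
  qed
  then show "emeasure (riemannian_measure A g) (manifold_boundary A) = 0"
    by (simp add: emeasure_riemannian_measure[OF B])
qed

end

section \<open>Comparison of two metrics that agree on an open set\<close>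

locale two_metrics = g: compact_riemannian A g + g': compact_riemannian A g'
  for A :: "('a::{t2_space, second_countable_topology}, 'h::euclidean_space) chart set" and g g' +
  fixes U :: "'a set"
  assumes U: "open U" and agree: "metrics_agree_on A U g g'"
begin

text \<open>The set where the coefficients differ is open in the chart, so if it contained a point
  of \<open>closure U\<close> it would meet \<open>U\<close>. The closure is required because the
  boundary norm is taken over \<open>closure U \<inter> \<Sigma>\<close>.\<close>

lemma metric_coeff_agree:
  assumes "c \<in> A" "x \<in> dom_chart c" "x \<in> closure U"
  shows "metric_coeff A g c (coords c x) u v = metric_coeff A g' c (coords c x) u v"
proof (rule ccontr)
  define h where "h x = metric_coeff A g c (coords c x) u v - metric_coeff A g' c (coords c x) u v" for x
  assume "metric_coeff A g c (coords c x) u v \<noteq> metric_coeff A g' c (coords c x) u v"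
  then have h: "h x \<noteq> 0" by (simp add: h_def)
  have "continuous_on (dom_chart c) h"
    unfolding h_def
    by (intro continuous_on_diff continuous_on_compose2[OF g.continuous_q[OF assms(1)]]
        continuous_on_compose2[OF g'.continuous_q[OF assms(1)]] g.continuous_coords assms(1)) auto
  then have "open (h -` (- {0}) \<inter> dom_chart c)"
    using continuous_on_open_vimage[OF g.open_dom[OF assms(1)]] by blast
  moreover have "x \<in> h -` (- {0}) \<inter> dom_chart c" using h assms by simp
  ultimately have "U \<inter> (h -` (- {0}) \<inter> dom_chart c) \<noteq> {}"
    using assms(3) open_Int_closure_eq_empty by (metis IntI emptyE inf_commute)
  then obtain y where y: "y \<in> U" "y \<in> dom_chart c" "h y \<noteq> 0" by auto
  have "h y = 0"
    using y agree g.coord_vector_tangent[OF assms(1) y(2)] assms(1)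
    unfolding metrics_agree_on_def h_def metric_coeff_def by simp
  then show False using y by simp
qed

text \<open>\<open>chart_cover A\<close> is determined by the atlas, so both measures are glued from
  the same pieces in the same charts and can be compared density by density.\<close>

lemma riemannian_measure_agree:
  assumes "B \<in> sets borel" "B \<subseteq> closure U"
  shows "emeasure (riemannian_measure A g) B = emeasure (riemannian_measure A g') B"
  unfolding g.emeasure_riemannian_measure[OF assms(1)] g'.emeasure_riemannian_measure[OF assms(1)]
proof (intro sum.cong refl nn_integral_cong)
  fix i y assume i: "i \<in> {..<length (chart_cover A)}"
  let ?c = "chart_cover A ! i" and ?p = "cover_piece (chart_cover A) i"
  have c: "?c \<in> A" using g.cs_A i by simp
  have "volume_density A g ?c y = volume_density A g' ?c y" if y: "y \<in> coords ?c ` (B \<inter> ?p)"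
  proof -
    obtain x where x: "y = coords ?c x" "x \<in> B" "x \<in> ?p" using y by blast
    then show ?thesis
      using metric_coeff_agree[OF c] g.piece_subset[of i] assms(2)
      unfolding volume_density_def by (auto simp: subset_iff fun_eq_iff intro!: arg_cong[of _ _ "gram_det Basis"])
  qed
  then show "ennreal (volume_density A g ?c y) * indicator (coords ?c ` (B \<inter> ?p)) y =
    ennreal (volume_density A g' ?c y) * indicator (coords ?c ` (B \<inter> ?p)) y"
    by (cases "y \<in> coords ?c ` (B \<inter> ?p)") simp_all
qed

lemma boundary_measure_agree:
  assumes "B \<in> sets borel" "B \<subseteq> closure U"
  shows "emeasure (boundary_measure A g) B = emeasure (boundary_measure A g') B"
  unfolding g.emeasure_boundary_measure[OF assms(1)] g'.emeasure_boundary_measure[OF assms(1)]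
proof (intro sum.cong refl nn_integral_cong)
  fix i z assume i: "i \<in> {..<length (chart_cover A)}"
  let ?c = "chart_cover A ! i" and ?p = "cover_piece (chart_cover A) i"
  have c: "?c \<in> A" using g.cs_A i by simp
  have "boundary_density A g ?c z = boundary_density A g' ?c z" if z: "(z, 0) \<in> coords ?c ` (B \<inter> ?p)"
  proof -
    obtain x where x: "(z, 0) = coords ?c x" "x \<in> B" "x \<in> ?p" using z by blast
    then show ?thesis
      using metric_coeff_agree[OF c] g.piece_subset[of i] assms(2)
      unfolding boundary_density_def by (auto simp: subset_iff fun_eq_iff intro!: arg_cong[of _ _ "gram_det Basis"])
  qed
  then show "ennreal (boundary_density A g ?c z) * indicator {z. (z, 0) \<in> coords ?c ` (B \<inter> ?p)} z =
    ennreal (boundary_density A g' ?c z) * indicator {z. (z, 0) \<in> coords ?c ` (B \<inter> ?p)} z"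
    by (cases "(z, 0) \<in> coords ?c ` (B \<inter> ?p)") simp_all
qed

lemma nn_integral_riemannian_agree:
  assumes "V \<in> sets borel" "V \<subseteq> closure U"
  shows "(\<integral>\<^sup>+x\<in>V. f x \<partial>riemannian_measure A g) = (\<integral>\<^sup>+x\<in>V. f x \<partial>riemannian_measure A g')"
  using assms by (intro nn_integral_measures_agree riemannian_measure_agree) auto

lemma nn_integral_boundary_agree:
  assumes "V \<in> sets borel" "V \<subseteq> closure U"
  shows "(\<integral>\<^sup>+x\<in>V. f x \<partial>boundary_measure A g) = (\<integral>\<^sup>+x\<in>V. f x \<partial>boundary_measure A g')"
  using assms by (intro nn_integral_measures_agree boundary_measure_agree) auto

end

section \<open>Finiteness of the boundary measure\<close>

text \<open>The change of variables theorem of the library is stated for \<open>real ^ 'n\<close> with a well-ordered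
  finite index type, so an index type for the basis of a Euclidean space is needed.\<close>

typedef (overloaded) ('h::euclidean_space) basis_index = "{..<DIM('h)}"
  by (rule exI[of _ 0]) simp

instance basis_index :: (euclidean_space) finite
proof
  have "(UNIV :: 'a basis_index set) = Abs_basis_index ` {..<DIM('a)}"
    by (metis type_definition.Abs_image type_definition_basis_index)
  then show "finite (UNIV :: 'a basis_index set)" by (metis finite_imageI finite_lessThan)
qed

instantiation basis_index :: (euclidean_space) wellorder
begin

definition less_eq_basis_index :: "'a basis_index \<Rightarrow> 'a basis_index \<Rightarrow> bool" where
  "x \<le> y \<longleftrightarrow> Rep_basis_index x \<le> Rep_basis_index y"

definition less_basis_index :: "'a basis_index \<Rightarrow> 'a basis_index \<Rightarrow> bool" where
  "x < y \<longleftrightarrow> Rep_basis_index x < Rep_basis_index y"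

instance
proof
  fix P :: "'a basis_index \<Rightarrow> bool" and a :: "'a basis_index"
  assume *: "\<And>x. (\<And>y. y < x \<Longrightarrow> P y) \<Longrightarrow> P x"
  show "P a"
    by (induction a rule: measure_induct_rule[of Rep_basis_index]) (use * in \<open>auto simp: less_basis_index_def\<close>)
qed (auto simp: less_eq_basis_index_def less_basis_index_def Rep_basis_index_inject)

end

lemma card_basis_index: "CARD('h::euclidean_space basis_index) = DIM('h)"
  using type_definition.card[OF type_definition_basis_index] by simp

definition basis_enum :: "'h::euclidean_space basis_index \<Rightarrow> 'h" where
  "basis_enum = (SOME e. bij_betw e UNIV Basis)"

lemma bij_basis_enum: "bij_betw (basis_enum :: 'h::euclidean_space basis_index \<Rightarrow> 'h) UNIV Basis"
proof -
  have "\<exists>e :: 'h basis_index \<Rightarrow> 'h. bij_betw e UNIV Basis"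
    by (rule finite_same_card_bij) (simp_all add: card_basis_index)
  then show ?thesis unfolding basis_enum_def by (rule someI_ex)
qed

lemma basis_enum_Basis [simp]: "basis_enum i \<in> Basis"
  using bij_basis_enum by (auto simp: bij_betw_def)

lemma sum_Basis_enum: "(\<Sum>b\<in>Basis. f b) = (\<Sum>i\<in>UNIV. f (basis_enum i))"
  by (rule sum.reindex_bij_betw[OF bij_basis_enum, symmetric])

lemma basis_enum_inner: "basis_enum i \<bullet> basis_enum j = (if i = j then 1 else 0)"
  by (simp add: inner_Basis inj_eq[OF bij_betw_imp_inj_on[OF bij_basis_enum]])

text \<open>Conjugation by \<open>e\<close> carries permutations of the index type to permutations
  of \<open>B\<close>. It sends transpositions to transpositions, so signs are preserved by
  induction on the number of swaps.\<close>

lemma gram_det_reindex: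
  fixes e :: "'n::finite \<Rightarrow> 'b"
  assumes e: "bij_betw e UNIV B"
  shows "gram_det B f = det (\<chi> i j. f (e i) (e j))"
proof -
  define \<Phi> where "\<Phi> = (\<lambda>p x. if x \<in> B then e (p (inv_into UNIV e x)) else x)"
  have bij: "bij_betw \<Phi> {p. p permutes UNIV} {p. p permutes B}"
    unfolding \<Phi>_def by (rule bij_betw_permutations[OF e])
  have inj: "inj e" and eB: "e i \<in> B" for i using e by (auto simp: bij_betw_def)
  have fB: "finite B" using e by (metis bij_betw_finite finite)
  have pe: "\<Phi> p (e i) = e (p i)" for p i by (simp add: \<Phi>_def eB inj)
  have perm: "\<Phi> p permutes B" if "p permutes UNIV" for p
    using bij that by (auto simp: bij_betw_def)
  have sign: "sign (\<Phi> p) = sign p" if "p permutes UNIV" for p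
    using that finite
  proof (induction p rule: permutes_induct)
    case id
    have "\<Phi> id = id" by (auto simp: \<Phi>_def fun_eq_iff f_inv_into_f e[unfolded bij_betw_def, THEN conjunct2])
    then show ?case by (simp only: sign_id)
  next
    case (swap a b p)
    have eq: "\<Phi> (Transposition.transpose a b \<circ> p) = Transposition.transpose (e a) (e b) \<circ> \<Phi> p"
    proof
      fix x
      show "\<Phi> (Transposition.transpose a b \<circ> p) x = (Transposition.transpose (e a) (e b) \<circ> \<Phi> p) x"
      proof (cases "x \<in> B")
        case True
        then obtain i where "x = e i" using e by (auto simp: bij_betw_def)
        then show ?thesis by (simp add: pe) (auto simp: Transposition.transpose_def inj_eq[OF inj])
      next
        case False
        then have "x \<noteq> e a" "x \<noteq> e b" using eB by auto
        then show ?thesis using False by (simp add: \<Phi>_def)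
      qed
    qed
    have pm: "permutation (\<Phi> p)" "permutation p"
      using perm swap fB by (auto simp: permutation_permutes)
    have ih: "sign (\<Phi> p) = sign p" using swap by simp
    show ?case
      by (simp only: eq ih sign_compose[OF permutation_swap_id pm(1)]
          sign_compose[OF permutation_swap_id pm(2)] sign_swap_id inj_eq[OF inj])
  qed
  have "gram_det B f = (\<Sum>p | p permutes (UNIV::'n set). of_int (sign (\<Phi> p)) * (\<Prod>b\<in>B. f b (\<Phi> p b)))"
    unfolding gram_det_def by (rule sum.reindex_bij_betw[OF bij, symmetric])
  also have "\<dots> = (\<Sum>p | p permutes (UNIV::'n set). of_int (sign p) * (\<Prod>i\<in>UNIV. f (e i) (e (p i))))"
  proof (intro sum.cong refl)
    fix p :: "'n \<Rightarrow> 'n" assume p: "p \<in> {p. p permutes UNIV}"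
    have "(\<Prod>b\<in>B. f b (\<Phi> p b)) = (\<Prod>i\<in>UNIV. f (e i) (\<Phi> p (e i)))"
      by (rule prod.reindex_bij_betw[OF e, symmetric])
    then show "of_int (sign (\<Phi> p)) * (\<Prod>b\<in>B. f b (\<Phi> p b)) = of_int (sign p) * (\<Prod>i\<in>UNIV. f (e i) (e (p i)))"
      using p sign by (simp add: pe)
  qed
  also have "\<dots> = det (\<chi> i j. f (e i) (e j))" by (simp add: det_def)
  finally show ?thesis .
qed

section \<open>Jacobians and change of variables in Euclidean space\<close>

text \<open>This is the modulus of the determinant of \<open>T\<close>; \<open>gram_det\<close>
  serves as a determinant of a general, not necessarily symmetric, matrix indexed by
  \<open>Basis\<close>.\<close>

definition jacobian :: "('h::euclidean_space \<Rightarrow> 'h) \<Rightarrow> real" where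
  "jacobian T = \<bar>gram_det Basis (\<lambda>u v. T v \<bullet> u)\<bar>"

text \<open>The pulled-back form has matrix \<open>M^T N M\<close> and determinants multiply. The
  hypothesis is bilinearity of \<open>G\<close>, in coordinates.\<close>

lemma gram_det_pullback:
  fixes T :: "'h::euclidean_space \<Rightarrow> 'h"
  assumes G: "\<And>u v. G u v = (\<Sum>i\<in>Basis. \<Sum>j\<in>Basis. (u \<bullet> i) * (v \<bullet> j) * G i j)"
  shows "gram_det Basis (\<lambda>u v. G (T u) (T v)) = (jacobian T)\<^sup>2 * gram_det Basis G"
proof -
  let ?e = "basis_enum :: 'h basis_index \<Rightarrow> 'h"
  define M :: "real^('h basis_index)^('h basis_index)" where "M = (\<chi> i j. T (?e j) \<bullet> ?e i)"
  define N :: "real^('h basis_index)^('h basis_index)" where "N = (\<chi> i j. G (?e i) (?e j))"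
  have "(\<chi> i j. G (T (?e i)) (T (?e j))) = transpose M ** (N ** M)"
  proof -
    have "G (T (?e i)) (T (?e j)) = (\<Sum>k\<in>UNIV. \<Sum>l\<in>UNIV. (T (?e i) \<bullet> ?e k) * (T (?e j) \<bullet> ?e l) * G (?e k) (?e l))" for i j
      by (subst G) (simp add: sum_Basis_enum)
    then show ?thesis
      by (simp add: vec_eq_iff M_def N_def matrix_matrix_mult_def transpose_def sum_distrib_left mult.commute mult.left_commute)
  qed
  then have "det (\<chi> i j. G (T (?e i)) (T (?e j))) = (det M)\<^sup>2 * det N"
    by (simp add: det_mul power2_eq_square)
  then show ?thesis
    by (simp add: gram_det_reindex[OF bij_basis_enum] jacobian_def M_def N_def)
qed

definition from_coords :: "real^('h::euclidean_space basis_index) \<Rightarrow> 'h" where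
  "from_coords x = (\<Sum>i\<in>UNIV. (x $ i) *\<^sub>R basis_enum i)"

definition to_coords :: "'h::euclidean_space \<Rightarrow> real^('h basis_index)" where
  "to_coords z = (\<chi> i. z \<bullet> basis_enum i)"

lemma from_coords_inner: "from_coords x \<bullet> basis_enum i = x $ i"
  by (simp add: from_coords_def inner_sum_left basis_enum_inner if_distrib[of "\<lambda>t. _ * t"] cong: if_cong)

lemma to_from [simp]: "to_coords (from_coords x) = x"
  by (simp add: to_coords_def from_coords_inner vec_eq_iff)

lemma from_to [simp]: "from_coords (to_coords z) = z"
  using euclidean_representation[of z] by (simp add: from_coords_def to_coords_def sum_Basis_enum)

lemma to_coords_image: "to_coords ` S = from_coords -` S"
proof safe
  fix x assume "from_coords x \<in> S"
  then show "x \<in> to_coords ` S" by (intro image_eqI[of _ _ "from_coords x"]) simp_all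
qed simp

lemma linear_from_coords: "linear from_coords"
  by (intro linearI) (simp_all add: from_coords_def scaleR_left_distrib sum.distrib scaleR_sum_right)

lemma linear_to_coords: "linear to_coords"
  by (intro linearI) (simp_all add: to_coords_def vec_eq_iff inner_left_distrib)

lemma bounded_linear_coords: "bounded_linear from_coords" "bounded_linear to_coords"
  by (simp_all add: linear_from_coords linear_to_coords linear_conv_bounded_linear[symmetric])

lemma measurable_from_coords [measurable]: "from_coords \<in> borel \<rightarrow>\<^sub>M borel"
  by (intro borel_measurable_continuous_onI linear_continuous_on bounded_linear_coords)

text \<open>Relabelling coordinates along an orthonormal basis carries boxes to boxes of the same
  volume, and volumes of boxes determine Lebesgue measure.\<close>

lemma lborel_from_coords: "lborel = distr lborel borel (from_coords :: _ \<Rightarrow> 'h::euclidean_space)"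
proof (rule lborel_eqI)
  fix l u :: 'h assume lu: "\<And>b. b \<in> Basis \<Longrightarrow> l \<bullet> b \<le> u \<bullet> b"
  have eq: "from_coords -` box l u = box (to_coords l) (to_coords u)"
  proof -
    have "from_coords x \<in> box l u \<longleftrightarrow> x \<in> box (to_coords l) (to_coords u)" for x
    proof -
      have "(\<forall>b\<in>Basis. P b) \<longleftrightarrow> (\<forall>i. P (basis_enum i))" for P :: "'h \<Rightarrow> bool"
        using bij_basis_enum by (metis bij_betw_imp_surj_on image_iff UNIV_I)
      then show ?thesis
        by (simp add: mem_box_cart mem_box from_coords_inner to_coords_def)
    qed
    then show ?thesis by auto
  qed
  have "emeasure (distr lborel borel from_coords) (box l u) = emeasure lborel (box (to_coords l) (to_coords u))"
    by (subst emeasure_distr) (simp_all add: eq)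
  also have "\<dots> = (\<Prod>b\<in>Basis. (to_coords u - to_coords l) \<bullet> b)"
    using lu by (intro emeasure_lborel_box) (auto simp: Basis_vec_def inner_axis to_coords_def)
  also have "(\<Prod>b\<in>Basis. (to_coords u - to_coords l) \<bullet> b) = (\<Prod>i\<in>UNIV. (to_coords u - to_coords l) $ i)"
  proof -
    have b: "bij_betw (\<lambda>i. axis i 1) UNIV (Basis :: (real^('h basis_index)) set)"
      by (auto simp: bij_betw_def inj_on_def Basis_vec_def axis_eq_axis)
    show ?thesis
      by (subst prod.reindex_bij_betw[OF b, symmetric]) (simp add: inner_axis)
  qed
  also have "\<dots> = (\<Prod>b\<in>Basis. (u - l) \<bullet> b)"
    by (subst prod.reindex_bij_betw[OF bij_basis_enum, symmetric]) (simp add: to_coords_def inner_diff_left)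
  finally show "emeasure (distr lborel borel from_coords) (box l u) = (\<Prod>b\<in>Basis. (u - l) \<bullet> b)" .
qed simp

lemma nn_integral_jacobian_finite:
  fixes \<tau> :: "'h::euclidean_space \<Rightarrow> 'h"
  assumes S: "S \<in> sets borel"
    and T: "\<And>z. z \<in> S \<Longrightarrow> (\<tau> has_derivative T z) (at z within S)"
    and inj: "inj_on \<tau> S"
    and img: "\<tau> ` S \<in> sets borel" "bounded (\<tau> ` S)"
    and w: "(\<lambda>z. w z * indicator S z) \<in> borel_measurable borel"
    and le: "\<And>z. z \<in> S \<Longrightarrow> w z \<le> ennreal (C * jacobian (T z))" and C: "0 \<le> C"
  shows "(\<integral>\<^sup>+z\<in>S. w z \<partial>lborel) < \<infinity>"
proof -
  define S' where "S' = from_coords -` S"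
  have S'_eq: "S' = to_coords ` S"
    by (simp add: S'_def to_coords_image)
  have S': "S' \<in> sets borel"
    unfolding S'_def using measurable_sets[OF measurable_from_coords S] by simp
  let ?f = "to_coords \<circ> \<tau> \<circ> from_coords"
  define f' where "f' x = to_coords \<circ> T (from_coords x) \<circ> from_coords" for x
  have der: "(?f has_derivative f' x) (at x within S')" if x: "x \<in> S'" for x
  proof -
    have 1: "(from_coords has_derivative from_coords) (at x within S')"
      by (rule bounded_linear_imp_has_derivative[OF bounded_linear_coords(1)])
    have "from_coords ` S' = S" by (auto simp: S'_eq image_image)
    then have "(\<tau> has_derivative T (from_coords x)) (at (from_coords x) within from_coords ` S')"
      using T x by (simp add: S'_def)
    from bounded_linear.has_derivative[OF bounded_linear_coords(2) has_derivative_in_compose[OF 1 this]]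
    show ?thesis by (simp add: f'_def comp_def)
  qed
  have inj': "inj_on ?f S'"
  proof (rule inj_onI)
    fix x y assume xy: "x \<in> S'" "y \<in> S'" "?f x = ?f y"
    then have "\<tau> (from_coords x) = \<tau> (from_coords y)" by (metis comp_apply from_to)
    then have "from_coords x = from_coords y" using inj xy by (auto simp: S'_def inj_on_def)
    then show "x = y" by (metis to_from)
  qed
  have im: "?f ` S' = to_coords ` (\<tau> ` S)" by (auto simp: S'_eq image_image)
  have "?f ` S' \<in> sets borel"
    using measurable_sets[OF measurable_from_coords img(1)] im by (simp add: to_coords_image)
  moreover have "bounded (?f ` S')"
    unfolding im by (rule bounded_linear_image[OF img(2) bounded_linear_coords(2)])
  ultimately have "?f ` S' \<in> lmeasurable"
    using bounded_set_imp_lmeasurable by (metis lborelD sets_completionI_sets sets_lborel)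
  \<comment> \<open>The constant integrand takes values in \<open>real^1\<close> to fit the
    vector-valued change of variables formula.\<close>
  then have "(\<lambda>_. 1 :: real^1) absolutely_integrable_on (?f ` S')"
    by (rule absolutely_integrable_on_const)
  then have "(\<lambda>x. \<bar>det (matrix (f' x))\<bar> *\<^sub>R (1 :: real^1)) absolutely_integrable_on S'"
    using absolutely_integrable_change_of_variables[OF _ der inj', of "\<lambda>_. 1 :: real^1"] S'
    by (simp add: sets_completionI_sets)
  then have int: "integrable lebesgue (\<lambda>x. indicator S' x *\<^sub>R \<bar>det (matrix (f' x))\<bar> *\<^sub>R (1 :: real^1))"
    by (simp add: set_integrable_def)
  have jac: "jacobian (T (from_coords x)) = \<bar>det (matrix (f' x))\<bar>" for x
  proof -
    have "from_coords (axis j 1) = basis_enum j" for j :: "'h basis_index"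
      by (simp add: from_coords_def axis_def if_distrib[of "\<lambda>t. t *\<^sub>R _"] cong: if_cong)
    then show ?thesis
      by (simp add: jacobian_def gram_det_reindex[OF bij_basis_enum] matrix_def f'_def to_coords_def)
  qed
  have n1: "norm (1 :: real^1) = 1" by (simp add: norm_vec_def L2_set_def)
  have "(\<integral>\<^sup>+z\<in>S. w z \<partial>lborel) = (\<integral>\<^sup>+x. w (from_coords x) * indicator S (from_coords x) \<partial>lborel)"
    by (subst lborel_from_coords, subst nn_integral_distr) (use w in simp_all)
  also have "\<dots> \<le> (\<integral>\<^sup>+x. ennreal C * ennreal (norm (indicator S' x *\<^sub>R \<bar>det (matrix (f' x))\<bar> *\<^sub>R (1 :: real^1))) \<partial>lborel)"
  proof (rule nn_integral_mono)
    fix x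
    show "w (from_coords x) * indicator S (from_coords x)
      \<le> ennreal C * ennreal (norm (indicator S' x *\<^sub>R \<bar>det (matrix (f' x))\<bar> *\<^sub>R (1 :: real^1)))"
    proof (cases "from_coords x \<in> S")
      case True
      then show ?thesis
        using le[OF True] C n1 by (simp add: S'_def jac ennreal_mult')
    qed simp
  qed
  \<comment> \<open>The change of variables gives measurability of the Jacobian for the completed
    measure; passing to it does not change the integral.\<close>
  also have "\<dots> = (\<integral>\<^sup>+x. ennreal C * ennreal (norm (indicator S' x *\<^sub>R \<bar>det (matrix (f' x))\<bar> *\<^sub>R (1 :: real^1))) \<partial>lebesgue)"
    by (rule nn_integral_completion[symmetric])
  also have "\<dots> = ennreal C * (\<integral>\<^sup>+x. ennreal (norm (indicator S' x *\<^sub>R \<bar>det (matrix (f' x))\<bar> *\<^sub>R (1 :: real^1))) \<partial>lebesgue)"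
    by (rule nn_integral_cmult[OF measurable_compose[OF
          measurable_compose[OF borel_measurable_integrable[OF int] borel_measurable_norm]
          measurable_ennreal]])
  also have "\<dots> < \<infinity>"
    using int by (simp add: integrable_iff_bounded ennreal_mult_less_top)
  finally show ?thesis .
qed

section \<open>Boundary densities under a change of charts\<close>

context riemannian
begin

text \<open>Transition maps preserve the boundary, so they induce maps between boundary coordinates;
  with differential \<open>t\<close> there, the Gram matrices of the two charts are related by a
  pull-back along \<open>t\<close>.\<close>

lemma boundary_density_change:
  assumes c: "c \<in> A" and d: "d \<in> A" and x: "x \<in> dom_chart c" "x \<in> dom_chart d"
    and z: "coords c x = (z, 0)" and w: "coords d x = (w, 0)"
  obtains t where "((\<lambda>z. fst (coords d (param c (z, 0)))) has_derivative t) (at z)"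
    "boundary_density A g c z = jacobian t * boundary_density A g d w"
proof -
  obtain T where T: "(coords d \<circ> param c has_derivative T) (at (coords c x) within half_space)"
    using transition_has_derivative[OF c d x] .
  obtain W where W: "open W" "\<And>z. z \<in> W \<Longrightarrow> z \<in> half_space \<Longrightarrow> z \<in> image_chart c \<and> param c z \<in> dom_chart d"
    "\<And>x. x \<in> dom_chart c \<Longrightarrow> x \<in> dom_chart d \<Longrightarrow> coords c x \<in> W"
    using coords_open_image[OF c open_dom[OF d]] by blast
  define N where "N = (\<lambda>z. (z, 0)) -` W"
  have N: "open N" unfolding N_def by (rule open_vimage[OF W(1)]) (intro continuous_intros)
  have zN: "z \<in> N" using W(3)[OF x] z by (simp add: N_def)
  have hs: "(u, 0) \<in> half_space" for u :: 'h by (simp add: half_space_def)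
  have "((\<lambda>z. (z, 0)) has_derivative (\<lambda>u. (u, 0))) (at z within N)"
    by (intro derivative_intros)
  moreover have "(coords d \<circ> param c has_derivative T) (at (z, 0) within (\<lambda>z. (z, 0)) ` N)"
    using T unfolding z by (rule has_derivative_subset) (use hs in blast)
  ultimately have "((\<lambda>z. (coords d \<circ> param c) (z, 0)) has_derivative (\<lambda>u. T (u, 0))) (at z within N)"
    by (rule has_derivative_in_compose)
  then have D: "((\<lambda>z. coords d (param c (z, 0))) has_derivative (\<lambda>u. T (u, 0))) (at z)"
    by (simp add: at_within_open[OF zN N])
  have "((\<lambda>z. snd (coords d (param c (z, 0)))) has_derivative (\<lambda>u. snd (T (u, 0)))) (at z)"
    by (rule has_derivative_snd[OF D])
  \<comment> \<open>Along the boundary the last coordinate of the transition map is constantly 0, so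
    \<open>T\<close> maps horizontal vectors to horizontal vectors.\<close>
  then have "((\<lambda>z. 0) has_derivative (\<lambda>u. snd (T (u, 0)))) (at z)"
  proof (rule has_derivative_transform_within_open[OF _ N zN])
    fix z' assume "z' \<in> N"
    then have z': "(z', 0) \<in> image_chart c" "param c (z', 0) \<in> dom_chart d"
      using W(2)[OF _ hs] by (auto simp: N_def)
    show "snd (coords d (param c (z', 0))) = 0"
      by (rule boundary_invariance[OF c d param_dom[OF c z'(1)] z'(2)]) (simp add: c z')
  qed
  then have "(\<lambda>u. snd (T (u, 0))) = (\<lambda>u. 0)"
    using has_derivative_unique has_derivative_const by metis
  then have T0: "T (u, 0) = (fst (T (u, 0)), 0)" for u by (metis prod.collapse)
  define t where "t u = fst (T (u, 0))" for u
  have "metric_coeff A g c (z, 0) (u, 0) (v, 0) = metric_coeff A g d (w, 0) (t u, 0) (t v, 0)" for u v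
    using coord_vector_change[OF c d x T] T0 x c d unfolding z[symmetric] w[symmetric]
    by (simp add: q_coords t_def flip: z w)
  moreover have "gram_det Basis (\<lambda>u v. metric_coeff A g d (w, 0) (t u, 0) (t v, 0)) =
      (jacobian t)\<^sup>2 * gram_det Basis (\<lambda>u v. metric_coeff A g d (w, 0) (u, 0) (v, 0))"
  proof (rule gram_det_pullback)
    fix u v :: 'h
    have wi: "(w, 0) \<in> image_chart d" using x(2) w by force
    have lin: "linear (\<lambda>u. (u, 0 :: real))" for u :: 'h by (intro linearI) auto
    have l1: "linear (\<lambda>u. q d (w, 0) (u, 0) v)" for v
      using linear_compose[OF lin linear_q_left[OF d wi]] by (simp add: comp_def)
    have l2: "linear (\<lambda>v. q d (w, 0) u (v, 0))" for u
      using linear_compose[OF lin linear_q_right[OF d wi]] by (simp add: comp_def)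
    show "q d (w, 0) (u, 0) (v, 0) = (\<Sum>i\<in>Basis. \<Sum>j\<in>Basis. (u \<bullet> i) * (v \<bullet> j) * q d (w, 0) (i, 0) (j, 0))"
      by (subst linear_real_expand[OF l1], subst linear_real_expand[OF l2]) (simp add: sum_distrib_left mult.assoc)
  qed
  ultimately have "boundary_density A g c z = jacobian t * boundary_density A g d w"
    by (simp add: boundary_density_def real_sqrt_mult jacobian_def)
  moreover have "((\<lambda>z. fst (coords d (param c (z, 0)))) has_derivative t) (at z)"
    unfolding t_def by (rule has_derivative_fst[OF D])
  ultimately show ?thesis by (rule that[rotated])
qed

text \<open>The chart domains need not be relatively compact in larger charts, so the density of a chart may
  blow up towards the end of its domain; it is compared with a chart centred at \<open>x\<close>.\<close>

lemma locally_finite_boundary_density: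
  obtains K where "open K" "x \<in> K"
    "\<And>c. c \<in> A \<Longrightarrow> (\<integral>\<^sup>+z\<in>{z. (z, 0) \<in> coords c ` (dom_chart c \<inter> K)}. ennreal (boundary_density A g c z) \<partial>lborel) < \<infinity>"
proof (cases "x \<in> manifold_boundary A")
  case False
  have empty: "{z. (z, 0) \<in> coords c ` (dom_chart c \<inter> - manifold_boundary A)} = {}" if c: "c \<in> A" for c
  proof (rule equals0I)
    fix z assume "z \<in> {z. (z, 0) \<in> coords c ` (dom_chart c \<inter> - manifold_boundary A)}"
    then obtain y where "(z, 0) = coords c y" "y \<in> dom_chart c" "y \<notin> manifold_boundary A" by blast
    then show False using manifold_boundary_iff[OF c, of y] by (metis snd_conv)
  qed
  show ?thesis
    by (rule that[of "- manifold_boundary A"]) (use False closed_manifold_boundary in \<open>auto simp: empty open_closed\<close>)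
next
  case True
  obtain d where d: "d \<in> A" "x \<in> dom_chart d" by (rule chart_at)
  obtain w where w: "coords d x = (w, 0)"
    using manifold_boundary_iff[OF d] True by (metis prod.collapse)
  define Z where "Z = {z. (z, 0) \<in> image_chart d}"
  obtain W where W: "open W" "coords d ` (dom_chart d \<inter> UNIV) = half_space \<inter> W"
    using image_open[OF d(1) open_UNIV] .
  have Z_eq: "Z = (\<lambda>z. (z, 0)) -` W"
    using W(2) by (auto simp: Z_def half_space_def)
  have Z: "open Z" unfolding Z_eq by (rule open_vimage[OF W(1)]) (intro continuous_intros)
  have wZ: "w \<in> Z" using d w unfolding Z_def by force
  have "isCont (boundary_density A g d) w"
    using continuous_boundary_density[OF d(1)] Z wZ
    by (simp add: continuous_on_eq_continuous_at Z_def)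
  then have "\<forall>\<^sub>F z in nhds w. boundary_density A g d z < boundary_density A g d w + 1"
    using continuous_at_imp_continuous_within
    by (intro order_tendstoD(2)[of _ "boundary_density A g d w"]) (auto simp: continuous_at tendsto_nhds_iff isCont_def)
  then obtain r where r: "r > 0" "\<And>z. dist z w < r \<Longrightarrow> boundary_density A g d z < boundary_density A g d w + 1"
    unfolding eventually_nhds_metric by blast
  define C where "C = \<bar>boundary_density A g d w\<bar> + 1"
  define K where "K = dom_chart d \<inter> coords d -` ball (coords d x) r"
  have K: "open K" unfolding K_def by (rule open_param_image[OF d(1) open_ball])
  show ?thesis
  proof (rule that[OF K])
    show "x \<in> K" using d r by (simp add: K_def)
    fix c assume c: "c \<in> A"
    define S where "S = {z. (z, 0) \<in> coords c ` (dom_chart c \<inter> K)}"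
    let ?\<tau> = "\<lambda>z. fst (coords d (param c (z, 0)))"
    have borel: "{z. (z, 0) \<in> coords c ` (dom_chart c \<inter> B)} \<in> sets borel"
      if "c \<in> A" "B \<in> sets borel" for c B
    proof -
      have "(\<lambda>z. (z, 0)) -` (coords c ` (dom_chart c \<inter> B)) \<inter> space borel \<in> sets borel"
        by (rule measurable_sets[OF _ borel_image_chart[OF that]])
           (intro borel_measurable_continuous_onI continuous_intros)
      then show ?thesis by (simp add: vimage_def)
    qed
    have Sx: "(z, 0) \<in> image_chart c \<and> param c (z, 0) \<in> dom_chart c \<and> param c (z, 0) \<in> dom_chart d
        \<and> param c (z, 0) \<in> K \<and> coords d (param c (z, 0)) = (?\<tau> z, 0) \<and> dist (?\<tau> z) w < r" if z: "z \<in> S" for z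
    proof -
      obtain y where y: "(z, 0) = coords c y" "y \<in> dom_chart c" "y \<in> K" using z by (auto simp: S_def)
      have py: "param c (z, 0) = y" using y c by simp
      have yd: "y \<in> dom_chart d" using y by (simp add: K_def)
      have "snd (coords d y) = 0"
        by (rule boundary_invariance[OF c d(1) y(2) yd]) (simp flip: y(1))
      then have e: "coords d y = (fst (coords d y), 0)" by (metis prod.collapse)
      have "dist (coords d x) (coords d y) < r" using y(3) by (simp add: K_def)
      then have "dist (fst (coords d y)) w < r"
        using dist_fst_le[of "coords d y" "coords d x"] w by (simp add: dist_commute)
      then show ?thesis using py y yd e by auto
    qed
    have ex: "\<exists>t. (?\<tau> has_derivative t) (at z) \<and> boundary_density A g c z = jacobian t * boundary_density A g d (?\<tau> z)"
      if "z \<in> S" for z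
      using boundary_density_change[OF c d(1), of "param c (z, 0)" z "?\<tau> z"] Sx[OF that] c by (metis coords_param)
    then obtain T where T: "\<And>z. z \<in> S \<Longrightarrow> (?\<tau> has_derivative T z) (at z)"
      "\<And>z. z \<in> S \<Longrightarrow> boundary_density A g c z = jacobian (T z) * boundary_density A g d (?\<tau> z)"
      by metis
    \<comment> \<open>The density in \<open>c\<close> is at most \<open>C\<close> times the Jacobian
      of the transition to \<open>d\<close>, and the transition carries \<open>S\<close> injectively
      into a ball; so the integral is at most \<open>C\<close> times a finite volume, for every
      \<open>c\<close>.\<close>
    have "(\<integral>\<^sup>+z\<in>S. ennreal (boundary_density A g c z) \<partial>lborel) < \<infinity>"
    proof (rule nn_integral_jacobian_finite[where \<tau>="?\<tau>" and T=T and C=C])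
      show Sb: "S \<in> sets borel" unfolding S_def using borel[OF c] K by simp
      show "(?\<tau> has_derivative T z) (at z within S)" if "z \<in> S" for z
        using T(1)[OF that] by (rule has_derivative_at_withinI)
      show "inj_on ?\<tau> S"
      proof (rule inj_onI)
        fix y z assume yz: "y \<in> S" "z \<in> S" "?\<tau> y = ?\<tau> z"
        then have "coords d (param c (y, 0)) = coords d (param c (z, 0))" using Sx by metis
        then have "param c (y, 0) = param c (z, 0)" using Sx yz d(1) param_coords by metis
        then have "(y, 0 :: real) = (z, 0)" using Sx yz c coords_param by metis
        then show "y = z" by simp
      qed
      have "?\<tau> ` S = {z. (z, 0) \<in> coords d ` (dom_chart d \<inter> (K \<inter> dom_chart c))}"
      proof (intro equalityI subsetI)
        fix z assume "z \<in> ?\<tau> ` S"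
        then obtain y where y: "y \<in> S" "z = ?\<tau> y" by blast
        then have "(z, 0) = coords d (param c (y, 0))" "param c (y, 0) \<in> dom_chart d \<inter> (K \<inter> dom_chart c)"
          using Sx[OF y(1)] by auto
        then show "z \<in> {z. (z, 0) \<in> coords d ` (dom_chart d \<inter> (K \<inter> dom_chart c))}" by blast
      next
        fix z assume "z \<in> {z. (z, 0) \<in> coords d ` (dom_chart d \<inter> (K \<inter> dom_chart c))}"
        then obtain y where y: "(z, 0) = coords d y" "y \<in> dom_chart d" "y \<in> K" "y \<in> dom_chart c" by blast
        have "snd (coords c y) = 0"
          by (rule boundary_invariance[OF d(1) c y(2,4)]) (simp flip: y(1))
        then have e: "coords c y = (fst (coords c y), 0)" by (metis prod.collapse)
        then have "fst (coords c y) \<in> S" using y by (force simp: S_def)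
        moreover have "?\<tau> (fst (coords c y)) = z"
          using e y c by (metis fst_conv param_coords)
        ultimately show "z \<in> ?\<tau> ` S" by blast
      qed
      then show "?\<tau> ` S \<in> sets borel"
        using borel[OF d(1), of "K \<inter> dom_chart c"] K open_dom[OF c] by simp
      have "?\<tau> ` S \<subseteq> ball w r" using Sx by (auto simp: dist_commute)
      then show "bounded (?\<tau> ` S)" by (rule bounded_subset[OF bounded_ball])
      have "S \<subseteq> {z. (z, 0) \<in> image_chart c}" using Sx by blast
      then have "boundary_density A g c \<in> borel_measurable (restrict_space borel S)"
        by (intro borel_measurable_continuous_on_restrict continuous_on_subset[OF continuous_boundary_density[OF c]])
      then have "(\<lambda>z. ennreal (boundary_density A g c z)) \<in> borel_measurable (restrict_space borel S)"
        by (rule measurable_compose[OF _ measurable_ennreal])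
      then show "(\<lambda>z. ennreal (boundary_density A g c z) * indicator S z) \<in> borel_measurable borel"
        using Sb by (subst (asm) borel_measurable_restrict_space_iff_ennreal) auto
      show "ennreal (boundary_density A g c z) \<le> ennreal (C * jacobian (T z))" if "z \<in> S" for z
      proof (rule ennreal_leI)
        have "boundary_density A g d (?\<tau> z) \<le> C"
          using r(2)[of "?\<tau> z"] Sx[OF that] by (simp add: C_def)
        then show "boundary_density A g c z \<le> C * jacobian (T z)"
          unfolding T(2)[OF that] mult.commute[of C]
          by (rule mult_left_mono) (simp add: jacobian_def)
      qed
      show "0 \<le> C" by (simp add: C_def)
    qed
    then show "(\<integral>\<^sup>+z\<in>{z. (z, 0) \<in> coords c ` (dom_chart c \<inter> K)}. ennreal (boundary_density A g c z) \<partial>lborel) < \<infinity>"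
      by (simp add: S_def)
  qed
qed

end

context compact_riemannian
begin

text \<open>The neighbourhood in the local result does not depend on the chart, so it bounds all
  pieces of the gluing at once; finitely many such neighbourhoods cover the manifold.\<close>

lemma finite_boundary_measure: "emeasure (boundary_measure A g) UNIV < \<infinity>"
proof -
  let ?\<mu> = "boundary_measure A g"
  have "\<forall>x. \<exists>K. open K \<and> x \<in> K \<and> emeasure ?\<mu> K < \<infinity>"
  proof
    fix x
    obtain K where K: "open K" "x \<in> K"
      "\<And>c. c \<in> A \<Longrightarrow> (\<integral>\<^sup>+z\<in>{z. (z, 0) \<in> coords c ` (dom_chart c \<inter> K)}. ennreal (boundary_density A g c z) \<partial>lborel) < \<infinity>"
      using locally_finite_boundary_density[of x] by blast
    have "(\<integral>\<^sup>+z\<in>{z. (z, 0) \<in> coords (cs ! i) ` (K \<inter> piece i)}. ennreal (boundary_density A g (cs ! i) z) \<partial>lborel) < \<infinity>"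
      if i: "i < length cs" for i
    proof (rule le_less_trans[OF nn_integral_mono K(3)[OF cs_A[OF i]]])
      fix z
      show "ennreal (boundary_density A g (cs ! i) z) * indicator {z. (z, 0) \<in> coords (cs ! i) ` (K \<inter> piece i)} z
        \<le> ennreal (boundary_density A g (cs ! i) z) * indicator {z. (z, 0) \<in> coords (cs ! i) ` (dom_chart (cs ! i) \<inter> K)} z"
        using piece_subset[of i] by (intro mult_left_mono) (auto simp: indicator_def)
    qed
    then have "emeasure ?\<mu> K < \<infinity>"
      using K(1) by (subst emeasure_boundary_measure) auto
    then show "\<exists>K. open K \<and> x \<in> K \<and> emeasure ?\<mu> K < \<infinity>" using K by blast
  qed
  then obtain K where K: "\<And>x. open (K x)" "\<And>x. x \<in> K x" "\<And>x. emeasure ?\<mu> (K x) < \<infinity>" by metis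
  obtain F where F: "finite F" "UNIV = (\<Union>x\<in>F. K x)"
    using compactE_image[OF compact, of UNIV K] K by (metis UNIV_I UN_I subsetI top.extremum_uniqueI)
  have "emeasure ?\<mu> (\<Union>x\<in>F. K x) \<le> (\<Sum>x\<in>F. emeasure ?\<mu> (K x))"
    by (rule emeasure_subadditive_finite) (use F K in auto)
  also have "\<dots> < \<infinity>" using F K by auto
  finally show ?thesis using F(2) by simp
qed

end

section \<open>The norm of the differential\<close>

context manifold
begin

text \<open>One local extension of \<open>f\<close> computes the coordinate vector at all nearby
  points, and its derivative is continuous.\<close>

lemma continuous_on_coord_vector:
  assumes c: "c \<in> A" and \<Omega>: "open \<Omega>" and f: "\<And>x. x \<in> \<Omega> \<Longrightarrow> smooth_at A f x"
  shows "continuous_on (dom_chart c \<inter> \<Omega>) (\<lambda>x. coord_vector A c x u f)"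
proof (rule continuous_at_imp_continuous_on, intro ballI)
  fix x assume x: "x \<in> dom_chart c \<inter> \<Omega>"
  obtain V F where V: "open V" "coords c x \<in> V" "\<And>k. Ck_on k F V"
    "\<And>z. z \<in> V \<Longrightarrow> z \<in> half_space \<Longrightarrow> z \<in> image_chart c \<and> param c z \<in> UNIV \<and> F z = f (param c z)"
    using smooth_at_extension[OF c _ f open_UNIV UNIV_I, of x] x by blast
  define N where "N = (dom_chart c \<inter> coords c -` V) \<inter> \<Omega>"
  have N: "open N" unfolding N_def by (intro open_Int open_param_image[OF c V(1)] \<Omega>)
  have "continuous_on V (\<lambda>y. frechet_derivative F (at y) u)"
    using V(3)[of "Suc 0"] unfolding Ck_on.simps by blast
  then have "continuous_on N (\<lambda>x. frechet_derivative F (at (coords c x)) u)"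
    by (rule continuous_on_compose2)
      (auto simp: N_def intro: continuous_on_subset[OF continuous_coords[OF c]])
  moreover have "frechet_derivative F (at (coords c y)) u = coord_vector A c y u f" if "y \<in> N" for y
    using that V(4) by (intro coord_vector_extension[symmetric, OF c _ f V(1) _ V(3)]) (auto simp: N_def)
  ultimately have "continuous_on N (\<lambda>x. coord_vector A c x u f)"
    by (simp cong: continuous_on_cong)
  then show "isCont (\<lambda>x. coord_vector A c x u f) x"
    using N x V(2) by (simp add: continuous_on_eq_continuous_at N_def)
qed

lemma linear_coord_vector:
  assumes "c \<in> A" "x \<in> dom_chart c"
  shows "linear (\<lambda>u. coord_vector A c x u f)"
  using coord_vector_lincomb[OF assms, of 1 _ 1] coord_vector_lincomb[OF assms, of _ _ 0 0]
  by (intro linearI) simp_all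

end

context riemannian
begin

text \<open>If \<open>q c (coords c x) u u = 0\<close>, then \<open>u\<close> represents the zero vector and the quotient is \<open>0 / 0 = 0\<close>.\<close>

lemma differential_norm2_chart:
  assumes c: "c \<in> A" "x \<in> dom_chart c"
  shows "differential_norm2 A g f x =
    (SUP u. ennreal ((coord_vector A c x u f)\<^sup>2 / q c (coords c x) u u))"
  unfolding differential_norm2_def
proof (rule antisym; rule SUP_least)
  fix X assume X: "X \<in> {X \<in> tangent_space A x. g x X X \<le> 1}"
  then obtain u where u: "X = coord_vector A c x u" using tangent_space_eq[OF c] by auto
  have q: "q c (coords c x) u u = g x X X" using q_coords[OF c] u by simp
  have "(X f)\<^sup>2 \<le> (X f)\<^sup>2 / g x X X"
  proof (cases "X = (\<lambda>f. 0)")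
    case False
    then have "0 < g x X X" "g x X X \<le> 1" using metric_pos X by auto
    then show ?thesis by (simp add: pos_le_divide_eq mult_left_le)
  qed simp
  then have "ennreal ((X f)\<^sup>2) \<le> ennreal ((coord_vector A c x u f)\<^sup>2 / q c (coords c x) u u)"
    using q u by (simp add: ennreal_leI)
  then show "ennreal ((X f)\<^sup>2) \<le> (SUP u. ennreal ((coord_vector A c x u f)\<^sup>2 / q c (coords c x) u u))"
    by (rule SUP_upper2[OF UNIV_I])
next
  fix u :: "'h \<times> real"
  let ?q = "q c (coords c x) u u"
  show "ennreal ((coord_vector A c x u f)\<^sup>2 / ?q) \<le> (SUP X\<in>{X \<in> tangent_space A x. g x X X \<le> 1}. ennreal ((X f)\<^sup>2))"
  proof (cases "?q = 0")
    case False
    have ci: "coords c x \<in> image_chart c" using c by blast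
    have q: "0 < ?q" using q_nonneg[OF c(1) ci, of u] False by linarith
    define v where "v = (1 / sqrt ?q) *\<^sub>R u"
    have lv: "linear (\<lambda>u. q c (coords c x) u w)" "linear (\<lambda>u. q c (coords c x) w u)" for w
      using linear_q_left[OF c(1) ci] linear_q_right[OF c(1) ci] by blast+
    have "q c (coords c x) v v = (1 / sqrt ?q) * ((1 / sqrt ?q) * ?q)"
      unfolding v_def using linear_scale[OF lv(1)] linear_scale[OF lv(2)] by simp
    also have "\<dots> = 1" using q by (simp add: field_simps flip: power2_eq_square)
    finally have 1: "g x (coord_vector A c x v) (coord_vector A c x v) \<le> 1" using q_coords[OF c] by simp
    have "coord_vector A c x v f = coord_vector A c x u f / sqrt ?q"
      unfolding v_def using linear_scale[OF linear_coord_vector[OF c, of f]] by simp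
    then have "(coord_vector A c x v f)\<^sup>2 = (coord_vector A c x u f)\<^sup>2 / ?q"
      using q by (simp add: power_divide)
    moreover have "ennreal ((coord_vector A c x v f)\<^sup>2) \<le> (SUP X\<in>{X \<in> tangent_space A x. g x X X \<le> 1}. ennreal ((X f)\<^sup>2))"
      by (rule SUP_upper) (use 1 coord_vector_tangent[OF c] in auto)
    ultimately show ?thesis by simp
  qed simp
qed

text \<open>A strict inequality for the quotient at \<open>u\<close> persists near \<open>u\<close>,
  hence at a point of \<open>D\<close>. The supremum over a countable \<open>D\<close> is what makes
  the norm of the differential measurable.\<close>

lemma differential_norm2_dense:
  assumes c: "c \<in> A" "x \<in> dom_chart c"
    and D: "\<And>X. open X \<Longrightarrow> X \<noteq> {} \<Longrightarrow> \<exists>d\<in>D. d \<in> X"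
  shows "differential_norm2 A g f x =
    (SUP u\<in>D. ennreal ((coord_vector A c x u f)\<^sup>2 / q c (coords c x) u u))" (is "_ = ?S")
  unfolding differential_norm2_chart[OF c]
proof (rule antisym)
  let ?h = "\<lambda>u. (coord_vector A c x u f)\<^sup>2 / q c (coords c x) u u"
  have ci: "coords c x \<in> image_chart c" using c by blast
  show "(SUP u. ennreal (?h u)) \<le> ?S"
  proof (rule SUP_least, rule ccontr)
    fix u assume n: "\<not> ennreal (?h u) \<le> ?S"
    \<comment> \<open>If the form vanished at \<open>u\<close>, the quotient would be
      \<open>0\<close> by the convention on division and could not exceed the supremum.\<close>
    then have q0: "q c (coords c x) u u \<noteq> 0" by (intro notI) simp
    obtain r where r: "?S = ennreal r" "0 \<le> r" "r < ?h u"
      using n by (cases ?S) (auto simp: not_le ennreal_less_iff)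
    have "isCont (\<lambda>u. coord_vector A c x u f) u"
      by (simp add: linear_continuous_at linear_coord_vector[OF c] flip: linear_conv_bounded_linear)
    moreover have "isCont (\<lambda>u. q c (coords c x) u u) u"
    proof -
      have eq: "(\<lambda>u. q c (coords c x) u u) =
          (\<lambda>u. \<Sum>i\<in>Basis. \<Sum>j\<in>Basis. (u \<bullet> i) * (u \<bullet> j) * q c (coords c x) i j)"
        by (rule ext) (rule q_expand[OF c(1) ci])
      show ?thesis by (subst eq) (intro continuous_intros)
    qed
    ultimately have "isCont ?h u" using q0 by (intro continuous_intros)
    then have "(?h \<longlongrightarrow> ?h u) (nhds u)"
      using tendsto_at_iff_tendsto_nhds[of ?h u] by (simp add: isCont_def)
    then have "\<forall>\<^sub>F v in nhds u. r < ?h v" using r(3) by (rule order_tendstoD)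
    then obtain X where X: "open X" "u \<in> X" "\<And>v. v \<in> X \<Longrightarrow> r < ?h v"
      unfolding eventually_nhds by blast
    then obtain d where d: "d \<in> D" "d \<in> X" using D[of X] by blast
    have "ennreal (?h d) \<le> ennreal r" using r(1) d(1) by (metis (no_types, lifting) SUP_upper)
    then show False using X(3)[OF d(2)] r(2) by (simp add: ennreal_le_iff)
  qed
  show "?S \<le> (SUP u. ennreal (?h u))" by (rule SUP_subset_mono) auto
qed

text \<open>All the dual norms are suprema over the same set of tangent vectors, so a bound valid
  for each vector separately passes to them.\<close>

lemma differential_norm2_le:
  assumes "\<And>X. X \<in> tangent_space A x \<Longrightarrow> (X h)\<^sup>2 \<le> a * (X f)\<^sup>2 + b * (\<Sum>i\<in>I. (X (k i))\<^sup>2)"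
    and "0 \<le> a" "0 \<le> b"
  shows "differential_norm2 A g h x \<le>
    ennreal a * differential_norm2 A g f x + ennreal b * (\<Sum>i\<in>I. differential_norm2 A g (k i) x)"
  unfolding differential_norm2_def[of A g h]
proof (rule SUP_least)
  fix X assume X: "X \<in> {X \<in> tangent_space A x. g x X X \<le> 1}"
  have up: "ennreal ((X f)\<^sup>2) \<le> differential_norm2 A g f x" for f
    unfolding differential_norm2_def by (rule SUP_upper[OF X])
  have "ennreal ((X h)\<^sup>2) \<le> ennreal (a * (X f)\<^sup>2 + b * (\<Sum>i\<in>I. (X (k i))\<^sup>2))"
    using assms(1) X by (auto intro: ennreal_leI)
  also have "\<dots> = ennreal a * ennreal ((X f)\<^sup>2) + ennreal b * (\<Sum>i\<in>I. ennreal ((X (k i))\<^sup>2))"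
    using assms(2,3) by (simp add: ennreal_plus ennreal_mult sum_nonneg)
  also have "\<dots> \<le> ennreal a * differential_norm2 A g f x + ennreal b * (\<Sum>i\<in>I. differential_norm2 A g (k i) x)"
    by (intro add_mono mult_left_mono sum_mono up) auto
  finally show "ennreal ((X h)\<^sup>2) \<le> \<dots>" .
qed

lemma differential_norm2_cong:
  assumes "open U" "x \<in> U" "\<And>y. y \<in> U \<Longrightarrow> f y = h y"
  shows "differential_norm2 A g f x = differential_norm2 A g h x"
proof -
  have "X f = X h" if "X \<in> tangent_space A x" for X
    by (rule tangent_cong[OF that assms])
  then have "ennreal ((X f)\<^sup>2) = ennreal ((X h)\<^sup>2)" if "X \<in> {X \<in> tangent_space A x. g x X X \<le> 1}" for X
    using that by (metis (no_types, lifting) mem_Collect_eq)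
  then show ?thesis unfolding differential_norm2_def by (intro SUP_cong refl)
qed

lemma differential_norm2_zero:
  assumes "open U" "x \<in> U" "\<And>y. y \<in> U \<Longrightarrow> f y = 0"
  shows "differential_norm2 A g f x = 0"
proof -
  have "differential_norm2 A g (\<lambda>_. 0) x \<le> 0"
    unfolding differential_norm2_def
  proof (rule SUP_least)
    fix X assume "X \<in> {X \<in> tangent_space A x. g x X X \<le> 1}"
    then have "X (\<lambda>_. 0) = 0" using tangent_const[of X x 0] by blast
    then show "ennreal ((X (\<lambda>_. 0))\<^sup>2) \<le> 0" by simp
  qed
  then have "differential_norm2 A g (\<lambda>_. 0) x = 0" by simp
  then show ?thesis using differential_norm2_cong[OF assms(1,2), of f "\<lambda>_. 0"] assms(3) by simp
qed

end

context compact_riemannian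
begin

text \<open>On each chart of the finite cover the norm is a countable supremum of continuous
  functions divided by continuous functions. The indicator confines the claim to
  \<open>\<Omega>\<close>, where \<open>f\<close> is smooth.\<close>

lemma borel_measurable_differential_norm2:
  assumes \<Omega>: "open \<Omega>" and f: "\<And>x. x \<in> \<Omega> \<Longrightarrow> smooth_at A f x"
  shows "(\<lambda>x. differential_norm2 A g f x * indicator \<Omega> x) \<in> borel_measurable borel"
proof -
  obtain D :: "('h \<times> real) set" where D: "countable D" "\<And>X. open X \<Longrightarrow> X \<noteq> {} \<Longrightarrow> \<exists>d\<in>D. d \<in> X"
    by (rule countable_dense_setE) blast
  let ?C = "insert (- \<Omega>) ((\<lambda>c. dom_chart c \<inter> \<Omega>) ` set cs)"
  show ?thesis
  proof (rule measurable_piecewise_restrict[of ?C])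
    show "S \<inter> space borel \<in> sets borel" if "S \<in> ?C" for S
      using that
    proof (elim insertE imageE)
      fix c assume "c \<in> set cs" "S = dom_chart c \<inter> \<Omega>"
      moreover from this have "c \<in> A" using chart_cover_subset by blast
      ultimately show ?thesis using open_Int[OF open_dom \<Omega>, of c] by simp
    qed (use \<Omega> in \<open>simp add: borel_comp\<close>)
    show "space borel \<subseteq> \<Union>?C" using chart_cover_UNIV by auto
    show "(\<lambda>x. differential_norm2 A g f x * indicator \<Omega> x) \<in> borel_measurable (restrict_space borel S)"
      if S: "S \<in> ?C" for S
    proof (cases "S = - \<Omega>")
      case True
      have "(\<lambda>x. differential_norm2 A g f x * indicator \<Omega> x) \<in> borel_measurable (restrict_space borel (- \<Omega>)) \<longleftrightarrow>
        (\<lambda>x. 0 :: ennreal) \<in> borel_measurable (restrict_space borel (- \<Omega>))"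
        by (rule measurable_cong) (simp add: space_restrict_space)
      then show ?thesis using True by simp
    next
      case False
      then obtain c where c: "c \<in> A" "S = dom_chart c \<inter> \<Omega>" using S chart_cover_subset by auto
      have q: "continuous_on S (\<lambda>x. q c (coords c x) u u)" for u
        unfolding c(2) by (rule continuous_on_compose2[OF continuous_q[OF c(1)]])
          (auto intro: continuous_on_subset[OF continuous_coords[OF c(1)]])
      have d: "continuous_on S (\<lambda>x. (coord_vector A c x u f)\<^sup>2)" for u
        unfolding c(2) by (intro continuous_on_power continuous_on_coord_vector[OF c(1) \<Omega> f])
      have "(\<lambda>x. SUP u\<in>D. ennreal ((coord_vector A c x u f)\<^sup>2 / q c (coords c x) u u)) \<in> borel_measurable (restrict_space borel S)"
        by (intro borel_measurable_SUP D measurable_compose[OF _ measurable_ennreal] borel_measurable_divide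
            borel_measurable_continuous_on_restrict q d)
      moreover have "differential_norm2 A g f x * indicator \<Omega> x =
          (SUP u\<in>D. ennreal ((coord_vector A c x u f)\<^sup>2 / q c (coords c x) u u))" if "x \<in> S" for x
        using that c differential_norm2_dense[OF c(1) _ D(2), of x f] by auto
      ultimately show ?thesis
        by (subst measurable_cong) (auto simp: space_restrict_space)
    qed
  qed (auto intro: countable_finite)
qed

end

context two_metrics
begin

lemma differential_norm2_agree:
  assumes "x \<in> U"
  shows "differential_norm2 A g f x = differential_norm2 A g' f x"
proof -
  have "{X \<in> tangent_space A x. g x X X \<le> 1} = {X \<in> tangent_space A x. g' x X X \<le> 1}"
    using agree assms by (auto simp: metrics_agree_on_def)
  then show ?thesis by (simp add: differential_norm2_def)
qed

end

section \<open>Pointwise estimate of the cut functions and coercivity of quadratic forms\<close>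

text \<open>The weighted inequality keeps the coefficient of the main term as close to 1 as desired;
  plain doubling would lose a factor 2 in the eigenvalue.\<close>

lemma square_add_le:
  fixes x y t :: real
  assumes "0 < t"
  shows "(x + y)\<^sup>2 \<le> (1 + t) * x\<^sup>2 + (1 + 1 / t) * y\<^sup>2"
proof -
  have "0 \<le> (t * x - y)\<^sup>2 / t" using assms by simp
  also have "\<dots> = t * x\<^sup>2 - 2 * x * y + y\<^sup>2 / t"
    using assms by (simp add: power2_eq_square field_simps)
  finally show ?thesis by (simp add: power2_eq_square algebra_simps)
qed

context manifold
begin

text \<open>In the product rule two Cauchy-Schwarz estimates, for \<open>f\<close> and for
  \<open>X s\<close>, each release a factor \<open>s\<close>; together they turn the square of
  \<open>cutoff'\<close> into that of \<open>cutoff_err\<close>. The 4 comes from differentiating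
  the squares in \<open>s\<close>.\<close>

lemma tangent_cutoff_le:
  fixes k :: "'i \<Rightarrow> 'a \<Rightarrow> real" and a :: "'i \<Rightarrow> real"
  assumes X: "X \<in> tangent_space A x" and I: "\<And>i. i \<in> I \<Longrightarrow> smooth_at A (k i) x"
    and t: "0 < t"
  defines "s \<equiv> \<lambda>y. \<Sum>i\<in>I. (k i y)\<^sup>2" and "f \<equiv> \<lambda>y. \<Sum>i\<in>I. a i * k i y"
  shows "(X (\<lambda>y. cutoff m (s y) * f y))\<^sup>2 \<le> (1 + t) * (X f)\<^sup>2 +
    ((1 + 1 / t) * 4 * (\<Sum>i\<in>I. (a i)\<^sup>2) * (cutoff_err m (s x))\<^sup>2) * (\<Sum>i\<in>I. (X (k i))\<^sup>2)"
proof -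
  have sf: "smooth_at A f x" unfolding f_def by (intro smooth_at_sum smooth_at_mult smooth_at_const I)
  have ss: "smooth_at A s x" unfolding s_def power2_eq_square by (intro smooth_at_sum smooth_at_mult I)
  have Xs: "X s = 2 * (\<Sum>i\<in>I. k i x * X (k i))"
  proof -
    have "X s = (\<Sum>i\<in>I. X (\<lambda>y. k i y * k i y))"
      unfolding s_def power2_eq_square by (rule tangent_sum[OF X]) (intro smooth_at_mult I)
    also have "\<dots> = (\<Sum>i\<in>I. 2 * (k i x * X (k i)))"
      by (intro sum.cong refl) (simp add: tangent_mult[OF X I I])
    finally show ?thesis by (simp add: sum_distrib_left)
  qed
  have s0: "0 \<le> s x" by (simp add: s_def sum_nonneg)
  let ?\<alpha> = "\<Sum>i\<in>I. (a i)\<^sup>2" and ?\<beta> = "\<Sum>i\<in>I. (X (k i))\<^sup>2"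
  have "X (\<lambda>y. cutoff m (s y) * f y) = cutoff m (s x) * X f + f x * (cutoff' m (s x) * X s)"
    using tangent_mult[OF X smooth_at_cutoff[OF ss] sf] tangent_cutoff[OF X ss] by simp
  then have "(X (\<lambda>y. cutoff m (s y) * f y))\<^sup>2 \<le>
      (1 + t) * (cutoff m (s x) * X f)\<^sup>2 + (1 + 1 / t) * (f x * (cutoff' m (s x) * X s))\<^sup>2"
    using square_add_le[OF t] by metis
  also have "\<dots> \<le> (1 + t) * (X f)\<^sup>2 + (1 + 1 / t) * (4 * ?\<alpha> * (cutoff_err m (s x))\<^sup>2 * ?\<beta>)"
  proof (intro add_mono mult_left_mono)
    have "(cutoff m (s x))\<^sup>2 \<le> 1" using cutoff_nonneg[of m "s x"] cutoff_le_1[of m "s x"]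
      by (simp add: power_le_one)
    then show "(cutoff m (s x) * X f)\<^sup>2 \<le> (X f)\<^sup>2"
      by (simp add: power_mult_distrib mult_left_le_one_le)
    have f2: "(f x)\<^sup>2 \<le> ?\<alpha> * s x" unfolding f_def s_def by (rule Cauchy_Schwarz_ineq_sum)
    have Xs2: "(X s)\<^sup>2 \<le> 4 * (s x * ?\<beta>)"
    proof -
      have "(\<Sum>i\<in>I. k i x * X (k i))\<^sup>2 \<le> s x * ?\<beta>"
        unfolding s_def by (rule Cauchy_Schwarz_ineq_sum)
      then show ?thesis unfolding Xs by (simp add: power_mult_distrib)
    qed
    have "(f x * (cutoff' m (s x) * X s))\<^sup>2 = (cutoff' m (s x))\<^sup>2 * ((f x)\<^sup>2 * (X s)\<^sup>2)"
      by (simp add: power_mult_distrib)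
    also have "\<dots> \<le> (cutoff' m (s x))\<^sup>2 * ((?\<alpha> * s x) * (4 * (s x * ?\<beta>)))"
      by (intro mult_left_mono mult_mono f2 Xs2) (use s0 in \<open>auto simp: sum_nonneg\<close>)
    also have "\<dots> = 4 * ?\<alpha> * (cutoff_err m (s x))\<^sup>2 * ?\<beta>"
      by (simp add: cutoff_err_def power2_eq_square)
    finally show "(f x * (cutoff' m (s x) * X s))\<^sup>2 \<le> 4 * ?\<alpha> * (cutoff_err m (s x))\<^sup>2 * ?\<beta>" .
  qed (use t in auto)
  finally show ?thesis by (simp only: mult.assoc)
qed

end

text \<open>The form attains a positive minimum on the unit sphere of coefficients, and both sides
  are homogeneous of degree 2.\<close>

lemma positive_definite_lower_bound:
  fixes \<beta> :: "'b \<Rightarrow> 'b \<Rightarrow> real"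
  assumes B: "finite B"
    and pos: "\<And>a. \<exists>i\<in>B. a i \<noteq> 0 \<Longrightarrow> 0 < (\<Sum>i\<in>B. \<Sum>j\<in>B. a i * a j * \<beta> i j)"
  obtains c where "0 < c" "\<And>a. c * (\<Sum>i\<in>B. (a i)\<^sup>2) \<le> (\<Sum>i\<in>B. \<Sum>j\<in>B. a i * a j * \<beta> i j)"
proof (cases "B = {}")
  case True
  then show ?thesis using that[of 1] by simp
next
  case False
  let ?Q = "\<lambda>a. \<Sum>i\<in>B. \<Sum>j\<in>B. a i * a j * \<beta> i j"
  \<comment> \<open>Coefficients live in a full function space; pinning them to 0 off
    \<open>B\<close> and to \<open>{-1..1}\<close> on \<open>B\<close> makes the sphere compact in
    the product topology.\<close>
  define K where "K = {a :: 'b \<Rightarrow> real. (\<forall>i. a i \<in> (if i \<in> B then {-1..1} else {0}))} \<inter> {a. (\<Sum>i\<in>B. (a i)\<^sup>2) = 1}"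
  have "compact {a :: 'b \<Rightarrow> real. (\<forall>i. a i \<in> (if i \<in> B then {-1..1} else {0}))}"
  proof -
    have "compactin (product_topology (\<lambda>i. euclidean) UNIV) (PiE UNIV (\<lambda>i::'b. if i \<in> B then {-1..1::real} else {0}))"
      by (simp add: compactin_PiE)
    then show ?thesis
      by (simp add: euclidean_product_topology PiE_def Pi_def extensional_def)
  qed
  then have K: "compact K"
    unfolding K_def
    by (rule compact_Int_closed) (intro closed_Collect_eq continuous_intros continuous_on_product_coordinates)
  obtain i0 where i0: "i0 \<in> B" using False by blast
  have "(\<Sum>i\<in>B. (if i = i0 then 1 else 0 :: real)\<^sup>2) = 1"
    using B i0 by (simp add: if_distrib[of "\<lambda>t. t\<^sup>2"] cong: if_cong)
  then have "(\<lambda>i. if i = i0 then 1 else 0) \<in> K"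
    unfolding K_def using i0 by auto
  then have "K \<noteq> {}" by blast
  moreover have "continuous_on K (\<lambda>a. a i)" for i
    by (rule continuous_on_subset[OF continuous_on_product_coordinates]) simp
  then have "continuous_on K ?Q"
    by (intro continuous_on_sum continuous_on_mult continuous_on_const)
  ultimately have "\<exists>a0\<in>K. \<forall>a\<in>K. ?Q a0 \<le> ?Q a"
    by (intro continuous_attains_inf K)
  then obtain a0 where a0: "a0 \<in> K" "\<And>a. a \<in> K \<Longrightarrow> ?Q a0 \<le> ?Q a" by blast
  have "\<exists>i\<in>B. a0 i \<noteq> 0"
  proof (rule ccontr)
    assume "\<not> ?thesis"
    then have "(\<Sum>i\<in>B. (a0 i)\<^sup>2) = 0" by simp
    then show False using a0(1) by (simp add: K_def)
  qed
  then have "0 < ?Q a0" by (rule pos)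
  moreover have "?Q a0 * (\<Sum>i\<in>B. (a i)\<^sup>2) \<le> ?Q a" for a
  proof (cases "\<exists>i\<in>B. a i \<noteq> 0")
    case False
    then show ?thesis by simp
  next
    case True
    define r where "r = (\<Sum>i\<in>B. (a i)\<^sup>2)"
    have r: "0 < r" using True B unfolding r_def by (metis (no_types, lifting) sum_pos2 zero_le_power2 zero_less_power2)
    define b where "b i = (if i \<in> B then a i / sqrt r else 0)" for i
    have b2: "(\<Sum>i\<in>B. (b i)\<^sup>2) = 1"
      using r by (simp add: b_def power_divide r_def flip: sum_divide_distrib)
    have "\<bar>b i\<bar> \<le> 1" if "i \<in> B" for i
    proof -
      have "(b i)\<^sup>2 \<le> (\<Sum>i\<in>B. (b i)\<^sup>2)" using B that by (intro member_le_sum) auto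
      then show ?thesis using b2 by (simp add: abs_square_le_1)
    qed
    then have "\<forall>i. b i \<in> (if i \<in> B then {-1..1} else {0})"
      by (metis abs_le_iff atLeastAtMost_iff b_def minus_le_iff singletonI)
    then have "b \<in> K" using b2 by (simp add: K_def)
    then have "?Q a0 \<le> ?Q b" by (rule a0(2))
    also have "?Q b = ?Q a / r"
      using r by (simp add: b_def sum_divide_distrib flip: power2_eq_square)
    finally show ?thesis using r by (simp add: pos_le_divide_eq r_def)
  qed
  ultimately show ?thesis by (rule that)
qed

section \<open>Cutting off Dirichlet functions\<close>

context manifold
begin

text \<open>Near a boundary point where \<open>f\<close> does not vanish, the interior of a half-ball is connected and
  avoids the frontier of \<open>\<Omega>\<close>, so it lies in \<open>\<Omega>\<close>.\<close>

lemma zero_off_interior_closure: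
  assumes f: "continuous_on UNIV f" and \<Omega>: "open \<Omega>"
    and zero: "\<And>x. x \<in> closure \<Omega> \<Longrightarrow> x \<notin> \<Omega> \<Longrightarrow> x \<notin> manifold_boundary A \<Longrightarrow> f x = (0 :: real)"
    and x: "x \<in> closure \<Omega>" "x \<notin> interior (closure \<Omega>)"
  shows "f x = 0"
proof (rule ccontr)
  assume fx: "f x \<noteq> 0"
  define P where "P = f -` (- {0})"
  have P: "open P" unfolding P_def by (rule open_vimage[OF _ f]) auto
  obtain c where c: "c \<in> A" "x \<in> dom_chart c" by (rule chart_at)
  obtain W where W: "open W" "\<And>z. z \<in> W \<Longrightarrow> z \<in> half_space \<Longrightarrow> z \<in> image_chart c \<and> param c z \<in> P"
    "\<And>x. x \<in> dom_chart c \<Longrightarrow> x \<in> P \<Longrightarrow> coords c x \<in> W"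
    using coords_open_image[OF c(1) P] by blast
  have "coords c x \<in> W" using W(3) c fx by (simp add: P_def)
  then obtain r where r: "0 < r" "ball (coords c x) r \<subseteq> W" using W(1) open_contains_ball by blast
  define H where "H = ball (coords c x) r \<inter> {y. 0 < snd y}"
  have H: "H \<subseteq> half_space" by (auto simp: H_def half_space_def)
  have Hi: "H \<subseteq> image_chart c" "param c ` H \<subseteq> P" using W(2) r(2) H unfolding H_def by blast+
  have "convex {y :: 'h \<times> real. 0 < snd y}"
    using convex_halfspace_gt[of 0 "(0, 1) :: 'h \<times> real"] by (simp add: inner_prod_def)
  then have "connected H" unfolding H_def by (intro convex_connected convex_Int convex_ball)
  then have conn: "connected (param c ` H)"
    by (intro connected_continuous_image continuous_on_subset[OF continuous_param[OF c(1)] Hi(1)])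
  \<comment> \<open>Points of \<open>H\<close> are interior points of the manifold where
    \<open>f\<close> does not vanish, so the Dirichlet condition keeps them off the frontier of
    \<open>\<Omega>\<close>.\<close>
  have dich: "y \<in> \<Omega> \<or> y \<notin> closure \<Omega>" if y: "y \<in> param c ` H" for y
  proof -
    obtain z where z: "y = param c z" "z \<in> H" using y by blast
    have zi: "z \<in> image_chart c" using z Hi by blast
    have "0 < snd (coords c y)" using z zi c by (simp add: H_def)
    then have "y \<notin> manifold_boundary A"
      using manifold_boundary_iff[OF c(1), of y] param_dom[OF c(1) zi] z by simp
    moreover have "f y \<noteq> 0" using y Hi(2) by (auto simp: P_def)
    ultimately show ?thesis using zero by blast
  qed
  define N where "N = dom_chart c \<inter> coords c -` ball (coords c x) r"
  have N: "open N" unfolding N_def by (rule open_param_image[OF c(1) open_ball])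
  have xN: "x \<in> N" using c r by (simp add: N_def)
  \<comment> \<open>Moving a point of \<open>N\<close> slightly inward along the last coordinate
    lands in \<open>H\<close>. So an open set that meets \<open>N\<close> already meets the
    connected part off \<open>\<Sigma>\<close>.\<close>
  have meet: "G \<inter> param c ` H \<noteq> {}" if G: "open G" "G \<inter> N \<noteq> {}" for G
  proof -
    obtain y where y: "y \<in> G" "y \<in> N" using G(2) by blast
    have yd: "y \<in> dom_chart c" using y by (simp add: N_def)
    obtain V where V: "open V" "\<And>z. z \<in> V \<Longrightarrow> z \<in> half_space \<Longrightarrow> z \<in> image_chart c \<and> param c z \<in> G \<inter> N"
      "\<And>x. x \<in> dom_chart c \<Longrightarrow> x \<in> G \<inter> N \<Longrightarrow> coords c x \<in> V"
      using coords_open_image[OF c(1) open_Int[OF G(1) N]] by blast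
    have "coords c y \<in> V" using V(3)[OF yd] y by blast
    then obtain e where e: "0 < e" "ball (coords c y) e \<subseteq> V" using V(1) open_contains_ball by blast
    define z where "z = coords c y + (0, e / 2)"
    have "dist (coords c y) z < e"
      using e(1) by (simp add: z_def dist_norm norm_Pair)
    then have zV: "z \<in> V" using e(2) by auto
    have sz: "0 < snd z"
      using coords_half_space[OF c(1) yd] e(1) by (simp add: z_def half_space_def)
    have zi: "z \<in> image_chart c" "param c z \<in> G \<inter> N" using V(2)[OF zV] sz by (auto simp: half_space_def)
    then have "coords c (param c z) \<in> ball (coords c x) r" by (simp add: N_def)
    then have "z \<in> H" using zi sz c by (simp add: H_def)
    then show ?thesis using zi by blast
  qed
  have "\<Omega> \<inter> N \<noteq> {}" using x(1) xN N by (metis closure_iff_nhds_not_empty inf_commute open_contains_ball_eq subset_refl)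
  then have "\<Omega> \<inter> param c ` H \<noteq> {}" by (rule meet[OF \<Omega>])
  moreover have "\<Omega> \<inter> param c ` H = {} \<or> - closure \<Omega> \<inter> param c ` H = {}"
    using connectedD[OF conn \<Omega>, of "- closure \<Omega>"] dich closure_subset[of \<Omega>] by blast
  ultimately have "- closure \<Omega> \<inter> N = {}" using meet[of "- closure \<Omega>"] by (metis closed_closure open_Compl)
  then have "N \<subseteq> closure \<Omega>" by blast
  then show False using x(2) xN N interior_maximal by blast
qed

end

section \<open>A finite family of Dirichlet functions and its cut combinations\<close>

locale dirichlet_span = two_metrics A g g' U
  for A :: "('a::{t2_space, second_countable_topology}, 'h::euclidean_space) chart set" and g g' U +
  fixes B :: "('a \<Rightarrow> real) set" and ext :: "('a \<Rightarrow> real) \<Rightarrow> 'a \<Rightarrow> real"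
  assumes finite_B: "finite B"
    and ext_smooth: "b \<in> B \<Longrightarrow> ext b \<in> smooth_functions A"
    and ext_eq: "b \<in> B \<Longrightarrow> b x = (if x \<in> closure U then ext b x else 0)"
    and ext_zero: "b \<in> B \<Longrightarrow> x \<in> domain_boundary A U - manifold_boundary A \<Longrightarrow> ext b x = 0"
begin

abbreviation \<Sigma> :: "'a set" where "\<Sigma> \<equiv> manifold_boundary A"

definition s :: "'a \<Rightarrow> real" where "s x = (\<Sum>b\<in>B. (b x)\<^sup>2)"

definition comb :: "(('a \<Rightarrow> real) \<Rightarrow> real) \<Rightarrow> 'a \<Rightarrow> real" where
  "comb a x = (\<Sum>b\<in>B. a b * b x)"

definition cut :: "nat \<Rightarrow> (('a \<Rightarrow> real) \<Rightarrow> real) \<Rightarrow> 'a \<Rightarrow> real" where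
  "cut m a x = cutoff m (s x) * comb a x"

lemma s_nonneg: "0 \<le> s x"
  by (simp add: s_def sum_nonneg)

lemma comb_le: "(comb a x)\<^sup>2 \<le> (\<Sum>b\<in>B. (a b)\<^sup>2) * s x"
  unfolding comb_def s_def by (rule Cauchy_Schwarz_ineq_sum)

lemma continuous_ext: "b \<in> B \<Longrightarrow> continuous_on UNIV (ext b)"
  by (rule g.smooth_functions_continuous[OF ext_smooth])

lemma ext_zero_frontier: "b \<in> B \<Longrightarrow> x \<in> closure U \<Longrightarrow> x \<notin> U \<Longrightarrow> x \<notin> \<Sigma> \<Longrightarrow> ext b x = 0"
  by (rule ext_zero) (auto simp: domain_boundary_def)

text \<open>The interior of the closure is used instead of \<open>U\<close>: it may contain points
  of \<open>\<Sigma>\<close> outside \<open>U\<close> at which the functions do not vanish.\<close>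

lemma smooth_at_B:
  assumes "b \<in> B" "x \<in> interior (closure U)"
  shows "smooth_at A b x"
proof (rule g.smooth_at_cong_local[OF _ open_interior assms(2)])
  show "smooth_at A (ext b) x" using ext_smooth[OF assms(1)] by (simp add: smooth_functions_def)
  show "ext b z = b z" if "z \<in> interior (closure U)" for z
    using ext_eq[OF assms(1), of z] that interior_subset by auto
qed

lemma U_interior: "U \<subseteq> interior (closure U)"
  using U by (simp add: interior_maximal closure_subset)

text \<open>Off \<open>closure U\<close> the sum \<open>s\<close> is 0 on an open set. At the
  remaining points every \<open>ext b\<close> vanishes, by \<open>zero_off_interior_closure\<close>
  or by the Dirichlet condition, and \<open>s\<close> stays below the threshold of the cutoff
  nearby.\<close>

lemma cutoff_locally_zero:
  assumes x: "x \<notin> interior (closure U) \<or> (x \<notin> U \<and> x \<notin> \<Sigma>)"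
  obtains N where "open N" "x \<in> N" "\<And>y. y \<in> N \<Longrightarrow> cutoff m (s y) = 0"
proof (cases "x \<in> closure U")
  case False
  show ?thesis
  proof (rule that[of "- closure U"])
    show "cutoff m (s y) = 0" if "y \<in> - closure U" for y
    proof -
      have "s y = 0" unfolding s_def by (rule sum.neutral) (use ext_eq[of _ y] that in auto)
      then show ?thesis by (simp add: cutoff_eq_0)
    qed
  qed (use False in auto)
next
  case True
  have z: "ext b x = 0" if b: "b \<in> B" for b
    using x g.zero_off_interior_closure[OF continuous_ext[OF b] U _ True] ext_zero_frontier[OF b] True
    by blast
  \<comment> \<open>Continuity is taken from the functions \<open>ext b\<close>, whose squares
    dominate those of the truncated functions \<open>b\<close>.\<close>
  define N where "N = (\<lambda>y. (\<Sum>b\<in>B. (ext b y)\<^sup>2) * real m) -` {..<1}"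
  have "continuous_on UNIV (\<lambda>y. (\<Sum>b\<in>B. (ext b y)\<^sup>2) * real m)"
    by (intro continuous_on_mult continuous_on_sum continuous_on_power continuous_ext continuous_on_const)
  then have N: "open N" unfolding N_def by (intro open_vimage) auto
  show ?thesis
  proof (rule that[OF N])
    show "x \<in> N" by (simp add: N_def z)
    fix y assume y: "y \<in> N"
    have "s y \<le> (\<Sum>b\<in>B. (ext b y)\<^sup>2)"
      unfolding s_def by (rule sum_mono) (simp add: ext_eq[of _ y])
    then have "s y * real m \<le> (\<Sum>b\<in>B. (ext b y)\<^sup>2) * real m" by (rule mult_right_mono) simp
    then show "cutoff m (s y) = 0" using y by (intro cutoff_eq_0) (simp add: N_def)
  qed
qed

lemma smooth_at_comb: "x \<in> interior (closure U) \<Longrightarrow> smooth_at A (comb a) x"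
  unfolding comb_def[abs_def] by (intro smooth_at_sum smooth_at_mult smooth_at_const smooth_at_B)

lemma smooth_cut: "cut m a \<in> smooth_functions A"
  unfolding smooth_functions_def
proof (intro CollectI allI)
  fix x
  show "smooth_at A (cut m a) x"
  proof (cases "x \<in> interior (closure U)")
    case True
    then show ?thesis
      unfolding cut_def[abs_def] s_def comb_def power2_eq_square
      by (intro smooth_at_mult smooth_at_cutoff smooth_at_sum smooth_at_const smooth_at_B)
  next
    case False
    then obtain N where N: "open N" "x \<in> N" "\<And>y. y \<in> N \<Longrightarrow> cutoff m (s y) = 0"
      using cutoff_locally_zero by blast
    show ?thesis
      by (rule g.smooth_at_cong_local[OF smooth_at_const[of A 0] N(1,2)]) (simp add: cut_def N(3))
  qed
qed

lemma differential_norm2_cut_zero: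
  assumes "x \<notin> U" "x \<notin> \<Sigma>"
  shows "differential_norm2 A g' (cut m a) x = 0"
proof -
  obtain N where N: "open N" "x \<in> N" "\<And>y. y \<in> N \<Longrightarrow> cutoff m (s y) = 0"
    using cutoff_locally_zero assms by blast
  show ?thesis by (rule g'.differential_norm2_zero[OF N(1,2)]) (simp add: cut_def N(3))
qed

lemma differential_norm2_cut_le:
  assumes x: "x \<in> U" and t: "0 < t"
  shows "differential_norm2 A g (cut m a) x \<le> ennreal (1 + t) * differential_norm2 A g (comb a) x +
    ennreal ((1 + 1 / t) * 4 * (\<Sum>b\<in>B. (a b)\<^sup>2) * (cutoff_err m (s x))\<^sup>2) * (\<Sum>b\<in>B. differential_norm2 A g b x)"
proof (rule g.differential_norm2_le)
  show "(X (cut m a))\<^sup>2 \<le> (1 + t) * (X (comb a))\<^sup>2 +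
      (1 + 1 / t) * 4 * (\<Sum>b\<in>B. (a b)\<^sup>2) * (cutoff_err m (s x))\<^sup>2 * (\<Sum>b\<in>B. (X b)\<^sup>2)"
    if "X \<in> tangent_space A x" for X
    using g.tangent_cutoff_le[OF that, of B "\<lambda>b. b" t m a] smooth_at_B x U_interior t
    unfolding cut_def[abs_def] comb_def[abs_def] s_def by blast
qed (use t in \<open>auto simp: sum_nonneg\<close>)

text \<open>Up to constants in \<open>t\<close> and \<open>a\<close>, this bounds the squared L2
  norm of the term in which the cutoff is differentiated.\<close>

definition \<kappa> :: "nat \<Rightarrow> ennreal" where
  "\<kappa> m = (\<integral>\<^sup>+x. ennreal ((cutoff_err m (s x))\<^sup>2) * (\<Sum>b\<in>B. differential_norm2 A g b x * indicator U x) \<partial>riemannian_measure A g)"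

lemma measurable_B: "b \<in> B \<Longrightarrow> b \<in> borel_measurable borel"
proof -
  assume b: "b \<in> B"
  have "(\<lambda>x. if x \<in> closure U then ext b x else 0) \<in> borel_measurable borel"
    by (intro measurable_If_set borel_measurable_continuous_onI continuous_ext b) auto
  moreover have "b = (\<lambda>x. if x \<in> closure U then ext b x else 0)"
    by (intro HOL.ext ext_eq[OF b])
  ultimately show ?thesis by (rule ssubst[where P="\<lambda>f. f \<in> borel_measurable borel", rotated])
qed

lemma measurable_s: "s \<in> borel_measurable borel"
  unfolding s_def[abs_def] by (intro borel_measurable_sum borel_measurable_power measurable_B)

lemma measurable_norm2: "b \<in> B \<Longrightarrow> (\<lambda>x. differential_norm2 A g b x * indicator U x) \<in> borel_measurable borel"
  by (rule g.borel_measurable_differential_norm2[OF U]) (use smooth_at_B U_interior in blast)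

lemma measurable_cutoff_err: "(\<lambda>x. ennreal ((cutoff_err m (s x))\<^sup>2)) \<in> borel_measurable borel"
  by (intro measurable_compose[OF _ measurable_ennreal] borel_measurable_power
      measurable_compose[OF measurable_s] borel_measurable_continuous_onI continuous_on_cutoff_err continuous_on_id)

lemma measurable_cutoff: "(\<lambda>x. cutoff m (s x)) \<in> borel_measurable borel"
  by (intro measurable_compose[OF measurable_s] borel_measurable_continuous_onI continuous_on_cutoff continuous_on_id)

lemma borel_measurable_riemannian: "borel_measurable (riemannian_measure A g) = borel_measurable borel"
  by (rule measurable_cong_sets[OF g.sets_riemannian_measure refl])

lemma measurable_\<kappa>: "(\<lambda>x. ennreal ((cutoff_err m (s x))\<^sup>2) *
    (\<Sum>b\<in>B. differential_norm2 A g b x * indicator U x)) \<in> borel_measurable (riemannian_measure A g)"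
  unfolding borel_measurable_riemannian
  by (intro borel_measurable_times_ennreal measurable_cutoff_err borel_measurable_sum measurable_norm2)

lemma energy_cut_le:
  assumes t: "0 < t"
  shows "energy A g' UNIV (cut m a) \<le> ennreal (1 + t) * energy A g U (comb a) +
    ennreal ((1 + 1 / t) * 4 * (\<Sum>b\<in>B. (a b)\<^sup>2)) * \<kappa> m"
proof -
  let ?K = "(1 + 1 / t) * 4 * (\<Sum>b\<in>B. (a b)\<^sup>2)"
  have K: "0 \<le> ?K" using t by (intro mult_nonneg_nonneg sum_nonneg) auto
  have "energy A g' UNIV (cut m a) \<le> (\<integral>\<^sup>+x\<in>U. differential_norm2 A g' (cut m a) x \<partial>riemannian_measure A g')"
    unfolding energy_def
  proof (rule nn_integral_mono_AE)
    \<comment> \<open>Outside \<open>U\<close> the differential of the cut function vanishes off the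
      null set \<open>\<Sigma>\<close>, so the frontier of \<open>U\<close> contributes no energy,
      whatever its measure.\<close>
    have "AE x in riemannian_measure A g'. x \<notin> \<Sigma>" by (rule AE_not_in[OF g'.null_boundary])
    then show "AE x in riemannian_measure A g'. differential_norm2 A g' (cut m a) x * indicator UNIV x
      \<le> differential_norm2 A g' (cut m a) x * indicator U x"
      by eventually_elim (use differential_norm2_cut_zero in \<open>auto simp: indicator_def\<close>)
  qed
  also have "\<dots> = (\<integral>\<^sup>+x\<in>U. differential_norm2 A g' (cut m a) x \<partial>riemannian_measure A g)"
    by (rule nn_integral_riemannian_agree[symmetric]) (use U closure_subset in auto)
  also have "\<dots> \<le> (\<integral>\<^sup>+x. ennreal (1 + t) * (differential_norm2 A g (comb a) x * indicator U x) +
      ennreal ?K * (ennreal ((cutoff_err m (s x))\<^sup>2) * (\<Sum>b\<in>B. differential_norm2 A g b x * indicator U x))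
      \<partial>riemannian_measure A g)"
  proof (rule nn_integral_mono)
    fix x
    show "differential_norm2 A g' (cut m a) x * indicator U x \<le>
      ennreal (1 + t) * (differential_norm2 A g (comb a) x * indicator U x) +
      ennreal ?K * (ennreal ((cutoff_err m (s x))\<^sup>2) * (\<Sum>b\<in>B. differential_norm2 A g b x * indicator U x))"
    proof (cases "x \<in> U")
      case True
      then show ?thesis
        using differential_norm2_cut_le[OF True t, of m a] differential_norm2_agree[OF True, of "cut m a"]
          ennreal_mult'[OF K, of "(cutoff_err m (s x))\<^sup>2"]
        by (simp add: mult.assoc)
    qed simp
  qed
  also have "\<dots> = ennreal (1 + t) * energy A g U (comb a) + ennreal ?K * \<kappa> m"
  proof -
    have mc: "(\<lambda>x. differential_norm2 A g (comb a) x * indicator U x) \<in> borel_measurable (riemannian_measure A g)"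
      unfolding borel_measurable_riemannian
      by (rule g.borel_measurable_differential_norm2[OF U]) (use smooth_at_comb U_interior in blast)
    show ?thesis
      unfolding energy_def \<kappa>_def
      by (subst nn_integral_add) (intro borel_measurable_times_ennreal borel_measurable_const mc measurable_\<kappa>
          | simp only: nn_integral_cmult[OF mc] nn_integral_cmult[OF measurable_\<kappa>])+
  qed
  finally show ?thesis .
qed

text \<open>Dominated convergence: the squared factor is at most \<open>2^2 = 4\<close> and tends to
  0 pointwise, while the remaining density has as integral the sum of the finite energies of
  \<open>B\<close>.\<close>

lemma \<kappa>_tendsto_0:
  assumes fin: "\<And>b. b \<in> B \<Longrightarrow> energy A g U b < \<infinity>"
  shows "\<kappa> \<longlonglongrightarrow> 0"
proof -
  let ?M = "riemannian_measure A g"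
  define h where "h x = (\<Sum>b\<in>B. differential_norm2 A g b x * indicator U x)" for x
  have mh: "h \<in> borel_measurable ?M"
    unfolding h_def[abs_def] borel_measurable_riemannian by (intro borel_measurable_sum measurable_norm2)
  have me: "(\<lambda>x. ennreal ((cutoff_err m (s x))\<^sup>2)) \<in> borel_measurable ?M" for m
    unfolding borel_measurable_riemannian by (rule measurable_cutoff_err)
  have "(\<integral>\<^sup>+x. h x \<partial>?M) = (\<Sum>b\<in>B. energy A g U b)"
    unfolding h_def energy_def by (rule nn_integral_sum) (simp only: borel_measurable_riemannian measurable_norm2)
  then have hfin: "(\<integral>\<^sup>+x. h x \<partial>?M) < \<infinity>" using fin finite_B by simp
  have "(\<lambda>m. \<integral>\<^sup>+x. ennreal ((cutoff_err m (s x))\<^sup>2) * h x \<partial>?M) \<longlonglongrightarrow> (\<integral>\<^sup>+x. 0 \<partial>?M)"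
  proof (rule nn_integral_dominated_convergence[where w="\<lambda>x. 4 * h x"])
    show "(\<lambda>x. ennreal ((cutoff_err m (s x))\<^sup>2) * h x) \<in> borel_measurable ?M" for m
      by (intro borel_measurable_times_ennreal me mh)
    show "(\<lambda>x. 4 * h x) \<in> borel_measurable ?M" by (intro borel_measurable_times_ennreal mh) simp
    show "AE x in ?M. ennreal ((cutoff_err m (s x))\<^sup>2) * h x \<le> 4 * h x" for m
    proof (intro AE_I2 mult_right_mono)
      fix x
      have "(cutoff_err m (s x))\<^sup>2 \<le> 2\<^sup>2"
        by (intro power_mono cutoff_err_le cutoff_err_nonneg)
      then have "ennreal ((cutoff_err m (s x))\<^sup>2) \<le> ennreal 4" by (intro ennreal_leI) simp
      then show "ennreal ((cutoff_err m (s x))\<^sup>2) \<le> 4" by simp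
    qed simp
    show "(\<integral>\<^sup>+x. 4 * h x \<partial>?M) < \<infinity>"
      using hfin by (subst nn_integral_cmult[OF mh]) (simp add: ennreal_mult_less_top)
    \<comment> \<open>Where the density were infinite, small positive factors would leave the
      product infinite; finiteness almost everywhere excludes this.\<close>
    have "AE x in ?M. h x \<noteq> \<infinity>"
      using hfin by (intro nn_integral_PInf_AE mh) auto
    then show "AE x in ?M. (\<lambda>m. ennreal ((cutoff_err m (s x))\<^sup>2) * h x) \<longlonglongrightarrow> 0"
    proof eventually_elim
      case (elim x)
      then obtain k where k: "h x = ennreal k" "0 \<le> k" by (cases "h x") auto
      have "(\<lambda>m. ennreal ((cutoff_err m (s x))\<^sup>2 * k)) \<longlonglongrightarrow> ennreal (0\<^sup>2 * k)"
        by (intro tendsto_ennrealI tendsto_mult tendsto_power cutoff_err_tendsto_0 s_nonneg tendsto_const)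
      then show ?case using k by (simp add: ennreal_mult)
    qed
  qed simp
  then show ?thesis by (simp add: \<kappa>_def[abs_def] h_def)
qed

section \<open>Boundary norms of the combinations and of their cut versions\<close>

definition D :: "'a set" where "D = closure U \<inter> \<Sigma>"

lemma D_eq: "domain_boundary A U \<inter> \<Sigma> = D"
  by (auto simp: D_def domain_boundary_def)

lemma borel_D: "D \<in> sets borel"
  unfolding D_def using g.closed_manifold_boundary by (simp add: borel_closed)

text \<open>An algebra containing all boundary integrands below; each member is integrable because
  the boundary measure is finite.\<close>

definition bounded_measurable :: "('a \<Rightarrow> real) \<Rightarrow> bool" where
  "bounded_measurable f \<longleftrightarrow> f \<in> borel_measurable borel \<and> (\<exists>C. \<forall>x. \<bar>f x\<bar> \<le> C)"

lemma bounded_measurable_mult: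
  assumes "bounded_measurable f" "bounded_measurable h"
  shows "bounded_measurable (\<lambda>x. f x * h x)"
proof -
  obtain C E where C: "\<And>x. \<bar>f x\<bar> \<le> C" and E: "\<And>x. \<bar>h x\<bar> \<le> E"
    using assms by (auto simp: bounded_measurable_def)
  have "\<bar>f x * h x\<bar> \<le> C * E" for x
    unfolding abs_mult by (intro mult_mono C E) (use C[of x] in auto)
  then show ?thesis using assms by (auto simp: bounded_measurable_def)
qed

lemma bounded_measurable_add:
  assumes "bounded_measurable f" "bounded_measurable h"
  shows "bounded_measurable (\<lambda>x. f x + h x)"
proof -
  obtain C E where C: "\<And>x. \<bar>f x\<bar> \<le> C" and E: "\<And>x. \<bar>h x\<bar> \<le> E"
    using assms by (auto simp: bounded_measurable_def)
  have "\<bar>f x + h x\<bar> \<le> C + E" for x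
    using C[of x] E[of x] by linarith
  then show ?thesis using assms by (auto simp: bounded_measurable_def)
qed

lemma bounded_measurable_const: "bounded_measurable (\<lambda>x. k)"
  by (auto simp: bounded_measurable_def)

lemma bounded_measurable_sum:
  "(\<And>i. i \<in> I \<Longrightarrow> bounded_measurable (f i)) \<Longrightarrow> bounded_measurable (\<lambda>x. \<Sum>i\<in>I. f i x)"
  by (induction I rule: infinite_finite_induct) (auto intro: bounded_measurable_add bounded_measurable_const)

lemma bounded_measurable_B: "bounded_measurable b" if b: "b \<in> B"
proof -
  have "compact (ext b ` UNIV)"
    by (rule compact_continuous_image[OF continuous_ext[OF b] g.compact])
  then obtain C where C: "\<And>x. \<bar>ext b x\<bar> \<le> C"
    using compact_imp_bounded bounded_iff by (metis UNIV_I image_eqI real_norm_def)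
  have "\<bar>b x\<bar> \<le> C" for x
    unfolding ext_eq[OF b, of x] using C[of x] order_trans[OF abs_ge_zero C[of x]] by simp
  then show ?thesis using measurable_B[OF b] by (auto simp: bounded_measurable_def)
qed

lemma bounded_measurable_comb: "bounded_measurable (comb a)"
  unfolding comb_def[abs_def]
  by (intro bounded_measurable_sum bounded_measurable_mult bounded_measurable_const bounded_measurable_B)

lemma bounded_measurable_s: "bounded_measurable s"
  unfolding s_def[abs_def] power2_eq_square
  by (intro bounded_measurable_sum bounded_measurable_mult bounded_measurable_B)

lemma bounded_measurable_cutoff: "bounded_measurable (\<lambda>x. cutoff m (s x))"
  unfolding bounded_measurable_def
proof (intro conjI measurable_cutoff exI allI)
  show "\<bar>cutoff m (s x)\<bar> \<le> 1" for x
    using cutoff_nonneg[of m "s x"] cutoff_le_1[of m "s x"] by simp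
qed

abbreviation \<sigma> :: "'a measure" where "\<sigma> \<equiv> boundary_measure A g"

lemma integrable_D: "bounded_measurable f \<Longrightarrow> integrable \<sigma> (\<lambda>x. indicator D x * f x)"
proof -
  assume f: "bounded_measurable f"
  interpret finite_measure \<sigma>
    by (rule finite_measureI) (use g.finite_boundary_measure in auto)
  obtain C where C: "\<And>x. \<bar>f x\<bar> \<le> C" using f by (auto simp: bounded_measurable_def)
  show ?thesis
  proof (rule integrable_const_bound[where B="C"])
    show "AE x in \<sigma>. norm (indicator D x * f x) \<le> C"
    proof (rule AE_I2)
      fix x
      have "0 \<le> C" using C[of x] by linarith
      then show "norm (indicator D x * f x) \<le> C" using C[of x] by (simp add: indicator_def)
    qed
    show "(\<lambda>x. indicator D x * f x) \<in> borel_measurable \<sigma>"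
      using f borel_D by (intro borel_measurable_times borel_measurable_indicator) (auto simp: bounded_measurable_def)
  qed
qed

definition Q :: "(('a \<Rightarrow> real) \<Rightarrow> real) \<Rightarrow> real" where
  "Q a = (\<integral>x. indicator D x * (comb a x)\<^sup>2 \<partial>\<sigma>)"

definition Q_cut :: "nat \<Rightarrow> (('a \<Rightarrow> real) \<Rightarrow> real) \<Rightarrow> real" where
  "Q_cut m a = (\<integral>x. indicator D x * (cut m a x)\<^sup>2 \<partial>\<sigma>)"

text \<open>By Cauchy-Schwarz, \<open>\<beta> m\<close> bounds the squared boundary norm lost in
  cutting a combination with coefficient vector of unit length.\<close>

definition \<beta> :: "nat \<Rightarrow> real" where
  "\<beta> m = (\<integral>x. indicator D x * ((1 - (cutoff m (s x))\<^sup>2) * s x) \<partial>\<sigma>)"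

lemma bounded_measurable_comb2: "bounded_measurable (\<lambda>x. (comb a x)\<^sup>2)"
  unfolding power2_eq_square by (intro bounded_measurable_mult bounded_measurable_comb)

lemma bounded_measurable_cut2: "bounded_measurable (\<lambda>x. (cut m a x)\<^sup>2)"
  unfolding power2_eq_square cut_def
  by (intro bounded_measurable_mult bounded_measurable_comb bounded_measurable_cutoff)

lemma nn_integral_D: "bounded_measurable f \<Longrightarrow> (\<And>x. 0 \<le> f x) \<Longrightarrow>
    (\<integral>\<^sup>+x\<in>D. ennreal (f x) \<partial>\<sigma>) = ennreal (\<integral>x. indicator D x * f x \<partial>\<sigma>)"
  by (subst nn_integral_eq_integral[symmetric, OF integrable_D])
     (auto simp: indicator_def intro!: nn_integral_cong)

lemma boundary_norm2_comb: "boundary_norm2 A g (domain_boundary A U \<inter> \<Sigma>) (comb a) = ennreal (Q a)"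
  unfolding boundary_norm2_def D_eq Q_def by (rule nn_integral_D[OF bounded_measurable_comb2]) simp

text \<open>The cut function vanishes off \<open>closure U\<close>, so the norm for
  \<open>g'\<close> over all of \<open>\<Sigma>\<close> is an integral over \<open>D\<close>, where
  the two boundary measures coincide.\<close>

lemma boundary_norm2_cut: "boundary_norm2 A g' \<Sigma> (cut m a) = ennreal (Q_cut m a)"
proof -
  have z: "cut m a x = 0" if "x \<notin> closure U" for x
  proof -
    have "s x = 0" unfolding s_def by (rule sum.neutral) (use ext_eq[of _ x] that in auto)
    then show ?thesis by (simp add: cut_def cutoff_eq_0)
  qed
  have "boundary_norm2 A g' \<Sigma> (cut m a) = (\<integral>\<^sup>+x\<in>D. ennreal ((cut m a x)\<^sup>2) \<partial>boundary_measure A g')"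
    unfolding boundary_norm2_def by (rule nn_integral_cong) (use z in \<open>auto simp: D_def indicator_def\<close>)
  also have "\<dots> = (\<integral>\<^sup>+x\<in>D. ennreal ((cut m a x)\<^sup>2) \<partial>\<sigma>)"
    by (rule nn_integral_boundary_agree[OF borel_D, symmetric]) (simp add: D_def)
  also have "\<dots> = ennreal (Q_cut m a)"
    unfolding Q_cut_def by (rule nn_integral_D[OF bounded_measurable_cut2]) simp
  finally show ?thesis .
qed

lemma bounded_measurable_\<beta>: "bounded_measurable (\<lambda>x. (1 - (cutoff m (s x))\<^sup>2) * s x)"
proof -
  have "bounded_measurable (\<lambda>x. (1 + (- 1) * (cutoff m (s x) * cutoff m (s x))) * s x)"
    by (intro bounded_measurable_mult bounded_measurable_add bounded_measurable_const bounded_measurable_cutoff bounded_measurable_s)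
  then show ?thesis by (simp add: power2_eq_square)
qed

lemma Q_le: "Q a \<le> Q_cut m a + (\<Sum>b\<in>B. (a b)\<^sup>2) * \<beta> m"
proof -
  have "Q a - Q_cut m a = (\<integral>x. indicator D x * (comb a x)\<^sup>2 - indicator D x * (cut m a x)\<^sup>2 \<partial>\<sigma>)"
    unfolding Q_def Q_cut_def
    by (rule Bochner_Integration.integral_diff[symmetric])
       (intro integrable_D bounded_measurable_comb2 bounded_measurable_cut2)+
  also have "\<dots> \<le> (\<integral>x. (\<Sum>b\<in>B. (a b)\<^sup>2) * (indicator D x * ((1 - (cutoff m (s x))\<^sup>2) * s x)) \<partial>\<sigma>)"
  proof (rule integral_mono)
    show "integrable \<sigma> (\<lambda>x. indicator D x * (comb a x)\<^sup>2 - indicator D x * (cut m a x)\<^sup>2)"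
      by (intro Bochner_Integration.integrable_diff integrable_D bounded_measurable_comb2 bounded_measurable_cut2)
    show "integrable \<sigma> (\<lambda>x. (\<Sum>b\<in>B. (a b)\<^sup>2) * (indicator D x * ((1 - (cutoff m (s x))\<^sup>2) * s x)))"
      by (intro integrable_mult_right integrable_D bounded_measurable_\<beta>)
    fix x
    have "(cutoff m (s x))\<^sup>2 \<le> 1" using cutoff_nonneg[of m "s x"] cutoff_le_1[of m "s x"]
      by (simp add: power_le_one)
    then have "(1 - (cutoff m (s x))\<^sup>2) * (comb a x)\<^sup>2 \<le> (1 - (cutoff m (s x))\<^sup>2) * ((\<Sum>b\<in>B. (a b)\<^sup>2) * s x)"
      by (intro mult_left_mono comb_le) simp
    then show "indicator D x * (comb a x)\<^sup>2 - indicator D x * (cut m a x)\<^sup>2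
      \<le> (\<Sum>b\<in>B. (a b)\<^sup>2) * (indicator D x * ((1 - (cutoff m (s x))\<^sup>2) * s x))"
      by (cases "x \<in> D") (simp_all add: cut_def power_mult_distrib algebra_simps)
  qed
  also have "\<dots> = (\<Sum>b\<in>B. (a b)\<^sup>2) * \<beta> m" unfolding \<beta>_def by (rule integral_mult_right_zero)
  finally show ?thesis by simp
qed

text \<open>The factor \<open>s\<close> kills the integrand where the cutoff stays 0, and elsewhere
  the cutoff tends to 1; the bounded function \<open>s\<close> dominates.\<close>

lemma \<beta>_tendsto_0: "\<beta> \<longlonglongrightarrow> 0"
proof -
  have "(\<lambda>m. \<integral>x. indicator D x * ((1 - (cutoff m (s x))\<^sup>2) * s x) \<partial>\<sigma>) \<longlonglongrightarrow> (\<integral>x. 0 \<partial>\<sigma>)"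
  proof (rule integral_dominated_convergence[where w="\<lambda>x. indicator D x * s x"])
    show "(\<lambda>x. indicator D x * ((1 - (cutoff m (s x))\<^sup>2) * s x)) \<in> borel_measurable \<sigma>" for m
      by (rule borel_measurable_integrable[OF integrable_D[OF bounded_measurable_\<beta>]])
    show "integrable \<sigma> (\<lambda>x. indicator D x * s x)" by (rule integrable_D[OF bounded_measurable_s])
    show "AE x in \<sigma>. (\<lambda>m. indicator D x * ((1 - (cutoff m (s x))\<^sup>2) * s x)) \<longlonglongrightarrow> 0"
    proof (rule AE_I2)
      fix x
      have "(\<lambda>m. (1 - (cutoff m (s x))\<^sup>2) * s x) \<longlonglongrightarrow> 0"
      proof (cases "s x = 0")
        case False
        then have "0 < s x" using s_nonneg[of x] by simp
        then have "(\<lambda>m. (1 - (cutoff m (s x))\<^sup>2) * s x) \<longlonglongrightarrow> (1 - 1\<^sup>2) * s x"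
          by (intro tendsto_mult tendsto_diff tendsto_power cutoff_tendsto_1 tendsto_const)
        then show ?thesis by simp
      qed simp
      then show "(\<lambda>m. indicator D x * ((1 - (cutoff m (s x))\<^sup>2) * s x)) \<longlonglongrightarrow> 0"
        by (rule tendsto_mult_right_zero)
    qed
    show "AE x in \<sigma>. norm (indicator D x * ((1 - (cutoff m (s x))\<^sup>2) * s x)) \<le> indicator D x * s x" for m
    proof (rule AE_I2)
      fix x
      have "0 \<le> 1 - (cutoff m (s x))\<^sup>2" "1 - (cutoff m (s x))\<^sup>2 \<le> 1"
        using cutoff_nonneg[of m "s x"] cutoff_le_1[of m "s x"] by (simp_all add: power_le_one)
      then show "norm (indicator D x * ((1 - (cutoff m (s x))\<^sup>2) * s x)) \<le> indicator D x * s x"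
        using s_nonneg[of x] by (auto simp: indicator_def abs_mult mult_left_le_one_le)
    qed
  qed simp
  then show ?thesis by (simp add: \<beta>_def[abs_def])
qed

lemma Q_expand: "Q a = (\<Sum>b\<in>B. \<Sum>b'\<in>B. a b * a b' * (\<integral>x. indicator D x * (b x * b' x) \<partial>\<sigma>))"
proof -
  have "Q a = (\<integral>x. (\<Sum>b\<in>B. \<Sum>b'\<in>B. (a b * a b') * (indicator D x * (b x * b' x))) \<partial>\<sigma>)"
    unfolding Q_def comb_def power2_eq_square sum_product
    by (simp add: sum_distrib_left mult.assoc mult.left_commute)
  also have "\<dots> = (\<Sum>b\<in>B. \<Sum>b'\<in>B. (a b * a b') * (\<integral>x. indicator D x * (b x * b' x) \<partial>\<sigma>))"
  proof -
    have i: "integrable \<sigma> (\<lambda>x. (a b * a b') * (indicator D x * (b x * b' x)))" if "b \<in> B" "b' \<in> B" for b b'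
      using that by (intro integrable_mult_right integrable_D bounded_measurable_mult bounded_measurable_B)
    show ?thesis
      by (simp only: Bochner_Integration.integral_sum Bochner_Integration.integrable_sum i
          integral_mult_right_zero cong: sum.cong)
  qed
  finally show ?thesis .
qed

text \<open>A finite bound on the quotients makes \<open>Q\<close> positive definite, and
  compactness gives \<open>Q a\<close> at least \<open>c\<close> times the squared length of
  \<open>a\<close>. Errors per squared coefficient length become errors relative to
  \<open>Q a\<close>, so \<open>m\<close> can be fixed before \<open>a\<close>.\<close>

lemma cutoff_rayleigh:
  fixes \<Lambda> \<tau> :: real
  assumes \<Lambda>: "0 \<le> \<Lambda>" and \<tau>: "0 < \<tau>"
    and le: "\<And>a. \<exists>b\<in>B. a b \<noteq> 0 \<Longrightarrow>
      rayleigh (energy A g U (comb a)) (boundary_norm2 A g (domain_boundary A U \<inter> \<Sigma>) (comb a)) \<le> ennreal \<Lambda>"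
  obtains m where "\<And>a. \<exists>b\<in>B. a b \<noteq> 0 \<Longrightarrow> cut m a \<noteq> 0 \<and>
      rayleigh (energy A g' UNIV (cut m a)) (boundary_norm2 A g' \<Sigma> (cut m a)) \<le> ennreal (\<Lambda> + \<tau>)"
proof -
  have Q: "0 < Q a" "energy A g U (comb a) \<le> ennreal (\<Lambda> * Q a)" if a: "\<exists>b\<in>B. a b \<noteq> 0" for a
  proof -
    have r: "rayleigh (energy A g U (comb a)) (ennreal (Q a)) \<le> ennreal \<Lambda>"
      using le[OF a] by (simp add: boundary_norm2_comb)
    \<comment> \<open>A zero denominator makes \<open>rayleigh\<close> infinite by definition,
      against the finite bound.\<close>
    have "ennreal (Q a) \<noteq> 0"
    proof
      assume "ennreal (Q a) = 0"
      then show False using r by (simp add: rayleigh_def top_unique)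
    qed
    then show pos: "0 < Q a" by (simp add: ennreal_eq_0_iff)
    have "energy A g U (comb a) / ennreal (Q a) \<le> ennreal \<Lambda>"
      using r pos by (simp add: rayleigh_def)
    then have "energy A g U (comb a) / ennreal (Q a) * ennreal (Q a) \<le> ennreal \<Lambda> * ennreal (Q a)"
      by (rule mult_right_mono) simp
    also have "energy A g U (comb a) / ennreal (Q a) * ennreal (Q a) = energy A g U (comb a)"
      using pos by (simp add: ennreal_divide_times ennreal_divide_self)
    also have "ennreal \<Lambda> * ennreal (Q a) = ennreal (\<Lambda> * Q a)"
      using \<Lambda> pos by (simp add: ennreal_mult)
    finally show "energy A g U (comb a) \<le> ennreal (\<Lambda> * Q a)" .
  qed
  obtain c where c: "0 < c" "\<And>a. c * (\<Sum>b\<in>B. (a b)\<^sup>2) \<le> Q a"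
  proof (rule positive_definite_lower_bound[OF finite_B])
    show "0 < (\<Sum>b\<in>B. \<Sum>b'\<in>B. a b * a b' * (\<integral>x. indicator D x * (b x * b' x) \<partial>\<sigma>))"
      if "\<exists>b\<in>B. a b \<noteq> 0" for a
      using Q(1)[OF that] by (simp add: Q_expand)
  qed (use that Q_expand in auto)
  \<comment> \<open>Each basis function is itself a combination, with a single unit coefficient, so
    its energy inherits the bound.\<close>
  have fin: "energy A g U b < \<infinity>" if b: "b \<in> B" for b
  proof -
    define a where "a b' = (if b' = b then 1 else 0 :: real)" for b'
    have "comb a = b"
      using finite_B b by (simp add: comb_def[abs_def] a_def if_distrib[of "\<lambda>t. t * _"] cong: if_cong)
    moreover have "\<exists>b\<in>B. a b \<noteq> 0" using b by (auto simp: a_def)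
    ultimately show ?thesis using Q(2)[of a] by (metis ennreal_less_top infinity_ennreal_def le_less_trans)
  qed
  \<comment> \<open>The allowance \<open>\<tau>\<close> is spent as \<open>\<tau> / 2\<close> on the
    factor \<open>1 + t\<close>, \<open>\<tau> / 4\<close> on the gradient error and
    \<open>\<tau> / 4\<close> on the boundary loss. The summand 1 covers
    \<open>\<Lambda> = 0\<close>.\<close>
  define t where "t = \<tau> / (2 * (\<Lambda> + 1))"
  have t: "0 < t" using \<tau> \<Lambda> by (simp add: t_def)
  have t\<Lambda>: "(1 + t) * \<Lambda> \<le> \<Lambda> + \<tau> / 2"
  proof -
    have "t * \<Lambda> \<le> t * (\<Lambda> + 1)" using t by simp
    also have "\<dots> = \<tau> / 2" using \<Lambda> by (simp add: t_def field_simps)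
    finally show ?thesis by (simp add: algebra_simps)
  qed
  define K where "K = (1 + 1 / t) * 4"
  have K: "0 < K" using t by (simp add: K_def add_pos_pos)
  \<comment> \<open>The factor \<open>c\<close> compensates for measuring errors by the squared
    length of \<open>a\<close>: since \<open>c * ?\<alpha> \<le> Q a\<close>, the gradient error is
    at most \<open>Q a * (\<tau> / 4)\<close>. The threshold \<open>\<eta>'\<close> plays the same
    role for the boundary loss.\<close>
  define \<eta> where "\<eta> = c * \<tau> / (4 * K)"
  have \<eta>: "0 < \<eta>" "K * \<eta> = c * (\<tau> / 4)" using c \<tau> K by (simp_all add: \<eta>_def)
  define \<eta>' where "\<eta>' = c * \<tau> / (4 * (\<Lambda> + \<tau>))"
  have \<eta>': "0 < \<eta>'" "(\<Lambda> + \<tau>) * \<eta>' = c * (\<tau> / 4)" using c \<tau> \<Lambda> by (simp_all add: \<eta>'_def field_simps)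
  have "\<forall>\<^sub>F m in sequentially. \<kappa> m < ennreal \<eta>"
    using \<eta> by (intro order_tendstoD(2)[OF \<kappa>_tendsto_0[OF fin]]) simp_all
  moreover have "\<forall>\<^sub>F m in sequentially. \<beta> m < \<eta>'"
    using \<eta>' by (intro order_tendstoD(2)[OF \<beta>_tendsto_0])
  ultimately have "\<forall>\<^sub>F m in sequentially. \<kappa> m < ennreal \<eta> \<and> \<beta> m < \<eta>'" by (rule eventually_conj)
  then obtain m where m: "\<kappa> m < ennreal \<eta>" "\<beta> m < \<eta>'"
    using eventually_happens by fastforce
  show ?thesis
  proof (rule that[of m])
    fix a :: "('a \<Rightarrow> real) \<Rightarrow> real"
    assume a: "\<exists>b\<in>B. a b \<noteq> 0"
    let ?\<alpha> = "\<Sum>b\<in>B. (a b)\<^sup>2"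
    have \<alpha>: "0 \<le> ?\<alpha>" by (simp add: sum_nonneg)
    have "?\<alpha> * \<beta> m \<le> ?\<alpha> * \<eta>'" using m(2) \<alpha> by (intro mult_left_mono) auto
    then have "(\<Lambda> + \<tau>) * (Q a - Q_cut m a) \<le> (\<Lambda> + \<tau>) * (?\<alpha> * \<eta>')"
      using Q_le[of a m] \<Lambda> \<tau> by (intro mult_left_mono) auto
    also have "\<dots> = (c * ?\<alpha>) * (\<tau> / 4)" using arg_cong[OF \<eta>'(2), of "\<lambda>z. z * ?\<alpha>"] by (simp only: mult.assoc mult.commute mult.left_commute)
    also have "\<dots> \<le> Q a * (\<tau> / 4)" using c(2)[of a] \<tau> by (intro mult_right_mono) auto
    finally have b1: "(\<Lambda> + 3 / 4 * \<tau>) * Q a \<le> (\<Lambda> + \<tau>) * Q_cut m a"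
      by (simp add: algebra_simps)
    have "0 < (\<Lambda> + 3 / 4 * \<tau>) * Q a" using Q(1)[OF a] \<Lambda> \<tau> by simp
    then have "0 < (\<Lambda> + \<tau>) * Q_cut m a" using b1 by linarith
    then have Qc: "0 < Q_cut m a" using \<Lambda> \<tau> by (simp add: zero_less_mult_iff)
    have "energy A g' UNIV (cut m a) \<le> ennreal (1 + t) * energy A g U (comb a) + ennreal (K * ?\<alpha>) * \<kappa> m"
      using energy_cut_le[OF t, of m a] by (simp add: K_def)
    also have "\<dots> \<le> ennreal (1 + t) * ennreal (\<Lambda> * Q a) + ennreal (K * ?\<alpha>) * ennreal \<eta>"
      by (intro add_mono mult_left_mono Q(2)[OF a] less_imp_le[OF m(1)]) auto
    also have "\<dots> = ennreal ((1 + t) * (\<Lambda> * Q a) + (K * ?\<alpha>) * \<eta>)"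
      using t \<Lambda> Q(1)[OF a] K \<alpha> \<eta>(1) by (simp add: ennreal_mult ennreal_plus)
    also have "\<dots> \<le> ennreal ((\<Lambda> + \<tau>) * Q_cut m a)"
    proof (rule ennreal_leI)
      have "(1 + t) * (\<Lambda> * Q a) \<le> (\<Lambda> + \<tau> / 2) * Q a"
        using mult_right_mono[OF t\<Lambda>, of "Q a"] Q(1)[OF a] by (simp add: mult.assoc)
      moreover have "(K * ?\<alpha>) * \<eta> \<le> Q a * (\<tau> / 4)"
      proof -
        have "(K * ?\<alpha>) * \<eta> = (c * ?\<alpha>) * (\<tau> / 4)"
          using arg_cong[OF \<eta>(2), of "\<lambda>z. z * ?\<alpha>"] by (simp only: mult.assoc mult.commute mult.left_commute)
        also have "\<dots> \<le> Q a * (\<tau> / 4)" using c(2)[of a] \<tau> by (intro mult_right_mono) auto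
        finally show ?thesis .
      qed
      ultimately show "(1 + t) * (\<Lambda> * Q a) + (K * ?\<alpha>) * \<eta> \<le> (\<Lambda> + \<tau>) * Q_cut m a"
        using b1 by (simp add: algebra_simps)
    qed
    also have "\<dots> = ennreal (\<Lambda> + \<tau>) * ennreal (Q_cut m a)"
      using \<Lambda> \<tau> Qc by (simp add: ennreal_mult)
    finally have "energy A g' UNIV (cut m a) / ennreal (Q_cut m a) \<le> ennreal (\<Lambda> + \<tau>)"
      using Qc by (intro divide_le_posI_ennreal) (simp_all add: mult.commute)
    then have "rayleigh (energy A g' UNIV (cut m a)) (boundary_norm2 A g' \<Sigma> (cut m a)) \<le> ennreal (\<Lambda> + \<tau>)"
      using Qc by (simp add: rayleigh_def boundary_norm2_cut)
    moreover have "cut m a \<noteq> 0"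
    proof
      assume "cut m a = 0"
      then show False using Qc by (simp add: Q_cut_def)
    qed
    ultimately show "cut m a \<noteq> 0 \<and>
      rayleigh (energy A g' UNIV (cut m a)) (boundary_norm2 A g' \<Sigma> (cut m a)) \<le> ennreal (\<Lambda> + \<tau>)" by blast
  qed
qed

end

section \<open>From combinations to competing linear spaces\<close>

lemma sum_fun_apply: "(\<Sum>i\<in>I. f i) x = (\<Sum>i\<in>I. f i x)"
  by (induction I rule: infinite_finite_induct) (auto simp: zero_fun_def plus_fun_def)

lemma span_fun_space:
  assumes "finite B"
  shows "fun_space.span B = range (\<lambda>a x. \<Sum>b\<in>B. a b * b x)"
  unfolding fun_space.span_finite[OF assms]
  by (intro image_cong refl) (auto simp: fun_eq_iff sum_fun_apply fun_scale_def)

text \<open>If the supremum on \<open>E\<close> is finite, multiplication by one cutoff carries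
  \<open>E\<close> to a space of smooth functions of the same dimension whose quotients exceed it by
  at most \<open>\<tau>\<close>; then \<open>\<tau>\<close> is arbitrary.\<close>

lemma steklov_le_if:
  fixes A :: "('a::{t2_space, second_countable_topology}, 'h::euclidean_space) chart set"
  assumes tm: "two_metrics A g g' U"
    and E: "fun_space.subspace E" "fun_space.dim E = k" "E \<subseteq> dirichlet_functions A U" and k: "1 \<le> k"
  shows "steklov_eigenvalue A g' k \<le> (SUP f\<in>E - {0}. rayleigh (energy A g U f)
      (boundary_norm2 A g (domain_boundary A U \<inter> manifold_boundary A) f))" (is "_ \<le> ?S")
proof (cases ?S)
  case top
  show ?thesis unfolding top by (rule top_greatest)
next
  case (real \<Lambda>)
  obtain B where B: "B \<subseteq> E" "fun_space.independent B" "E \<subseteq> fun_space.span B" "card B = fun_space.dim E"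
    using fun_space.basis_exists by blast
  \<comment> \<open>This is where \<open>k \<ge> 1\<close> matters: \<open>card\<close> is 0 on
    infinite sets, so an infinite basis would have cardinality 0.\<close>
  have finB: "finite B" using B(4) E(2) k by (metis card.infinite not_one_le_zero)
  have span: "fun_space.span B = E" using B(1,3) E(1) by (simp add: fun_space.span_minimal subset_antisym)
  have "\<forall>b\<in>B. \<exists>f. f \<in> smooth_functions A \<and> (\<forall>x\<in>domain_boundary A U - manifold_boundary A. f x = 0) \<and>
      b = (\<lambda>x. if x \<in> closure U then f x else 0)"
    using B(1) E(3) unfolding dirichlet_functions_def by blast
  then obtain ext where ext: "\<And>b. b \<in> B \<Longrightarrow> ext b \<in> smooth_functions A \<and>
      (\<forall>x\<in>domain_boundary A U - manifold_boundary A. ext b x = 0) \<and>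
      b = (\<lambda>x. if x \<in> closure U then ext b x else 0)"
    by metis
  interpret two_metrics A g g' U by (rule tm)
  interpret dirichlet_span A g g' U B ext
  proof unfold_locales
    show "b x = (if x \<in> closure U then ext b x else 0)" if "b \<in> B" for b x
      using ext[OF that] by metis
  qed (use finB ext in auto)
  have E_comb: "E = range comb" using span_fun_space[OF finB] span by (simp add: comb_def[abs_def])
  have nz: "comb a \<noteq> 0" if a: "\<exists>b\<in>B. a b \<noteq> 0" for a
  proof
    assume "comb a = 0"
    then have "(\<Sum>b\<in>B. fun_scale (a b) b) = 0"
      by (auto simp: fun_eq_iff comb_def sum_fun_apply fun_scale_def)
    then show False using a B(2) finB fun_space.dependent_finite by blast
  qed
  show ?thesis
  proof (rule ennreal_le_epsilon)
    fix \<tau> :: real assume \<tau>: "0 < \<tau>"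
    have le: "rayleigh (energy A g U (comb a)) (boundary_norm2 A g (domain_boundary A U \<inter> manifold_boundary A) (comb a)) \<le> ennreal \<Lambda>"
      if "\<exists>b\<in>B. a b \<noteq> 0" for a
      unfolding real(2)[symmetric] by (rule SUP_upper) (use nz[OF that] E_comb in auto)
    obtain m where m: "\<And>a. \<exists>b\<in>B. a b \<noteq> 0 \<Longrightarrow> cut m a \<noteq> 0 \<and>
      rayleigh (energy A g' UNIV (cut m a)) (boundary_norm2 A g' (manifold_boundary A) (cut m a)) \<le> ennreal (\<Lambda> + \<tau>)"
      using cutoff_rayleigh[OF real(1) \<tau> le] by blast
    define \<phi> where "\<phi> f = (\<lambda>x. cutoff m (s x) * f x)" for f :: "'a \<Rightarrow> real"
    interpret \<phi>: module_hom fun_scale fun_scale \<phi>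
      by unfold_locales (auto simp: \<phi>_def fun_eq_iff fun_scale_def algebra_simps)
    have cut_\<phi>: "cut m a = \<phi> (comb a)" for a by (simp add: cut_def[abs_def] \<phi>_def)
    \<comment> \<open>Injectivity comes from the Rayleigh estimate: a combination with a nonzero
      coefficient keeps a positive boundary norm after cutting, hence is not cut to 0.\<close>
    have inj: "inj_on \<phi> (fun_space.span B)"
    proof (rule inj_onI)
      fix f h assume fh: "f \<in> fun_space.span B" "h \<in> fun_space.span B" "\<phi> f = \<phi> h"
      have "f - h \<in> E" using fh span fun_space.span_diff by metis
      then obtain a where a: "f - h = comb a" using E_comb by blast
      have "cut m a = 0" using fh(3) a cut_\<phi>[of a] \<phi>.diff[of f h] by simp
      then have "\<not> (\<exists>b\<in>B. a b \<noteq> 0)" using m by blast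
      then have "comb a = 0" by (auto simp: comb_def fun_eq_iff)
      then show "f = h" using a by simp
    qed
    have "fun_space.dim (\<phi> ` E) = card (\<phi> ` B)"
      using fun_space.dim_span_eq_card_independent[OF \<phi>.independent_injective_image[OF B(2) inj]]
        \<phi>.span_image[of B] span by simp
    also have "card (\<phi> ` B) = k"
      using card_image[OF inj_on_subset[OF inj fun_space.span_superset]] B(4) E(2) by simp
    finally have dim: "fun_space.dim (\<phi> ` E) = k" .
    have "\<phi> ` E \<subseteq> smooth_functions A" using smooth_cut[of m] cut_\<phi> E_comb by auto
    then have "steklov_eigenvalue A g' k \<le> (SUP f\<in>\<phi> ` E - {0}. rayleigh (energy A g' UNIV f) (boundary_norm2 A g' (manifold_boundary A) f))"
      unfolding steklov_eigenvalue_def using dim \<phi>.subspace_image[OF E(1)] by (intro INF_lower) blast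
    also have "\<dots> \<le> ennreal (\<Lambda> + \<tau>)"
    proof (rule SUP_least)
      fix f assume f: "f \<in> \<phi> ` E - {0}"
      then obtain a where a: "f = cut m a" using E_comb cut_\<phi> by auto
      have "\<exists>b\<in>B. a b \<noteq> 0"
      proof (rule ccontr)
        assume "\<not> ?thesis"
        then have "f = 0" unfolding a by (auto simp: fun_eq_iff cut_def comb_def)
        then show False using f by simp
      qed
      then show "rayleigh (energy A g' UNIV f) (boundary_norm2 A g' (manifold_boundary A) f) \<le> ennreal (\<Lambda> + \<tau>)"
        unfolding a using m by blast
    qed
    also have "\<dots> = ?S + ennreal \<tau>" using real \<tau> by (simp add: ennreal_plus)
    finally show "steklov_eigenvalue A g' k \<le> ?S + ennreal \<tau>" .
  qed
qed

theorem proposition1p2: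
  fixes A :: "('a::{t2_space, second_countable_topology}, 'h::euclidean_space) chart set"
    and g g' :: "'a metric_field"
    and p :: 'a and \<epsilon> :: real and k :: nat
  assumes "compact_riemannian_manifold A g"
    and "manifold_boundary A \<noteq> {}"
    and "p \<in> manifold_boundary A"
    and "0 < \<epsilon>"
    and "riemannian_metric A g'"
    and "metrics_agree_on A (riemannian_ball A g p \<epsilon>) g g'"
    and "1 \<le> k"
  shows "steklov_eigenvalue A g' k \<le> mixed_eigenvalue A g (riemannian_ball A g p \<epsilon>) k"
proof -
  have M: "compact (UNIV :: 'a set)" "smooth_atlas A" "riemannian_metric A g"
    using assms(1) by (simp_all add: compact_riemannian_manifold_def)
  interpret g: compact_riemannian A g by unfold_locales (use M in auto)
  interpret g': compact_riemannian A g' by unfold_locales (use M assms in auto)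
  have "two_metrics A g g' (riemannian_ball A g p \<epsilon>)"
    by unfold_locales (use assms(6) g.open_riemannian_ball in auto)
  then show ?thesis
    unfolding mixed_eigenvalue_def by (intro INF_greatest steklov_le_if) (use assms(7) in auto)
qed

end
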